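(* Let $(S_n)_{n\ge 0}$ be an ERWG process whose memory matrix $B$ is diagonalisable over $\mathbb{C}$, say $T^{-1}BT=\mathrm{diag}(\lambda_1,\dots,\lambda_k)$ with $T\in\mathbb{C}^{k\times k}$ invertible. Suppose $\eta\le\frac12$. Then there exist a probability space on which the entire sequence $(S_n)_{n\ge0}$ is redefined without changing its distribution and, on the same space, a sequence $(Y_n)_{n\ge1}$ of i.i.d. $\mathcal{N}_k(0,I)$ random (row) vectors such that, for some $\delta>0$, $$S_n=\begin{cases}\sum_{j=1}^n Y_j\left(\frac jn\right)^{-B}+O\big(n^{\frac12-\delta}\big)\ \text{a.s.} & \text{if }\eta<\frac12,\\[4pt] \sum_{j=1}^n Y_j\left(\frac jn\right)^{-B}+O\big(n^{\frac12}\big)\ \text{a.s.} & \text{if }\eta=\frac12.\end{cases}$$ Further, if $B$ is diagonalisable over $\mathbb{R}$ (i.e. $T$ and $\lambda_1,\dots,\lambda_k$ can be and are taken real), then $$S_n=\sum_{j=1}^n Y_j\left(\frac jn\right)^{-B}+\epsilon_nT^{-1}\quad\text{a.s.},$$ where $\epsilon_n=(\epsilon_n^{(1)},\dots,\epsilon_n^{(k)})$ satisfies $\epsilon_n^{(j)}=O(n^{\frac12-\delta_j})$ a.s. for all $j=1,\dots,k$, with $\delta_j>0$ if $\lambda_j<\frac12$ and $\delta_j=0$ if $\lambda_j=\frac12$.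
   Context: ERWG model. Let $k\ge1$, $V=\{1,\dots,k\}$, and let $(V,\overrightarrow{E})$, $\overrightarrow{E}\subseteq V\times V$, be a directed graph (self-loops allowed) in which every vertex $j$ has in-degree $d_j^{\rm in}=|\{i:(i,j)\in\overrightarrow{E}\}|\ge1$. Let $p_v,q_v\in[0,1]$ for $v\in V$. $\mathrm{Rad}(p)$ is the law on $\{-1,1\}$ giving mass $p$ to $1$. Let $\{\sigma^{(v)},\xi_n^{(v)},D_n^{(v)},u_n^{(v)}: n\ge1,v\in V\}$ be independent with $\sigma^{(v)}\sim\mathrm{Rad}(q_v)$, $\xi_n^{(v)}\sim\mathrm{Rad}(p_v)$, $D_n^{(v)}\sim\mathrm{Unif}\{1,\dots,n\}$, $u_n^{(v)}\sim\mathrm{Unif}\{v':(v',v)\in\overrightarrow{E}\}$. Define $X_1^{(v)}=\sigma^{(v)}$ and, for $n\ge1$, $X_{n+1}^{(v)}=\xi_n^{(v)}X^{(u_n^{(v)})}_{D_n^{(v)}}$; set $X_n=(X_n^{(1)},\dots,X_n^{(k)})$, $S_0=0$, $S_n=\sum_{j=1}^nX_j$. The process $(S_n)$ is called the ERWG process. Its memory matrix is the $k\times k$ matrix $B$ with $B_{i,j}=\frac{2p_j-1}{d_j^{\rm in}}\mathbf{1}_{\{(i,j)\in\overrightarrow{E}\}}$. Let $\lambda_1,\dots,\lambda_k$ be the eigenvalues of $B$ (with multiplicity) and $\eta=\max_j\Re(\lambda_j)$. All vectors are row vectors; $I$ is the identity matrix. For $x>0$ and a square matrix $A$, $x^A=\exp((\log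 x)A)$. $O(\cdot)$ is as $n\to\infty$, and "a.s." means the bound holds almost surely with a possibly random constant. *)

theory Defs
  imports "HOL-Probability.Probability" "HOL-Library.Landau_Symbols"
begin

text \<open>The vertex set is a finite type \<open>'v\<close>, so \<open>k = CARD('v)\<close>. Vectors are row vectors and act
  on matrices from the left by \<open>v*\<close>.\<close>

definition in_nbrs :: "('v \<times> 'v) set \<Rightarrow> 'v \<Rightarrow> 'v set" where
  "in_nbrs E v = {v'. (v', v) \<in> E}"

definition rad_pmf :: "real \<Rightarrow> int pmf" where
  "rad_pmf p = map_pmf (\<lambda>b. if b then 1 else - 1) (bernoulli_pmf p)"

datatype 'v innov_index =
    Start 'v
  | Flip nat 'v
  | Memory nat 'v
  | Nbr nat 'v

text \<open>The innovations take values in three different types. As \<open>indep_vars\<close> needs a common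
  codomain, they are injected into the countable sum \<open>int + nat + 'v\<close>, which does not change the
  sigma-algebras that they generate.\<close>

definition innov_family ::
  "('v \<Rightarrow> 'a \<Rightarrow> int) \<Rightarrow> (nat \<Rightarrow> 'v \<Rightarrow> 'a \<Rightarrow> int) \<Rightarrow> (nat \<Rightarrow> 'v \<Rightarrow> 'a \<Rightarrow> nat) \<Rightarrow> (nat \<Rightarrow> 'v \<Rightarrow> 'a \<Rightarrow> 'v)
    \<Rightarrow> 'v innov_index \<Rightarrow> 'a \<Rightarrow> int + nat + 'v" where
  "innov_family \<sigma> \<xi> D u i \<omega> = (case i of
      Start v \<Rightarrow> Inl (\<sigma> v \<omega>)
    | Flip n v \<Rightarrow> Inl (\<xi> n v \<omega>)
    | Memory n v \<Rightarrow> Inr (Inl (D n v \<omega>))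
    | Nbr n v \<Rightarrow> Inr (Inr (u n v \<omega>)))"

definition innov_indices :: "'v innov_index set" where
  "innov_indices = {Start v | v. True} \<union>
     {i. \<exists>n\<ge>1. \<exists>v. i = Flip n v \<or> i = Memory n v \<or> i = Nbr n v}"

definition erwg_innovations ::
  "'a measure \<Rightarrow> ('v \<times> 'v) set \<Rightarrow> ('v \<Rightarrow> real) \<Rightarrow> ('v \<Rightarrow> real) \<Rightarrow> ('v \<Rightarrow> 'a \<Rightarrow> int)
    \<Rightarrow> (nat \<Rightarrow> 'v \<Rightarrow> 'a \<Rightarrow> int) \<Rightarrow> (nat \<Rightarrow> 'v \<Rightarrow> 'a \<Rightarrow> nat) \<Rightarrow> (nat \<Rightarrow> 'v \<Rightarrow> 'a \<Rightarrow> 'v) \<Rightarrow> bool" where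
  "erwg_innovations M E p q \<sigma> \<xi> D u \<longleftrightarrow>
     prob_space.indep_vars M (\<lambda>_. count_space UNIV) (innov_family \<sigma> \<xi> D u) innov_indices \<and>
     (\<forall>v. distr M (count_space UNIV) (\<sigma> v) = measure_pmf (rad_pmf (q v))) \<and>
     (\<forall>n\<ge>1. \<forall>v.
        distr M (count_space UNIV) (\<xi> n v) = measure_pmf (rad_pmf (p v)) \<and>
        distr M (count_space UNIV) (D n v) = measure_pmf (pmf_of_set {1..n}) \<and>
        distr M (count_space UNIV) (u n v) = measure_pmf (pmf_of_set (in_nbrs E v)))"

text \<open>The recursion for the steps is only required almost surely: \<open>D n v\<close> may leave \<open>{1..n}\<close> on a
  null event, where the recursion would not be well-founded.\<close>

definition erwg_process ::
  "'a measure \<Rightarrow> ('v::finite \<times> 'v) set \<Rightarrow> ('v \<Rightarrow> real) \<Rightarrow> ('v \<Rightarrow> real)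
    \<Rightarrow> (nat \<Rightarrow> 'a \<Rightarrow> real ^ 'v) \<Rightarrow> bool" where
  "erwg_process M E p q S \<longleftrightarrow> prob_space M \<and>
     (\<exists>\<sigma> \<xi> D u (X :: nat \<Rightarrow> 'v \<Rightarrow> 'a \<Rightarrow> int).
        erwg_innovations M E p q \<sigma> \<xi> D u \<and>
        (\<forall>n\<ge>1. \<forall>v. X n v \<in> measurable M (count_space UNIV)) \<and>
        (AE \<omega> in M. \<forall>v. X 1 v \<omega> = \<sigma> v \<omega>) \<and>
        (AE \<omega> in M. \<forall>n\<ge>1. \<forall>v. X (n + 1) v \<omega> = \<xi> n v \<omega> * X (D n v \<omega>) (u n v \<omega>) \<omega>) \<and>
        (\<forall>n. \<forall>\<omega>\<in>space M. S n \<omega> = (\<Sum>j=1..n. \<chi> v. real_of_int (X j v \<omega>))))"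

definition memory_matrix :: "('v::finite \<times> 'v) set \<Rightarrow> ('v \<Rightarrow> real) \<Rightarrow> real ^ 'v ^ 'v" where
  "memory_matrix E p =
     (\<chi> i j. if (i, j) \<in> E then (2 * p j - 1) / real (card (in_nbrs E j)) else 0)"

definition diag_mat :: "('n \<Rightarrow> 'a::zero) \<Rightarrow> 'a ^ 'n ^ 'n" where
  "diag_mat l = (\<chi> i j. if i = j then l i else 0)"

definition eigvals :: "real ^ 'n ^ 'n \<Rightarrow> complex set" where
  "eigvals A = {\<mu>. \<exists>x. x \<noteq> 0 \<and> map_matrix complex_of_real A *v x = \<mu> *s x}"

definition max_Re_eigval :: "real ^ 'n ^ 'n \<Rightarrow> real" where
  "max_Re_eigval A = Max (Re ` eigvals A)"

text \<open>On \<open>real ^ 'n ^ 'n\<close> the operations \<open>*\<close> and \<open>^\<close> of the library are entrywise, and \<open>exp\<close> is not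
  available. Powers with respect to \<open>**\<close> and the exponential series are therefore defined here.\<close>

primrec mat_pow :: "real ^ 'n ^ 'n \<Rightarrow> nat \<Rightarrow> real ^ 'n ^ 'n" where
  "mat_pow A 0 = mat 1"
| "mat_pow A (Suc m) = A ** mat_pow A m"

definition mat_exp :: "real ^ 'n ^ 'n \<Rightarrow> real ^ 'n ^ 'n" where
  "mat_exp A = (\<Sum>m. (1 / fact m) *\<^sub>R mat_pow A m)"

definition mat_powr :: "real \<Rightarrow> real ^ 'n ^ 'n \<Rightarrow> real ^ 'n ^ 'n" where
  "mat_powr x A = mat_exp (ln x *\<^sub>R A)"

definition std_mvn_density :: "real ^ 'n \<Rightarrow> real" where
  "std_mvn_density x = exp (- (norm x)\<^sup>2 / 2) / sqrt ((2 * pi) ^ CARD('n))"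

definition iid_std_mvn :: "'a measure \<Rightarrow> (nat \<Rightarrow> 'a \<Rightarrow> real ^ 'n) \<Rightarrow> bool" where
  "iid_std_mvn M Y \<longleftrightarrow>
     prob_space.indep_vars M (\<lambda>_. borel) Y {1..} \<and>
     (\<forall>n\<ge>1. distributed M lborel (Y n) (\<lambda>x. ennreal (std_mvn_density x)))"

definition same_law ::
  "'a measure \<Rightarrow> (nat \<Rightarrow> 'a \<Rightarrow> real ^ 'n) \<Rightarrow> 'b measure \<Rightarrow> (nat \<Rightarrow> 'b \<Rightarrow> real ^ 'n) \<Rightarrow> bool" where
  "same_law M S M' S' \<longleftrightarrow>
     distr M (PiM UNIV (\<lambda>_. borel)) (\<lambda>\<omega> n. S n \<omega>) =
     distr M' (PiM UNIV (\<lambda>_. borel)) (\<lambda>\<omega> n. S' n \<omega>)"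

definition gauss_sum ::
  "real ^ 'n ^ 'n \<Rightarrow> (nat \<Rightarrow> 'a \<Rightarrow> real ^ 'n) \<Rightarrow> nat \<Rightarrow> 'a \<Rightarrow> real ^ 'n" where
  "gauss_sum B Y n \<omega> = (\<Sum>j=1..n. Y j \<omega> v* mat_powr (real j / real n) (- B))"

end

theory Submission
  imports Defs
begin

text \<open>
  Given the past, the coordinates of the step \<open>X\<^bsub>n+1\<^esub>\<close> are independent signs with means
  \<open>a\<^sub>n = S\<^sub>n B / n\<close>. They can be produced from independent Rademacher variables \<open>R\<^bsub>n+1\<^esub>\<close> and
  uniform variables \<open>W\<^bsub>n+1\<^esub>\<close> by overwriting \<open>R\<^bsub>n+1\<^esub>\<close> with the sign of \<open>a\<^sub>n\<close> whenever
  \<open>W\<^bsub>n+1\<^esub> < |a\<^sub>n|\<close>. Then \<open>S\<^bsub>n+1\<^esub> = S\<^sub>n (I + B / n) + R\<^bsub>n+1\<^esub> + \<Delta>\<^bsub>n+1\<^esub>\<close> with martingale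
  differences \<open>\<Delta>\<^bsub>n+1\<^esub>\<close> whose conditional variance is at most a multiple of \<open>|a\<^sub>n|\<close>. A second moment
  recursion gives \<open>E|a\<^sub>n| = O(n\<^bsup>-1/4\<^esup>)\<close>, so that the sums of the \<open>\<Delta>\<^sub>j\<close> are \<open>O(n\<^bsup>31/64\<^esup>)\<close> by a
  maximal inequality.

  The Rademacher variables are functions of the normal variables \<open>Y\<^sub>j\<close>. On each block
  \<open>i\<^bsup>16\<^esup> < j \<le> (i+1)\<^bsup>16\<^esup>\<close> the vector of the \<open>R\<^sub>j\<close> is read off from the sum of the \<open>Y\<^sub>j\<close> in such a way
  that the sum of the \<open>R\<^sub>j\<close> is a monotone function of it. A Lindeberg argument for smoothed Lipschitz
  functions bounds the mean distance of the two sums over a block of length \<open>m\<close> by a multiple of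
  \<open>m\<^bsup>1/3\<^esup>\<close>, whence the sums of the \<open>R\<^sub>j - Y\<^sub>j\<close> are \<open>O(n\<^bsup>31/64\<^esup>)\<close> as well.

  Along an eigenvector of \<open>B\<close> for \<open>\<lambda>\<close>, both \<open>S\<^sub>n\<close> and the weighted sum of the \<open>Y\<^sub>j\<close> follow the
  scalar recursion with factors \<open>(1 + 1/n)\<^bsup>\<lambda>\<^esup>\<close>, up to an \<open>O(1/n)\<close> term, and a discrete Gronwall
  inequality bounds their difference. The exponent \<open>31/64\<close> is a choice: it has to be less than
  \<open>1/2\<close> and, doubled, exceed both the exponent \<open>15/16\<close> of the block length and the exponent
  \<open>7/8\<close> of the second moment of the sums of the \<open>\<Delta>\<^sub>j\<close>.
\<close>

section \<open>Growth of perturbed linear recursions\<close>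

text \<open>The obstacle is that a sign \<open>rad n\<close> is read off from the sum over its whole
  block, so it anticipates later normal variables, and the normal sequence cannot serve as the
  filtration of the walk. Therefore all conditioning refers to the past of the family
  \<open>Z\<close> of signs and uniform variables, which is again independent, while signs and
  normal variables are compared only path by path, through partial sums. With the normal variables
  given and the signs constructed from them, the independence of the vectors \<open>Y\<close> is
  immediate; what has to be shown is that the signs are independent and that the walk built on them
  has the original law, by comparing the probabilities of finite paths. The block length is a
  compromise: in long blocks the two sums drift apart before the next matching time, whereas short
  blocks accumulate coupling errors, here of order i^5 for block i, which sum almost surely to
  O(i^7) = O(n^(7/16)). Noise of smaller order than n^(1/2) is amplified to at most n^(1/2) by an
  eigenvalue with real part 1/2. This is where the rate of the critical case comes from.\<close>

lemma one_plus_inverse_powr: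
  assumes "n \<ge> (1::nat)"
  shows "(1 + 1 / real n) powr \<mu> * real n powr \<mu> = real (Suc n) powr \<mu>"
proof -
  have "real (Suc n) = (1 + 1 / real n) * real n" using assms by (simp add: field_simps)
  then show ?thesis using assms by (metis add_nonneg_nonneg divide_nonneg_nonneg of_nat_0_le_iff powr_mult zero_le_one)
qed

text \<open>After division by n^\<mu>, the recursion only allows increments of size C n^(\<kappa> -
  \<mu> - 1), which are summable because \<kappa> < \<mu>. The strict inequality is what avoids a
  logarithm.\<close>

lemma growth_bound:
  fixes z :: "nat \<Rightarrow> real"
  assumes z: "\<And>n. z n \<ge> 0" and C: "C \<ge> 0" and \<kappa>: "\<kappa> < \<mu>" and \<mu>: "\<mu> \<ge> 0" and n0: "n0 \<ge> 1"
    and rec: "\<And>n. n \<ge> n0 \<Longrightarrow> z (Suc n) \<le> (1 + 1 / real n) powr \<mu> * z n + C * real n powr (\<kappa> - 1)"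
  shows "\<exists>K\<ge>0. \<forall>n\<ge>1. z n \<le> K * real n powr \<mu>"
proof -
  define w where "w n = z n / real n powr \<mu>" for n
  define g where "g n = real n powr (\<kappa> - \<mu> - 1)" for n :: nat
  have sg: "summable g" unfolding g_def using \<kappa> by (subst summable_real_powr_iff) auto
  have w_nonneg: "w n \<ge> 0" for n using z by (simp add: w_def)
  have step: "w (Suc n) \<le> w n + C * g n" if "n \<ge> n0" for n
  proof -
    have n: "n \<ge> 1" using that n0 by simp
    define b where "b = (1 + 1 / real n) powr \<mu>"
    have b: "b > 0" "b * real n powr \<mu> = real (Suc n) powr \<mu>"
      using one_plus_inverse_powr[OF n, of \<mu>] n by (auto simp: b_def add_pos_nonneg)
    have le: "real n powr \<mu> \<le> real (Suc n) powr \<mu>" using \<mu> by (intro powr_mono2) auto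
    have np: "real n powr \<mu> > 0" using n by simp
    have "w (Suc n) \<le> (b * z n + C * real n powr (\<kappa> - 1)) / real (Suc n) powr \<mu>"
      unfolding w_def b_def using rec[OF that] by (intro divide_right_mono) auto
    also have "\<dots> = b * z n / (b * real n powr \<mu>) + C * real n powr (\<kappa> - 1) / real (Suc n) powr \<mu>"
      by (simp add: add_divide_distrib b(2))
    also have "b * z n / (b * real n powr \<mu>) = w n" using b(1) by (simp add: w_def)
    also have "C * real n powr (\<kappa> - 1) / real (Suc n) powr \<mu> \<le> C * real n powr (\<kappa> - 1) / real n powr \<mu>"
      using le np C by (intro divide_left_mono) auto
    also have "\<dots> = C * g n" using n by (simp add: g_def powr_diff powr_add)
    finally show ?thesis by simp
  qed
  have bound: "w (n0 + k) \<le> w n0 + C * (\<Sum>i<k. g (n0 + i))" for k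
  proof (induction k)
    case (Suc k)
    then show ?case using step[of "n0 + k"] by (simp add: algebra_simps)
  qed simp
  define G where "G = suminf (\<lambda>i. g (n0 + i))"
  have "summable (\<lambda>i. g (n0 + i))" using sg by (simp add: add.commute summable_iff_shift)
  then have "(\<Sum>i<k. g (n0 + i)) \<le> G" for k
    unfolding G_def by (rule sum_le_suminf) (auto simp: g_def)
  then have bound2: "w (n0 + k) \<le> w n0 + C * G" for k
    using bound[of k] C by (smt (verit) mult_left_mono)
  \<comment> \<open>The finite sum takes care of the indices below \<open>n0\<close>, about which
    the recursion says nothing.\<close>
  define K where "K = \<bar>w n0 + C * G\<bar> + (\<Sum>n<n0. w n)"
  have "w n \<le> K" for n
  proof (cases "n < n0")
    case True
    then have "w n \<le> (\<Sum>n<n0. w n)" using w_nonneg by (intro member_le_sum) auto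
    then show ?thesis by (simp add: K_def)
  next
    case False
    then have "w n \<le> w n0 + C * G" using bound2[of "n - n0"] by simp
    moreover have "(\<Sum>n<n0. w n) \<ge> 0" using w_nonneg by (intro sum_nonneg) auto
    ultimately show ?thesis by (simp add: K_def)
  qed
  then have "z n \<le> K * real n powr \<mu>" if "n \<ge> 1" for n
  proof -
    have "real n powr \<mu> > 0" using that by simp
    then show ?thesis using \<open>\<And>n. w n \<le> K\<close>[of n] unfolding w_def by (subst (asm) pos_divide_le_eq) auto
  qed
  moreover have "K \<ge> 0" using w_nonneg[of n0] by (auto simp: K_def intro!: add_nonneg_nonneg sum_nonneg w_nonneg)
  ultimately show ?thesis by blast
qed

section \<open>Complex powers of 1 + 1/n and the scalar recursion\<close>

lemma norm_exp_minus_one_le: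
  fixes z :: complex
  shows "norm (exp z - 1) \<le> norm z * exp (norm z)"
  using Taylor_exp_field[of z 0] by (simp add: mult.commute)

lemma norm_exp_minus_one_minus_le:
  fixes z :: complex
  shows "norm (exp z - 1 - z) \<le> (norm z)\<^sup>2 * exp (norm z)"
  using Taylor_exp_field[of z 1] by (simp add: mult.commute power2_eq_square diff_diff_add)

lemma ln_one_plus_inverse_le: "n \<ge> 1 \<Longrightarrow> ln (1 + 1 / real n) \<le> 1 / real n"
  by (rule ln_add_one_self_le_self) simp

lemma ln_one_plus_inverse_ge: "n \<ge> 1 \<Longrightarrow> ln (1 + 1 / real n) \<ge> 1 / real n - 1 / (real n)\<^sup>2"
  using ln_one_plus_pos_lower_bound[of "1 / real n"] by (simp add: power_one_over)

text \<open>This is (1 + 1/n)^l, the factor by which a weight (j/n)^(-l) changes when n is replaced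
  by n + 1.\<close>

definition ratio_pow :: "complex \<Rightarrow> nat \<Rightarrow> complex" where
  "ratio_pow l n = exp (of_real (ln (1 + 1 / real n)) * l)"

lemma norm_ratio_pow: "n \<ge> 1 \<Longrightarrow> norm (ratio_pow l n) = (1 + 1 / real n) powr Re l"
  using add_pos_nonneg[of 1 "1 / real n"] by (simp add: ratio_pow_def norm_exp_eq_Re powr_def mult.commute)

lemma ratio_pow_minus_one:
  assumes "n \<ge> 1"
  shows "norm (ratio_pow l n - 1) \<le> norm l * exp (norm l) / real n"
proof -
  define x where "x = ln (1 + 1 / real n)"
  have x: "0 \<le> x" "x \<le> 1 / real n" "1 / real n \<le> 1"
    using assms ln_one_plus_inverse_le[OF assms] by (auto simp: x_def)
  have nx: "norm (of_real x * l) = x * norm l" using x by (simp add: norm_mult)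
  have "norm (ratio_pow l n - 1) \<le> norm (of_real x * l) * exp (norm (of_real x * l))"
    unfolding ratio_pow_def x_def[symmetric] by (rule norm_exp_minus_one_le)
  also have "\<dots> \<le> (1 / real n * norm l) * exp (1 * norm l)"
    unfolding nx using x by (intro mult_mono) (auto intro!: mult_right_mono mult_left_le_one_le)
  finally show ?thesis by (simp add: field_simps)
qed

text \<open>The walk produces the factor 1 + l/n and the weighted normal sum the factor
  \<open>ratio_pow l n\<close>. Since the walk is O(n), a gap of order 1/n^2 costs only a forcing
  term of order 1/n.\<close>

lemma ratio_pow_minus_linear:
  assumes "n \<ge> 1"
  shows "norm (1 + l / of_nat n - ratio_pow l n) \<le> (norm l + (norm l)\<^sup>2 * exp (norm l)) / (real n)\<^sup>2"
proof -
  define x where "x = ln (1 + 1 / real n)"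
  have x: "0 \<le> x" "x \<le> 1 / real n" "1 / real n \<le> 1" "1 / real n - x \<le> 1 / (real n)\<^sup>2"
    using assms ln_one_plus_inverse_le[OF assms] ln_one_plus_inverse_ge[OF assms] by (auto simp: x_def)
  have nx: "norm (of_real x * l) = x * norm l" using x by (simp add: norm_mult)
  have "norm (exp (of_real x * l) - 1 - of_real x * l) \<le> (x * norm l)\<^sup>2 * exp (x * norm l)"
    using norm_exp_minus_one_minus_le[of "of_real x * l"] unfolding nx .
  also have "\<dots> \<le> (1 / real n * norm l)\<^sup>2 * exp (1 * norm l)"
    using x by (intro mult_mono power_mono) (auto intro!: mult_right_mono mult_left_le_one_le)
  finally have 1: "norm (exp (of_real x * l) - 1 - of_real x * l) \<le> (norm l)\<^sup>2 * exp (norm l) / (real n)\<^sup>2"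
    by (simp add: power_divide)
  have "norm (of_real (1 / real n - x) * l) = (1 / real n - x) * norm l"
    using x by (simp only: norm_mult norm_of_real)
  also have "\<dots> \<le> norm l / (real n)\<^sup>2" using mult_right_mono[OF x(4) norm_ge_zero[of l]] by simp
  finally have 2: "norm (of_real (1 / real n - x) * l) \<le> norm l / (real n)\<^sup>2" .
  have "1 + l / of_nat n - ratio_pow l n
      = of_real (1 / real n - x) * l - (exp (of_real x * l) - 1 - of_real x * l)"
    using assms by (simp add: ratio_pow_def x_def algebra_simps)
  then have "norm (1 + l / of_nat n - ratio_pow l n)
      \<le> norm (of_real (1 / real n - x) * l) + norm (exp (of_real x * l) - 1 - of_real x * l)"
    by (simp only: norm_triangle_ineq4)
  also have "\<dots> \<le> norm l / (real n)\<^sup>2 + (norm l)\<^sup>2 * exp (norm l) / (real n)\<^sup>2" using 1 2 by simp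
  finally show ?thesis by (simp add: add_divide_distrib)
qed

text \<open>The increments of \<open>N\<close> may be of order one; only \<open>N\<close> itself is
  small. Passing to \<open>e n - N n\<close>, a summation by parts, trades the increment for
  \<open>(ratio_pow l n - 1) * N n\<close>, which is O(n^(\<kappa> - 1)) as
  \<open>growth_bound\<close> demands.\<close>

lemma scalar_recursion_bound:
  fixes e N \<rho> :: "nat \<Rightarrow> complex"
  assumes rec: "\<And>n. n \<ge> 1 \<Longrightarrow> e (Suc n) = ratio_pow l n * e n + (N (Suc n) - N n) + \<rho> n"
    and N: "\<And>n. n \<ge> 1 \<Longrightarrow> norm (N n) \<le> C * real n powr \<kappa>"
    and \<rho>: "\<And>n. n \<ge> 1 \<Longrightarrow> norm (\<rho> n) \<le> D / real n"
    and \<kappa>: "0 \<le> \<kappa>" "\<kappa> < \<mu>" and l: "Re l \<le> \<mu>"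
  shows "\<exists>K\<ge>0. \<forall>n\<ge>1. norm (e n) \<le> K * real n powr \<mu>"
proof -
  have C: "C \<ge> 0" using order_trans[OF norm_ge_zero N[of 1]] by simp
  have D: "D \<ge> 0" using order_trans[OF norm_ge_zero \<rho>[of 1]] by simp
  define L where "L = norm l * exp (norm l)"
  have L: "L \<ge> 0" by (simp add: L_def)
  have "\<exists>K\<ge>0. \<forall>n\<ge>1. norm (e n - N n) \<le> K * real n powr \<mu>"
  proof (rule growth_bound[of "\<lambda>n. norm (e n - N n)" "L * C + D" \<kappa> \<mu> 1])
    fix n :: nat assume n: "n \<ge> 1"
    have "e (Suc n) - N (Suc n) = ratio_pow l n * (e n - N n) + (ratio_pow l n - 1) * N n + \<rho> n"
      using rec[OF n] by (simp add: algebra_simps)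
    then have "norm (e (Suc n) - N (Suc n)) \<le>
        norm (ratio_pow l n) * norm (e n - N n) + norm (ratio_pow l n - 1) * norm (N n) + norm (\<rho> n)"
      by (metis (no_types, lifting) add_right_mono norm_mult norm_triangle_le norm_triangle_mono order_refl)
    also have "\<dots> \<le> (1 + 1 / real n) powr \<mu> * norm (e n - N n) + (L / real n) * (C * real n powr \<kappa>) + D * real n powr (\<kappa> - 1)"
    proof (intro add_mono mult_mono)
      show "norm (ratio_pow l n) \<le> (1 + 1 / real n) powr \<mu>"
        unfolding norm_ratio_pow[OF n] using l by (intro powr_mono) auto
      show "norm (ratio_pow l n - 1) \<le> L / real n" unfolding L_def by (rule ratio_pow_minus_one[OF n])
      have "1 / real n \<le> real n powr (\<kappa> - 1)"
        using n \<kappa> powr_mono[of "-1" "\<kappa> - 1" "real n"] by (simp add: powr_minus divide_inverse)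
      from mult_left_mono[OF this D] show "norm (\<rho> n) \<le> D * real n powr (\<kappa> - 1)" using \<rho>[OF n] by simp
    qed (use N n L in auto)
    also have "(L / real n) * (C * real n powr \<kappa>) = L * C * real n powr (\<kappa> - 1)"
      using n by (simp add: powr_diff)
    finally show "norm (e (Suc n) - N (Suc n)) \<le> (1 + 1 / real n) powr \<mu> * norm (e n - N n) + (L * C + D) * real n powr (\<kappa> - 1)"
      by (simp add: algebra_simps)
  qed (use C D L \<kappa> in auto)
  then obtain K where K: "K \<ge> 0" "\<And>n. n \<ge> 1 \<Longrightarrow> norm (e n - N n) \<le> K * real n powr \<mu>" by blast
  have "norm (e n) \<le> (K + C) * real n powr \<mu>" if n: "n \<ge> 1" for n
  proof -
    have "real n powr \<kappa> \<le> real n powr \<mu>" using \<kappa> n by (intro powr_mono) auto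
    then have "norm (N n) \<le> C * real n powr \<mu>" using N[OF n] C by (meson mult_left_mono order_trans)
    then show ?thesis using K(2)[OF n] norm_triangle_sub[of "e n" "N n"] by (simp add: algebra_simps)
  qed
  then show ?thesis using K(1) C by (intro exI[of _ "K + C"]) auto
qed

section \<open>Matrix powers on eigenvectors\<close>

definition pair_col :: "real ^ 'n \<Rightarrow> complex ^ 'n \<Rightarrow> complex" where
  "pair_col y c = (\<Sum>i\<in>UNIV. of_real (y $ i) * c $ i)"

text \<open>The column \<open>c\<close> is a right eigenvector of \<open>A\<close>, expressed by the action of \<open>A\<close> on real row vectors.\<close>

definition eigcol :: "real ^ 'n ^ 'n \<Rightarrow> complex ^ 'n \<Rightarrow> complex \<Rightarrow> bool" where
  "eigcol A c l \<longleftrightarrow> (\<forall>y. pair_col (y v* A) c = l * pair_col y c)"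

lemma pair_col_add: "pair_col (x + y) c = pair_col x c + pair_col y c"
  by (simp add: pair_col_def distrib_right sum.distrib)

lemma pair_col_scaleR: "pair_col (r *\<^sub>R x) c = of_real r * pair_col x c"
  by (simp add: pair_col_def sum_distrib_left mult.assoc)

lemma linear_pair_col: "linear (\<lambda>y. pair_col y c)"
  by (rule linearI) (simp_all add: pair_col_add pair_col_scaleR scaleR_conv_of_real[where 'a = complex])

lemma pair_col_diff: "pair_col (x - y) c = pair_col x c - pair_col y c"
  using linear_diff[OF linear_pair_col] .

lemma pair_col_sum: "pair_col (\<Sum>i\<in>I. f i) c = (\<Sum>i\<in>I. pair_col (f i) c)"
  using linear_sum[OF linear_pair_col] .

lemma norm_pair_col_le: "\<exists>K\<ge>0. \<forall>y. norm (pair_col y c) \<le> K * norm y"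
proof -
  obtain K where "K > 0" "\<And>y. norm (pair_col y c) \<le> norm y * K"
    using bounded_linear.pos_bounded linear_conv_bounded_linear linear_pair_col by blast
  then show ?thesis by (intro exI[of _ K]) (auto simp: mult.commute)
qed

lemma mat_pow_entry_le:
  "\<bar>mat_pow A m $ i $ j\<bar> \<le> (\<Sum>i\<in>UNIV. \<Sum>j\<in>UNIV. \<bar>A $ i $ j\<bar>) ^ m"
proof (induction m arbitrary: i j)
  case 0
  then show ?case by (simp add: mat_def)
next
  case (Suc m)
  let ?c = "\<Sum>i\<in>UNIV. \<Sum>j\<in>UNIV. \<bar>A $ i $ j\<bar>"
  have c: "?c \<ge> 0" by (intro sum_nonneg) auto
  have "\<bar>mat_pow A (Suc m) $ i $ j\<bar> = \<bar>\<Sum>k\<in>UNIV. A $ i $ k * mat_pow A m $ k $ j\<bar>"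
    by (simp add: matrix_matrix_mult_def)
  also have "\<dots> \<le> (\<Sum>k\<in>UNIV. \<bar>A $ i $ k\<bar> * ?c ^ m)"
    by (rule order_trans[OF sum_abs], intro sum_mono) (auto simp: abs_mult intro!: mult_left_mono Suc)
  also have "\<dots> = (\<Sum>k\<in>UNIV. \<bar>A $ i $ k\<bar>) * ?c ^ m" by (simp add: sum_distrib_right)
  also have "\<dots> \<le> ?c * ?c ^ m"
    using c by (intro mult_right_mono member_le_sum[of i UNIV "\<lambda>i. \<Sum>j\<in>UNIV. \<bar>A $ i $ j\<bar>"]) (auto intro: sum_nonneg)
  finally show ?case by simp
qed

lemma norm_matrix_le: "norm (M :: real ^ 'n ^ 'm) \<le> (\<Sum>i\<in>UNIV. \<Sum>j\<in>UNIV. \<bar>M $ i $ j\<bar>)"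
proof -
  have "norm M \<le> (\<Sum>i\<in>UNIV. norm (M $ i))" by (simp add: norm_vec_def L2_set_le_sum)
  also have "\<dots> \<le> (\<Sum>i\<in>UNIV. \<Sum>j\<in>UNIV. \<bar>M $ i $ j\<bar>)" by (intro sum_mono norm_le_l1_cart)
  finally show ?thesis .
qed

lemma summable_mat_exp: "summable (\<lambda>m. (1 / fact m) *\<^sub>R mat_pow (A :: real ^ 'n ^ 'n) m)"
proof (rule summable_comparison_test')
  let ?c = "\<Sum>i\<in>UNIV. \<Sum>j\<in>UNIV. \<bar>A $ i $ j\<bar>"
  show "summable (\<lambda>m. real (CARD('n) * CARD('n)) * (inverse (fact m) * ?c ^ m))"
    by (intro summable_mult summable_exp)
  fix m :: nat assume "m \<ge> 0"
  have "norm (mat_pow A m) \<le> (\<Sum>i\<in>(UNIV :: 'n set). \<Sum>j\<in>(UNIV :: 'n set). ?c ^ m)"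
    by (rule order_trans[OF norm_matrix_le]) (intro sum_mono mat_pow_entry_le)
  then have "norm (mat_pow A m) \<le> real (CARD('n) * CARD('n)) * ?c ^ m" by simp
  then show "norm ((1 / fact m) *\<^sub>R mat_pow A m) \<le> real (CARD('n) * CARD('n)) * (inverse (fact m) * ?c ^ m)"
    by (simp add: field_simps)
qed

lemma linear_pair_col_vec_mat: "linear (\<lambda>M :: real ^ 'n ^ 'n. pair_col (y v* M) c)"
  by (rule linearI)
    (simp_all add: pair_col_def vector_matrix_mult_def sum.distrib algebra_simps scaleR_conv_of_real[where 'a = complex]
      sum_distrib_left sum_distrib_right)

lemma eigcol_mat_pow: 
  fixes A :: "real ^ 'n ^ 'n"
  shows "eigcol A c l \<Longrightarrow> eigcol (mat_pow A m) c (l ^ m)"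
proof (induction m)
  case (Suc m)
  have "y v* (A ** P) = (y v* A) v* P" for y :: "real ^ 'n" and P :: "real ^ 'n ^ 'n"
    by (simp add: vector_matrix_mul_assoc)
  then show ?case using Suc by (simp add: eigcol_def)
qed (simp add: eigcol_def)

text \<open>For fixed y and c, the pairing is a bounded linear functional of the matrix, so it may
  be applied to the exponential series term by term.\<close>

lemma eigcol_mat_exp: fixes A :: "real ^ 'n ^ 'n" assumes "eigcol A c l" shows "eigcol (mat_exp A) c (exp l)"
  unfolding eigcol_def
proof
  fix y :: "real ^ 'n"
  have bl: "bounded_linear (\<lambda>M. pair_col (y v* M) c)"
    using linear_pair_col_vec_mat[of y c] by (simp add: linear_conv_bounded_linear)
  have "(\<lambda>m. pair_col (y v* ((1 / fact m) *\<^sub>R mat_pow A m)) c) sums pair_col (y v* mat_exp A) c"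
    unfolding mat_exp_def by (rule bounded_linear.sums[OF bl summable_sums[OF summable_mat_exp]])
  moreover have "pair_col (y v* ((1 / fact m) *\<^sub>R mat_pow A m)) c = (l ^ m /\<^sub>R fact m) * pair_col y c" for m
    using eigcol_mat_pow[OF assms, of m] linear_scale[OF linear_pair_col_vec_mat[of y c], of "1 / fact m" "mat_pow A m"]
    by (simp add: eigcol_def scaleR_conv_of_real[where 'a = complex] divide_inverse)
  ultimately have "(\<lambda>m. (l ^ m /\<^sub>R fact m) * pair_col y c) sums pair_col (y v* mat_exp A) c" by simp
  moreover have "(\<lambda>m. (l ^ m /\<^sub>R fact m) * pair_col y c) sums (exp l * pair_col y c)"
    by (rule sums_mult2[OF exp_converges])
  ultimately show "pair_col (y v* mat_exp A) c = exp l * pair_col y c" by (rule sums_unique2)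
qed

lemma eigcol_mat_powr:
  assumes "eigcol B c l"
  shows "eigcol (mat_powr x (- B)) c (exp (of_real (- ln x) * l))"
  unfolding mat_powr_def
proof (rule eigcol_mat_exp)
  have "pair_col (y v* (ln x *\<^sub>R - B)) c = of_real (- ln x) * pair_col (y v* B) c" for y
    using linear_scale[OF linear_pair_col_vec_mat[of y c], of "- ln x" B] by (simp add: scaleR_conv_of_real[where 'a = complex])
  then show "eigcol (ln x *\<^sub>R - B) c (of_real (- ln x) * l)"
    using assms by (simp add: eigcol_def)
qed

lemma pair_col_gauss_sum:
  assumes "eigcol B c l"
  shows "pair_col (gauss_sum B Y n \<omega>) c
    = (\<Sum>j=1..n. exp (of_real (- ln (real j / real n)) * l) * pair_col (Y j \<omega>) c)"
  using eigcol_mat_powr[OF assms] by (simp add: gauss_sum_def pair_col_sum eigcol_def)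

text \<open>All old weights grow by the same factor, because j/n = (1 + 1/n) (j/(n+1)), and the new
  summand enters with weight 1.\<close>

lemma pair_col_gauss_sum_Suc:
  assumes "eigcol B c l" and n: "n \<ge> 1"
  shows "pair_col (gauss_sum B Y (Suc n) \<omega>) c
    = ratio_pow l n * pair_col (gauss_sum B Y n \<omega>) c + pair_col (Y (Suc n) \<omega>) c"
proof -
  have "exp (of_real (- ln (real j / real (Suc n))) * l)
      = ratio_pow l n * exp (of_real (- ln (real j / real n)) * l)" if "j \<in> {1..n}" for j
  proof -
    have "real j / real n = (1 + 1 / real n) * (real j / real (Suc n))" using n by (simp add: divide_simps)
    then have "ln (real j / real n) = ln (1 + 1 / real n) + ln (real j / real (Suc n))"
      using that n ln_mult_pos[of "1 + 1 / real n" "real j / real (Suc n)"] by (simp add: add_pos_nonneg)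
    then show ?thesis unfolding ratio_pow_def exp_add[symmetric] by (simp add: algebra_simps)
  qed
  then show ?thesis
    unfolding pair_col_gauss_sum[OF assms(1)] by (simp add: sum_distrib_left mult.assoc)
qed

text \<open>A deterministic statement, to be applied to single paths, with \<open>N\<close> the
  accumulated noise of the walk. Along \<open>c\<close> both sequences obey scalar recursions; the
  mismatch of their factors acts on \<open>s n\<close>, for which the crude linear bound
  suffices.\<close>

lemma eigcol_error_bound:
  fixes s N :: "nat \<Rightarrow> real ^ 'v" and Y :: "nat \<Rightarrow> 'a \<Rightarrow> real ^ 'v"
  assumes rec: "\<And>n. n \<ge> 1 \<Longrightarrow> s (Suc n) = s n + (1 / real n) *\<^sub>R (s n v* B) + (N (Suc n) - N n)"
    and s: "\<And>n. norm (s n) \<le> C0 * real n"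
    and N: "\<And>n. n \<ge> 1 \<Longrightarrow> norm (N n - (\<Sum>j=1..n. Y j \<omega>)) \<le> C * real n powr \<kappa>"
    and \<kappa>: "0 \<le> \<kappa>" "\<kappa> < \<mu>" and eig: "eigcol B c l" and l: "Re l \<le> \<mu>"
  shows "\<exists>K\<ge>0. \<forall>n\<ge>1. norm (pair_col (s n - gauss_sum B Y n \<omega>) c) \<le> K * real n powr \<mu>"
proof -
  obtain L where L: "L \<ge> 0" "\<And>y. norm (pair_col y c) \<le> L * norm y" using norm_pair_col_le by blast
  define D where "D = norm l + (norm l)\<^sup>2 * exp (norm l)"
  have D: "D \<ge> 0" by (simp add: D_def)
  have C0: "C0 \<ge> 0" using order_trans[OF norm_ge_zero s[of 1]] by simp
  show ?thesis
  proof (rule scalar_recursion_bound[of _ l "\<lambda>n. pair_col (N n - (\<Sum>j=1..n. Y j \<omega>)) c"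
        "\<lambda>n. (1 + l / of_nat n - ratio_pow l n) * pair_col (s n) c" "L * C" \<kappa> "D * (L * C0)"])
    fix n :: nat assume n: "n \<ge> 1"
    have "pair_col (s (Suc n)) c
        = pair_col (s n) c + of_real (1 / real n) * (l * pair_col (s n) c) + (pair_col (N (Suc n)) c - pair_col (N n) c)"
      unfolding rec[OF n] using eig by (simp add: pair_col_add pair_col_diff pair_col_scaleR eigcol_def)
    then show "pair_col (s (Suc n) - gauss_sum B Y (Suc n) \<omega>) c
        = ratio_pow l n * pair_col (s n - gauss_sum B Y n \<omega>) c +
          (pair_col (N (Suc n) - (\<Sum>j=1..Suc n. Y j \<omega>)) c - pair_col (N n - (\<Sum>j=1..n. Y j \<omega>)) c) +
          (1 + l / of_nat n - ratio_pow l n) * pair_col (s n) c"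
      by (simp add: pair_col_diff pair_col_add pair_col_gauss_sum_Suc[OF eig n] algebra_simps)
    show "norm (pair_col (N n - (\<Sum>j=1..n. Y j \<omega>)) c) \<le> L * C * real n powr \<kappa>"
      using mult_left_mono[OF N[OF n] L(1)] L(2)[of "N n - (\<Sum>j=1..n. Y j \<omega>)"] by (simp add: mult.assoc)
    have "norm ((1 + l / of_nat n - ratio_pow l n) * pair_col (s n) c) \<le> D / (real n)\<^sup>2 * (L * (C0 * real n))"
      unfolding norm_mult using ratio_pow_minus_linear[OF n] D
      by (intro mult_mono order_trans[OF L(2)] mult_left_mono s L) (auto simp: D_def)
    then show "norm ((1 + l / of_nat n - ratio_pow l n) * pair_col (s n) c) \<le> D * (L * C0) / real n"
      using n by (simp add: power2_eq_square field_simps)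
  qed (use \<kappa> l in auto)
qed

section \<open>Diagonalisation and eigenvectors\<close>

lemma matrix_inv_right:
  fixes T :: "'a::field ^ 'n ^ 'n"
  shows "invertible T \<Longrightarrow> T ** matrix_inv T = mat 1"
  unfolding invertible_def matrix_inv_def by (rule someI_ex[THEN conjunct1])

lemma matrix_inv_left:
  fixes T :: "'a::field ^ 'n ^ 'n"
  shows "invertible T \<Longrightarrow> matrix_inv T ** T = mat 1"
  unfolding invertible_def matrix_inv_def by (rule someI_ex[THEN conjunct2])

lemma eigcol_of_commute:
  fixes T :: "complex ^ 'n ^ 'n"
  assumes *: "map_matrix complex_of_real B ** T = T ** diag_mat lam"
  shows "eigcol B (column j T) (lam j)"
proof -
  let ?B = "map_matrix complex_of_real B"
  have e: "(\<Sum>k\<in>UNIV. of_real (B $ i $ k) * T $ k $ j) = lam j * T $ i $ j" for i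
  proof -
    have "(\<Sum>k\<in>UNIV. of_real (B $ i $ k) * T $ k $ j) = (?B ** T) $ i $ j"
      by (simp add: matrix_matrix_mult_def map_matrix_def)
    also have "\<dots> = (\<Sum>k\<in>UNIV. T $ i $ k * (if k = j then lam k else 0))"
      unfolding * by (simp add: matrix_matrix_mult_def diag_mat_def)
    finally show ?thesis by (simp add: if_distrib cong: if_cong)
  qed
  show ?thesis unfolding eigcol_def
  proof
    fix y :: "real ^ 'n"
    have "pair_col (y v* B) (column j T) = (\<Sum>k\<in>UNIV. \<Sum>i\<in>UNIV. of_real (B $ i $ k) * of_real (y $ i) * T $ k $ j)"
      by (simp add: pair_col_def column_def vector_matrix_mult_def sum_distrib_right mult.commute[of "of_real (y $ _)"])
    also have "\<dots> = (\<Sum>i\<in>UNIV. \<Sum>k\<in>UNIV. of_real (B $ i $ k) * of_real (y $ i) * T $ k $ j)"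
      by (rule sum.swap)
    also have "\<dots> = (\<Sum>i\<in>UNIV. of_real (y $ i) * (\<Sum>k\<in>UNIV. of_real (B $ i $ k) * T $ k $ j))"
      unfolding sum_distrib_left by (intro sum.cong refl) (simp only: mult_ac)
    also have "\<dots> = lam j * pair_col y (column j T)"
      unfolding e pair_col_def column_def sum_distrib_left by (intro sum.cong refl) (simp add: mult_ac)
    finally show "pair_col (y v* B) (column j T) = lam j * pair_col y (column j T)" .
  qed
qed

lemma commute_of_diag:
  fixes T :: "'a::field ^ 'n ^ 'n"
  assumes T: "invertible T" and diag: "matrix_inv T ** A ** T = diag_mat l"
  shows "A ** T = T ** diag_mat l"
  unfolding diag[symmetric] matrix_mul_assoc by (simp add: matrix_inv_right[OF T])

lemmas eigcol_of_diag = eigcol_of_commute[OF commute_of_diag]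

lemma eigvals_of_diag:
  fixes T :: "complex ^ 'n ^ 'n"
  assumes T: "invertible T" and diag: "matrix_inv T ** map_matrix complex_of_real B ** T = diag_mat lam"
  shows "lam j \<in> eigvals B"
proof -
  let ?B = "map_matrix complex_of_real B"
  have *: "?B ** T = T ** diag_mat lam" by (rule commute_of_diag[OF T diag])
  have "column j T \<noteq> 0"
  proof
    assume "column j T = 0"
    then have "(matrix_inv T ** T) $ j $ j = 0"
      by (simp add: matrix_matrix_mult_def column_def vec_eq_iff)
    then show False by (simp add: matrix_inv_left[OF T] mat_def)
  qed
  moreover have "?B *v column j T = lam j *s column j T"
  proof -
    have "(?B *v column j T) $ i = (?B ** T) $ i $ j" for i
      by (simp add: matrix_matrix_mult_def matrix_vector_mult_def column_def)
    moreover have "(T ** diag_mat lam) $ i $ j = lam j * T $ i $ j" for i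
      by (simp add: matrix_matrix_mult_def diag_mat_def if_distrib cong: if_cong)
    ultimately show ?thesis unfolding * by (simp add: vec_eq_iff column_def)
  qed
  ultimately show ?thesis unfolding eigvals_def by blast
qed

text \<open>The maximum in \<open>max_Re_eigval\<close> bounds its elements only because it is taken
  over a finite set. In the coordinates given by T an eigenvector has a nonzero entry j, which
  forces the eigenvalue to be \<open>lam j\<close>.\<close>

lemma finite_eigvals: 
  fixes T :: "complex ^ 'n ^ 'n"
  assumes T: "invertible T" and diag: "matrix_inv T ** map_matrix complex_of_real B ** T = diag_mat lam"
  shows "finite (eigvals B)"
proof -
  let ?B = "map_matrix complex_of_real B"
  have "eigvals B \<subseteq> range lam"
  proof
    fix \<mu> assume "\<mu> \<in> eigvals B"
    then obtain x where x: "x \<noteq> 0" "?B *v x = \<mu> *s x" unfolding eigvals_def by blast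
    define z where "z = matrix_inv T *v x"
    have Tz: "T *v z = x" by (simp add: z_def matrix_vector_mul_assoc matrix_inv_right[OF T])
    have "diag_mat lam *v z = matrix_inv T *v (?B *v (T *v z))"
      by (simp add: diag[symmetric] matrix_vector_mul_assoc matrix_mul_assoc)
    also have "\<dots> = \<mu> *s z" unfolding Tz x(2) by (simp add: z_def vector_scalar_commute)
    finally have "(diag_mat lam *v z) $ j = \<mu> * z $ j" for j by simp
    moreover have "(diag_mat lam *v z) $ j = lam j * z $ j" for j
      by (simp add: matrix_vector_mult_def diag_mat_def if_distrib[of "\<lambda>t. t * _"] cong: if_cong)
    ultimately have lz: "lam j * z $ j = \<mu> * z $ j" for j by simp
    have "z \<noteq> 0" using Tz x(1) by auto
    then obtain j where "z $ j \<noteq> 0" by (auto simp: vec_eq_iff)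
    then show "\<mu> \<in> range lam" using lz[of j] by auto
  qed
  then show ?thesis by (rule finite_subset) simp
qed

text \<open>The pairings with the columns of T are the coordinates of x T, and x is recovered as (x
  T) times the inverse of T. The entries of the inverse provide the constant.\<close>

lemma norm_le_sum_pair_col:
  fixes T :: "complex ^ 'n ^ 'n"
  assumes T: "invertible T"
  shows "\<exists>K\<ge>0. \<forall>x. norm x \<le> K * (\<Sum>j\<in>UNIV. norm (pair_col x (column j T)))"
proof -
  define K where "K = (\<Sum>i\<in>UNIV. \<Sum>j\<in>UNIV. norm (matrix_inv T $ j $ i))"
  have "norm x \<le> K * (\<Sum>j\<in>UNIV. norm (pair_col x (column j T)))" for x
  proof -
    have inv: "(\<Sum>j\<in>UNIV. T $ k $ j * matrix_inv T $ j $ i) = (if k = i then 1 else 0)" for k i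
      using matrix_inv_right[OF T] by (simp add: matrix_matrix_mult_def mat_def vec_eq_iff)
    have x: "complex_of_real (x $ i) = (\<Sum>j\<in>UNIV. pair_col x (column j T) * matrix_inv T $ j $ i)" for i
    proof -
      have "(\<Sum>j\<in>UNIV. pair_col x (column j T) * matrix_inv T $ j $ i)
          = (\<Sum>j\<in>UNIV. \<Sum>k\<in>UNIV. of_real (x $ k) * (T $ k $ j * matrix_inv T $ j $ i))"
        by (simp add: pair_col_def column_def sum_distrib_right mult.assoc)
      also have "\<dots> = (\<Sum>k\<in>UNIV. \<Sum>j\<in>UNIV. of_real (x $ k) * (T $ k $ j * matrix_inv T $ j $ i))"
        by (rule sum.swap)
      also have "\<dots> = (\<Sum>k\<in>UNIV. of_real (x $ k) * (\<Sum>j\<in>UNIV. T $ k $ j * matrix_inv T $ j $ i))"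
        by (simp only: sum_distrib_left)
      finally show ?thesis by (simp add: inv if_distrib cong: if_cong)
    qed
    have "\<bar>x $ i\<bar> \<le> (\<Sum>j\<in>UNIV. norm (matrix_inv T $ j $ i)) * (\<Sum>j\<in>UNIV. norm (pair_col x (column j T)))" for i
    proof -
      have "\<bar>x $ i\<bar> = norm (complex_of_real (x $ i))" by simp
      also have "\<dots> \<le> (\<Sum>j\<in>UNIV. norm (pair_col x (column j T)) * norm (matrix_inv T $ j $ i))"
        unfolding x by (rule order_trans[OF norm_sum]) (simp add: norm_mult)
      also have "\<dots> \<le> (\<Sum>j\<in>UNIV. (\<Sum>j\<in>UNIV. norm (pair_col x (column j T))) * norm (matrix_inv T $ j $ i))"
        by (intro sum_mono mult_right_mono member_le_sum) auto
      finally show ?thesis by (simp add: sum_distrib_left mult.commute)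
    qed
    then have "(\<Sum>i\<in>UNIV. \<bar>x $ i\<bar>) \<le> K * (\<Sum>j\<in>UNIV. norm (pair_col x (column j T)))"
      unfolding K_def sum_distrib_right by (intro sum_mono)
    then show ?thesis using norm_le_l1_cart order_trans by blast
  qed
  moreover have "K \<ge> 0" unfolding K_def by (intro sum_nonneg) auto
  ultimately show ?thesis by blast
qed

section \<open>Coupling of Rademacher and normal sums\<close>

lemma (in prob_space) indep_set_swap: "indep_set A B \<Longrightarrow> indep_set B A"
  unfolding indep_sets2_eq by (metis Int_commute mult.commute)

lemma (in prob_space) indep_var_swap:
  "indep_var N A L b \<Longrightarrow> indep_var L b N A"
  unfolding indep_var_eq using indep_set_swap by blast

text \<open>Fubini for the joint law, which is a product by independence. It plays the part of
  conditioning on \<open>A\<close>: the first variable is frozen and the second one integrated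
  out.\<close>

lemma (in prob_space) indep_var_integral:
  fixes h :: "'b \<times> 'b \<Rightarrow> real"
  assumes ind: "indep_var N A L b" and h: "h \<in> borel_measurable (N \<Otimes>\<^sub>M L)"
    and int: "integrable M (\<lambda>\<omega>. h (A \<omega>, b \<omega>))"
  shows "expectation (\<lambda>\<omega>. h (A \<omega>, b \<omega>)) = expectation (\<lambda>\<omega>. \<integral>z. h (A \<omega>, z) \<partial>distr M L b)"
    and "integrable M (\<lambda>\<omega>. \<integral>z. h (A \<omega>, z) \<partial>distr M L b)"
proof -
  have rv[measurable]: "random_variable N A" "random_variable L b" 
    and eq: "distr M N A \<Otimes>\<^sub>M distr M L b = distr M (N \<Otimes>\<^sub>M L) (\<lambda>\<omega>. (A \<omega>, b \<omega>))"
    using ind unfolding indep_var_distribution_eq by auto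
  interpret A: prob_space "distr M N A" by (rule prob_space_distr) fact
  interpret b: prob_space "distr M L b" by (rule prob_space_distr) fact
  interpret P: pair_sigma_finite "distr M N A" "distr M L b" ..
  note [measurable] = h
  have mh: "h \<in> borel_measurable (N \<Otimes>\<^sub>M distr M L b)" using h by (simp cong: measurable_cong_sets)
  have "integrable (distr M (N \<Otimes>\<^sub>M L) (\<lambda>\<omega>. (A \<omega>, b \<omega>))) h"
    using int by (subst integrable_distr_eq) auto
  then have ih: "integrable (distr M N A \<Otimes>\<^sub>M distr M L b) (\<lambda>(x, y). h (x, y))" by (simp add: eq)
  have m: "(\<lambda>x. \<integral>y. h (x, y) \<partial>distr M L b) \<in> borel_measurable N"
    by (rule b.borel_measurable_lebesgue_integral) (use mh in simp)
  have "expectation (\<lambda>\<omega>. h (A \<omega>, b \<omega>)) = (\<integral>x. h x \<partial>distr M (N \<Otimes>\<^sub>M L) (\<lambda>\<omega>. (A \<omega>, b \<omega>)))"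
    by (rule integral_distr[symmetric]) auto
  also have "\<dots> = (\<integral>x. (\<integral>y. h (x, y) \<partial>distr M L b) \<partial>distr M N A)"
    using P.integral_fst'[of h] ih by (simp add: eq)
  also have "\<dots> = expectation (\<lambda>\<omega>. \<integral>z. h (A \<omega>, z) \<partial>distr M L b)"
    by (rule integral_distr) (use m in auto)
  finally show "expectation (\<lambda>\<omega>. h (A \<omega>, b \<omega>)) = expectation (\<lambda>\<omega>. \<integral>z. h (A \<omega>, z) \<partial>distr M L b)" .
  have "integrable (distr M N A) (\<lambda>x. \<integral>y. h (x, y) \<partial>distr M L b)"
    using P.integrable_fst'[of h] ih by simp
  then show "integrable M (\<lambda>\<omega>. \<integral>z. h (A \<omega>, z) \<partial>distr M L b)"
    by (subst (asm) integrable_distr_eq) (use m in auto)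
qed

lemma integral_abs_le:
  fixes f g :: "'a \<Rightarrow> real"
  assumes "integrable M f" "integrable M g" "\<And>x. x \<in> space M \<Longrightarrow> \<bar>f x\<bar> \<le> g x"
  shows "\<bar>\<integral>x. f x \<partial>M\<bar> \<le> (\<integral>x. g x \<partial>M)"
  by (rule order_trans[OF integral_abs_bound integral_mono]) (use assms in auto)

lemma abs_half_sum_le: "\<bar>a\<bar> \<le> e \<Longrightarrow> \<bar>b\<bar> \<le> e \<Longrightarrow> \<bar>(a + b) / 2\<bar> \<le> (e :: real)"
  by simp

section \<open>Lipschitz test functions and Lindeberg replacement\<close>

definition lip1 :: "(real \<Rightarrow> real) \<Rightarrow> bool" where
  "lip1 f \<longleftrightarrow> (\<forall>a b. \<bar>f a - f b\<bar> \<le> \<bar>a - b\<bar>)"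

lemma lip1D: "lip1 f \<Longrightarrow> \<bar>f a - f b\<bar> \<le> \<bar>a - b\<bar>" by (simp add: lip1_def)

lemma lip1_continuous: "lip1 f \<Longrightarrow> continuous_on S f"
proof -
  assume "lip1 f"
  then have "1-lipschitz_on S f" by (intro lipschitz_onI) (auto simp: lip1_def dist_real_def)
  then show ?thesis by (rule lipschitz_on_continuous_on)
qed

lemma lip1_measurable: "lip1 f \<Longrightarrow> f \<in> borel_measurable borel"
  using borel_measurable_continuous_onI lip1_continuous by blast

lemma (in prob_space) lip1_integrable:
  assumes f: "lip1 f" and X: "integrable M X"
  shows "integrable M (\<lambda>\<omega>. f (X \<omega>))"
proof (rule Bochner_Integration.integrable_bound)
  show "integrable M (\<lambda>\<omega>. \<bar>X \<omega>\<bar> + \<bar>f 0\<bar>)" using X by auto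
  show "(\<lambda>\<omega>. f (X \<omega>)) \<in> borel_measurable M"
    using lip1_measurable[OF f] X by measurable
  show "AE \<omega> in M. norm (f (X \<omega>)) \<le> norm (\<bar>X \<omega>\<bar> + \<bar>f 0\<bar>)"
    using lip1D[OF f, of _ 0] by (intro AE_I2) (smt (verit) real_norm_def)
qed

text \<open>A Taylor expansion of order two with a cubic remainder uniform in x. The coefficients
  are arbitrary functions, so stability under averaging is a pointwise matter.\<close>

definition taylor2 :: "real \<Rightarrow> (real \<Rightarrow> real) \<Rightarrow> bool" where
  "taylor2 L F \<longleftrightarrow> (\<exists>F1 F2. \<forall>x d. \<bar>F (x + d) - F x - d * F1 x - d\<^sup>2 / 2 * F2 x\<bar> \<le> L * \<bar>d\<bar> ^ 3)"

text \<open>This is the mean of F at x plus a sum of m independent Rademacher variables, written as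
  an iterated average and hence independent of any probability space; see
  \<open>rad_avg_eq\<close>.\<close>

primrec rad_avg :: "nat \<Rightarrow> (real \<Rightarrow> real) \<Rightarrow> real \<Rightarrow> real" where
  "rad_avg 0 F = F"
| "rad_avg (Suc m) F = rad_avg m (\<lambda>x. (F (x + 1) + F (x - 1)) / 2)"

lemma lip1_avg:
  assumes F: "lip1 F" shows "lip1 (\<lambda>x. (F (x + 1) + F (x - 1)) / 2)"
  unfolding lip1_def
proof (intro allI)
  fix a b
  show "\<bar>(F (a + 1) + F (a - 1)) / 2 - (F (b + 1) + F (b - 1)) / 2\<bar> \<le> \<bar>a - b\<bar>"
    using abs_half_sum_le[of "F (a + 1) - F (b + 1)" "\<bar>a - b\<bar>" "F (a - 1) - F (b - 1)"]
      lip1D[OF F, of "a + 1" "b + 1"] lip1D[OF F, of "a - 1" "b - 1"] by (simp add: field_simps)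
qed

lemma taylor2_avg: 
  assumes "taylor2 L F" shows "taylor2 L (\<lambda>x. (F (x + 1) + F (x - 1)) / 2)"
proof -
  obtain F1 F2 where F: "\<And>x d. \<bar>F (x + d) - F x - d * F1 x - d\<^sup>2 / 2 * F2 x\<bar> \<le> L * \<bar>d\<bar> ^ 3"
    using assms unfolding taylor2_def by blast
  have "\<bar>(F (x + d + 1) + F (x + d - 1)) / 2 - (F (x + 1) + F (x - 1)) / 2
     - d * ((F1 (x + 1) + F1 (x - 1)) / 2) - d\<^sup>2 / 2 * ((F2 (x + 1) + F2 (x - 1)) / 2)\<bar> \<le> L * \<bar>d\<bar> ^ 3" for x d
  proof -
    let ?A = "F (x + 1 + d) - F (x + 1) - d * F1 (x + 1) - d\<^sup>2 / 2 * F2 (x + 1)"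
    let ?B = "F (x - 1 + d) - F (x - 1) - d * F1 (x - 1) - d\<^sup>2 / 2 * F2 (x - 1)"
    have eq: "(F (x + d + 1) + F (x + d - 1)) / 2 - (F (x + 1) + F (x - 1)) / 2
     - d * ((F1 (x + 1) + F1 (x - 1)) / 2) - d\<^sup>2 / 2 * ((F2 (x + 1) + F2 (x - 1)) / 2) = (?A + ?B) / 2"
      by (simp add: field_simps)
    show ?thesis unfolding eq by (rule abs_half_sum_le) (rule F)+
  qed
  then show ?thesis unfolding taylor2_def by fast
qed

abbreviation "std_normal \<equiv> density lborel std_normal_density"

definition "abs_moment3 = (\<integral>x. \<bar>x\<bar> ^ 3 \<partial>std_normal)"

lemma integrable_std_normal_pow: "integrable std_normal (\<lambda>x. x ^ k)"
  using integrable_std_normal_moment[of k] by (subst integrable_real_density) auto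

lemma integrable_std_normal_pow_abs: "integrable std_normal (\<lambda>x. \<bar>x\<bar> ^ k)"
  using integrable_std_normal_moment_abs[of k] by (subst integrable_real_density) auto

lemma integral_std_normal_id: "(\<integral>x. x \<partial>std_normal) = 0"
  using integral_std_normal_moment_odd[of 0] by (subst integral_real_density) auto

lemma integral_std_normal_square: "(\<integral>x. x\<^sup>2 \<partial>std_normal) = 1"
  using integral_std_normal_moment_even[of 1] by (subst integral_real_density) (auto simp: fact_numeral)

lemma prob_space_std_normal: "prob_space std_normal"
  by (rule prob_space_normal_density) simp

lemma abs_moment3_nonneg: "abs_moment3 \<ge> 0"
  by (simp add: abs_moment3_def)

text \<open>A standard normal and a Rademacher variable have the same first two moments, so the
  terms up to order two cancel. The remainders contribute L times the third absolute moments, which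
  are \<open>abs_moment3\<close> and 1.\<close>

lemma normal_step:
  assumes F: "taylor2 L F" and lip: "lip1 F" and L: "L \<ge> 0"
  shows "\<bar>(\<integral>z. F (u + z) \<partial>std_normal) - (F (u + 1) + F (u - 1)) / 2\<bar> \<le> L * (1 + abs_moment3)"
proof -
  interpret N: prob_space std_normal by (rule prob_space_std_normal)
  obtain F1 F2 where F12: "\<And>x d. \<bar>F (x + d) - F x - d * F1 x - d\<^sup>2 / 2 * F2 x\<bar> \<le> L * \<bar>d\<bar> ^ 3"
    using F unfolding taylor2_def by blast
  have i1: "integrable std_normal (\<lambda>z. z)" using integrable_std_normal_pow[of 1] by simp
  have i2: "integrable std_normal (\<lambda>z. z\<^sup>2)" by (rule integrable_std_normal_pow)
  have iF: "integrable std_normal (\<lambda>z. F (u + z))"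
    by (rule N.lip1_integrable[OF lip]) (use i1 in auto)
  have "(\<integral>z. F (u + z) - F u - z * F1 u - z\<^sup>2 / 2 * F2 u \<partial>std_normal)
     = (\<integral>z. F (u + z) \<partial>std_normal) - F u - F2 u / 2"
    using iF i1 i2 by (simp add: integral_std_normal_id integral_std_normal_square N.prob_space[simplified])
  moreover have "\<bar>\<integral>z. F (u + z) - F u - z * F1 u - z\<^sup>2 / 2 * F2 u \<partial>std_normal\<bar> \<le> (\<integral>z. L * \<bar>z\<bar> ^ 3 \<partial>std_normal)"
    by (rule integral_abs_le) (use iF i1 i2 integrable_std_normal_pow_abs[of 3] F12 in auto)
  ultimately have 1: "\<bar>(\<integral>z. F (u + z) \<partial>std_normal) - F u - F2 u / 2\<bar> \<le> L * abs_moment3"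
    by (simp add: abs_moment3_def)
  have "\<bar>(F (u + 1) + F (u - 1)) / 2 - F u - F2 u / 2\<bar> \<le> L"
  proof -
    have eq: "(F (u + 1) + F (u - 1)) / 2 - F u - F2 u / 2
        = ((F (u + 1) - F u - F1 u - F2 u / 2) + (F (u - 1) - F u + F1 u - F2 u / 2)) / 2"
      by (simp add: field_simps)
    show ?thesis unfolding eq
      by (rule abs_half_sum_le) (use F12[of u 1] F12[of u "-1"] in simp_all)
  qed
  with 1 show ?thesis unfolding distrib_left by linarith
qed

lemma (in prob_space) normal_integrable:
  assumes "distributed M lborel X std_normal_density"
  shows "integrable M X"
proof -
  have X: "X \<in> borel_measurable M" using distributed_measurable[OF assms] by simp
  have d: "distr M lborel X = std_normal" using assms by (simp add: distributed_def)
  have "integrable (distr M lborel X) (\<lambda>x. x)" unfolding d using integrable_std_normal_pow[of 1] by simp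
  then show ?thesis using X by (subst (asm) integrable_distr_eq) auto
qed

text \<open>In the induction the remaining signs are averaged out first. Averages of translates of \<open>F\<close> inherit
  the Taylor bound, so that nothing has to be differentiated under the normal integral.\<close>

lemma (in prob_space) lindeberg:
  fixes y :: "'i \<Rightarrow> 'a \<Rightarrow> real"
  assumes "finite I" "indep_vars (\<lambda>_. borel) y I" "\<And>i. i \<in> I \<Longrightarrow> distributed M lborel (y i) std_normal_density"
    and "lip1 F" "taylor2 L F" "L \<ge> 0"
  shows "\<bar>rad_avg (card I) F x - expectation (\<lambda>\<omega>. F (x + (\<Sum>i\<in>I. y i \<omega>)))\<bar> \<le> real (card I) * (L * (1 + abs_moment3))"
  using assms
proof (induction I arbitrary: F rule: finite_induct)
  case empty
  then show ?case by (simp add: prob_space)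
next
  case (insert i I)
  let ?S = "\<lambda>\<omega>. \<Sum>i\<in>I. y i \<omega>" and ?G = "\<lambda>x. (F (x + 1) + F (x - 1)) / 2"
  have ind: "indep_var borel (y i) borel ?S"
    using insert by (intro indep_vars_sum) auto
  \<comment> \<open>The order matters: \<open>indep_var_integral\<close> freezes the first variable,
    and here the variable to be replaced has to be integrated out.\<close>
  have ind: "indep_var borel ?S borel (y i)"
    by (rule indep_var_swap[OF ind])
  have int: "integrable M (y j)" if "j \<in> insert i I" for j
    using normal_integrable insert.prems(2) that by blast
  have iS: "integrable M ?S" using int by auto
  have lipG: "lip1 ?G" using insert.prems by (intro lip1_avg)
  have d: "distr M borel (y i) = std_normal"
    using insert.prems(2)[of i] by (simp add: distributed_def cong: distr_cong)
  have Fm[measurable]: "F \<in> borel_measurable borel" using insert.prems by (intro lip1_measurable)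
  have iF: "integrable M (\<lambda>\<omega>. F (x + (?S \<omega> + y i \<omega>)))"
    by (rule lip1_integrable[OF insert.prems(3)]) (use iS int[of i] in auto)
  note Fub = indep_var_integral[OF ind, of "\<lambda>(s, z). F (x + (s + z))", simplified, OF iF, unfolded d]
  have E: "expectation (\<lambda>\<omega>. F (x + (\<Sum>i\<in>insert i I. y i \<omega>))) = expectation (\<lambda>\<omega>. \<integral>z. F (x + (?S \<omega> + z)) \<partial>std_normal)"
    using Fub(1) insert.hyps by (simp add: add.commute)
  have iG: "integrable M (\<lambda>\<omega>. ?G (x + ?S \<omega>))"
    by (rule lip1_integrable[OF lipG]) (use iS in auto)
  have "\<bar>expectation (\<lambda>\<omega>. (\<integral>z. F (x + (?S \<omega> + z)) \<partial>std_normal) - ?G (x + ?S \<omega>))\<bar> \<le> expectation (\<lambda>_. L * (1 + abs_moment3))"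
  proof (rule integral_abs_le)
    show "\<bar>(\<integral>z. F (x + (?S \<omega> + z)) \<partial>std_normal) - ?G (x + ?S \<omega>)\<bar> \<le> L * (1 + abs_moment3)" for \<omega>
      using normal_step[OF insert.prems(4,3,5), of "x + ?S \<omega>"] by (simp add: add.assoc)
  qed (use Fub(2) iG in auto)
  then have 1: "\<bar>expectation (\<lambda>\<omega>. \<integral>z. F (x + (?S \<omega> + z)) \<partial>std_normal) - expectation (\<lambda>\<omega>. ?G (x + ?S \<omega>))\<bar> \<le> L * (1 + abs_moment3)"
    using Fub(2) iG by (simp add: prob_space)
  have 2: "\<bar>rad_avg (card I) ?G x - expectation (\<lambda>\<omega>. ?G (x + ?S \<omega>))\<bar> \<le> real (card I) * (L * (1 + abs_moment3))"
    using insert.prems insert.hyps by (intro insert.IH lipG taylor2_avg indep_vars_subset[OF insert.prems(1)]) auto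
  have "rad_avg (card (insert i I)) F x = rad_avg (card I) ?G x" using insert.hyps by simp
  moreover have "real (card (insert i I)) * (L * (1 + abs_moment3)) = real (card I) * (L * (1 + abs_moment3)) + L * (1 + abs_moment3)"
    using insert.hyps by (simp add: algebra_simps)
  ultimately show ?case unfolding E using 1 2 by linarith
qed

lemma continuous_antiderivative:
  fixes f :: "real \<Rightarrow> real"
  assumes "continuous_on UNIV f"
  shows "\<exists>P. \<forall>x. (P has_real_derivative f x) (at x)"
proof -
  have "\<exists>F. \<forall>x::real. -\<infinity> < ereal x \<longrightarrow> ereal x < \<infinity> \<longrightarrow> (F has_vector_derivative f x) (at x)"
    using assms by (intro einterval_antiderivative) (auto simp: continuous_on_eq_continuous_at)
  then show ?thesis by (auto simp: has_real_derivative_iff_has_vector_derivative)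
qed

text \<open>Two averages of width h move f by at most 2h. The second derivative is the second
  difference of f divided by h^2, whose Lipschitz constant is at most (1 + 2 + 1) / h^2; this is the
  4.\<close>

lemma smoothing:
  assumes f: "lip1 f" and h: "h > 0"
  shows "\<exists>F. lip1 F \<and> taylor2 (4 / h\<^sup>2) F \<and> (\<forall>x. \<bar>F x - f x\<bar> \<le> 2 * h)"
proof -
  obtain P where P: "\<And>x. (P has_real_derivative f x) (at x)"
    using continuous_antiderivative[OF lip1_continuous[OF f]] by blast
  have "continuous_on UNIV P" by (rule DERIV_continuous_on) (use P in auto)
  then obtain Q where Q: "\<And>x. (Q has_real_derivative P x) (at x)"
    using continuous_antiderivative by blast
  \<comment> \<open>the average of \<open>f\<close> over \<open>[x, x + h]\<close>, taken twice\<close>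
  define F where "F x = (Q (x + 2 * h) - 2 * Q (x + h) + Q x) / h\<^sup>2" for x
  define F1 where "F1 x = (P (x + 2 * h) - 2 * P (x + h) + P x) / h\<^sup>2" for x
  define F2 where "F2 x = (f (x + 2 * h) - 2 * f (x + h) + f x) / h\<^sup>2" for x
  note [derivative_intros] = DERIV_chain2[OF P] DERIV_chain2[OF Q]
  have dF: "(F has_real_derivative F1 x) (at x)" for x
    unfolding F_def F1_def using h by (auto intro!: derivative_eq_intros simp: field_simps)
  have dF1: "(F1 has_real_derivative F2 x) (at x)" for x
    unfolding F1_def F2_def using h by (auto intro!: derivative_eq_intros simp: field_simps)
  \<comment> \<open>The mean value theorem, applied to a difference of Q and then to P, turns the
    second difference into a value of f at a nearby point.\<close>
  have second: "\<exists>s. x < s \<and> s < x + 2 * h \<and> F x = f s" for x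
  proof -
    have "\<exists>\<xi>. 0 < \<xi> \<and> \<xi> < h \<and> (Q (x + h + h) - Q (x + h)) - (Q (x + h + 0) - Q (x + 0)) = (h - 0) * (P (x + h + \<xi>) - P (x + \<xi>))"
      by (rule MVT2) (use h in \<open>auto intro!: derivative_eq_intros\<close>)
    then obtain \<xi> where \<xi>: "0 < \<xi>" "\<xi> < h" "(Q (x + h + h) - Q (x + h)) - (Q (x + h) - Q x) = h * (P (x + h + \<xi>) - P (x + \<xi>))"
      by auto
    have "\<exists>s. x + \<xi> < s \<and> s < x + h + \<xi> \<and> P (x + h + \<xi>) - P (x + \<xi>) = ((x + h + \<xi>) - (x + \<xi>)) * f s"
      by (rule MVT2) (use h P in auto)
    then obtain s where s: "x + \<xi> < s" "s < x + h + \<xi>" "P (x + h + \<xi>) - P (x + \<xi>) = h * f s" by auto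
    have "F x = f s" using \<xi>(3) s(3) h by (simp add: F_def power2_eq_square field_simps)
    then show ?thesis using \<xi> s by (intro exI[of _ s]) auto
  qed
  have close: "\<bar>F x - f x\<bar> \<le> 2 * h" for x
    using second[of x] lip1D[OF f, of _ x] by (smt (verit))
  have F1le: "\<bar>F1 x\<bar> \<le> 1" for x
  proof -
    have "x + 2 * h = x + h + h" by simp
    have "\<exists>\<xi>. 0 < \<xi> \<and> \<xi> < h \<and> (P (x + h + h) - P (x + h)) - (P (x + h + 0) - P (x + 0)) = (h - 0) * (f (x + h + \<xi>) - f (x + \<xi>))"
      by (rule MVT2) (use h in \<open>auto intro!: derivative_eq_intros\<close>)
    then obtain \<xi> where \<xi>: "(P (x + h + h) - P (x + h)) - (P (x + h) - P x) = h * (f (x + h + \<xi>) - f (x + \<xi>))" by auto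
    then have "P (x + 2 * h) - 2 * P (x + h) + P x = h * (f (x + h + \<xi>) - f (x + \<xi>))"
      unfolding \<open>x + 2 * h = x + h + h\<close> by linarith
    then have "F1 x = (f (x + h + \<xi>) - f (x + \<xi>)) / h" using h unfolding F1_def by (simp add: power2_eq_square)
    moreover have "\<bar>f (x + h + \<xi>) - f (x + \<xi>)\<bar> \<le> h" using lip1D[OF f, of "x + h + \<xi>" "x + \<xi>"] h by simp
    ultimately show ?thesis using h by simp
  qed
  have lipF: "lip1 F" unfolding lip1_def
  proof (intro allI)
    have *: "\<bar>F a - F b\<bar> \<le> \<bar>a - b\<bar>" if ba: "b < a" for a b
    proof -
      obtain z where "F a - F b = (a - b) * F1 z" using MVT2[OF ba, of F F1] dF by auto
      then show ?thesis using F1le[of z] by (simp add: abs_mult mult_left_le)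
    qed
    show "\<bar>F a - F b\<bar> \<le> \<bar>a - b\<bar>" for a b
      using *[of a b] *[of b a] by (cases a b rule: linorder_cases) (auto simp: abs_minus_commute)
  qed
  have lipF2: "\<bar>F2 a - F2 b\<bar> \<le> 4 / h\<^sup>2 * \<bar>a - b\<bar>" for a b
  proof -
    have "\<bar>(f (a + 2 * h) - 2 * f (a + h) + f a) - (f (b + 2 * h) - 2 * f (b + h) + f b)\<bar> \<le> 4 * \<bar>a - b\<bar>"
    proof -
      have "\<bar>f (a + 2 * h) - f (b + 2 * h)\<bar> \<le> \<bar>a - b\<bar>" "\<bar>f (a + h) - f (b + h)\<bar> \<le> \<bar>a - b\<bar>" "\<bar>f a - f b\<bar> \<le> \<bar>a - b\<bar>"
        using lip1D[OF f, of "a + 2 * h" "b + 2 * h"] lip1D[OF f, of "a + h" "b + h"] lip1D[OF f, of a b] by simp_all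
      then show ?thesis by (smt (verit))
    qed
    then show ?thesis using h by (simp add: F2_def diff_divide_distrib[symmetric] divide_right_mono)
  qed
  have "\<bar>F (x + d) - F x - d * F1 x - d\<^sup>2 / 2 * F2 x\<bar> \<le> 4 / h\<^sup>2 * \<bar>d\<bar> ^ 3" for x d
  proof (cases "d = 0")
    case False
    define D where "D n = (if n = 0 then F else if n = 1 then F1 else F2)" for n :: nat
    have "\<exists>t. (if x + d < x then x + d < t \<and> t < x else x < t \<and> t < x + d) \<and>
        F (x + d) = (\<Sum>m<2. D m x / fact m * (x + d - x) ^ m) + D 2 t / fact 2 * (x + d - x)\<^sup>2"
      by (rule Taylor[where a = "x - \<bar>d\<bar>" and b = "x + \<bar>d\<bar>"])
         (use False dF dF1 in \<open>auto simp: D_def less_2_cases_iff\<close>)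
    then obtain t where t0: "if x + d < x then x + d < t \<and> t < x else x < t \<and> t < x + d"
      and t1: "F (x + d) = (\<Sum>m<2. D m x / fact m * (x + d - x) ^ m) + D 2 t / fact 2 * (x + d - x)\<^sup>2" by blast
    have "\<bar>t - x\<bar> \<le> \<bar>d\<bar>" using t0 by (auto split: if_splits)
    moreover have "F (x + d) = F x + d * F1 x + d\<^sup>2 / 2 * F2 t"
      using t1 by (simp add: D_def numeral_2_eq_2 mult.commute)
    ultimately have t: "\<bar>t - x\<bar> \<le> \<bar>d\<bar>" "F (x + d) = F x + d * F1 x + d\<^sup>2 / 2 * F2 t" .
    have "\<bar>F (x + d) - F x - d * F1 x - d\<^sup>2 / 2 * F2 x\<bar> = d\<^sup>2 / 2 * \<bar>F2 t - F2 x\<bar>"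
    proof -
      have "F (x + d) - F x - d * F1 x - d\<^sup>2 / 2 * F2 x = d\<^sup>2 / 2 * (F2 t - F2 x)"
        unfolding t(2) by (simp add: algebra_simps)
      then show ?thesis by (simp only: abs_mult) simp
    qed
    also have "\<dots> \<le> d\<^sup>2 / 2 * (4 / h\<^sup>2 * \<bar>d\<bar>)"
      by (intro mult_left_mono order_trans[OF lipF2] t(1)) (use h in auto)
    also have "\<dots> \<le> 4 / h\<^sup>2 * \<bar>d\<bar> ^ 3"
    proof -
      have "\<bar>d\<bar> ^ 3 = d\<^sup>2 * \<bar>d\<bar>" by (simp add: power3_eq_cube power2_eq_square abs_mult)
      moreover have "d\<^sup>2 / 2 * (4 / h\<^sup>2 * \<bar>d\<bar>) \<le> d\<^sup>2 * (4 / h\<^sup>2 * \<bar>d\<bar>)" by (rule mult_right_mono) auto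
      ultimately show ?thesis by (simp add: mult_ac)
    qed
    finally show ?thesis .
  qed simp
  then have "taylor2 (4 / h\<^sup>2) F" unfolding taylor2_def by blast
  then show ?thesis using lipF close by blast
qed

lemma rad_avg_close:
  assumes "\<And>x. \<bar>F x - f x\<bar> \<le> e"
  shows "\<bar>rad_avg m F x - rad_avg m f x\<bar> \<le> e"
  using assms
proof (induction m arbitrary: F f)
  case (Suc m)
  show ?case unfolding rad_avg.simps
  proof (rule Suc.IH)
    fix x show "\<bar>(F (x + 1) + F (x - 1)) / 2 - (f (x + 1) + f (x - 1)) / 2\<bar> \<le> e"
      using abs_half_sum_le[OF Suc.prems[of "x + 1"] Suc.prems[of "x - 1"]] by (simp add: field_simps)
  qed
qed simp

text \<open>The first 4 is the smoothing error 2h, paid once for each of the two laws, and the rest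
  is the Lindeberg error m (4 / h^2) (1 + \<open>abs_moment3\<close>), both in units of h =
  m^(1/3).\<close>

definition "w1_const = 4 + 4 * (1 + abs_moment3)"

lemma w1_const_nonneg: "w1_const \<ge> 0" using abs_moment3_nonneg by (simp add: w1_const_def)

text \<open>The dual form of a bound on the Wasserstein distance of order one between the two sums,
  uniform over all Lipschitz functions. It will be used for the one function that
  \<open>monotone_coupling_lip1\<close> provides.\<close>

lemma (in prob_space) wasserstein_rademacher_normal:
  fixes y :: "'i \<Rightarrow> 'a \<Rightarrow> real"
  assumes I: "finite I" "I \<noteq> {}" and ind: "indep_vars (\<lambda>_. borel) y I"
    and d: "\<And>i. i \<in> I \<Longrightarrow> distributed M lborel (y i) std_normal_density" and f: "lip1 f"
  shows "\<bar>rad_avg (card I) f 0 - expectation (\<lambda>\<omega>. f (\<Sum>i\<in>I. y i \<omega>))\<bar> \<le> w1_const * real (card I) powr (1/3)"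
proof -
  define m where "m = real (card I)"
  have m: "m > 0" using I by (simp add: m_def card_gt_0_iff)
  \<comment> \<open>This width balances the smoothing error of order h against the Lindeberg error
    of order m / h^2.\<close>
  define h where "h = m powr (1/3)"
  have h: "h > 0" using m by (simp add: h_def)
  have h3: "h ^ 3 = m" using m unfolding h_def by (simp flip: powr_numeral add: powr_powr)
  obtain F where F: "lip1 F" "taylor2 (4 / h\<^sup>2) F" "\<And>x. \<bar>F x - f x\<bar> \<le> 2 * h" using smoothing[OF f h] by blast
  let ?S = "\<lambda>\<omega>. \<Sum>i\<in>I. y i \<omega>"
  have iS: "integrable M ?S" using normal_integrable[OF d] by auto
  have "\<bar>rad_avg (card I) F 0 - expectation (\<lambda>\<omega>. F (0 + ?S \<omega>))\<bar> \<le> real (card I) * (4 / h\<^sup>2 * (1 + abs_moment3))"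
    by (rule lindeberg) (use assms F in auto)
  also have "real (card I) * (4 / h\<^sup>2 * (1 + abs_moment3)) = 4 * (1 + abs_moment3) * h"
    unfolding m_def[symmetric] h3[symmetric] using h by (simp add: field_simps power2_eq_square power3_eq_cube)
  finally have 1: "\<bar>rad_avg (card I) F 0 - expectation (\<lambda>\<omega>. F (?S \<omega>))\<bar> \<le> 4 * (1 + abs_moment3) * h" by simp
  have 2: "\<bar>rad_avg (card I) F 0 - rad_avg (card I) f 0\<bar> \<le> 2 * h" by (rule rad_avg_close) (rule F)
  have "\<bar>expectation (\<lambda>\<omega>. F (?S \<omega>) - f (?S \<omega>))\<bar> \<le> expectation (\<lambda>_. 2 * h)"
    by (rule integral_abs_le) (use F(3) lip1_integrable[OF F(1) iS] lip1_integrable[OF f iS] in auto)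
  then have 3: "\<bar>expectation (\<lambda>\<omega>. F (?S \<omega>)) - expectation (\<lambda>\<omega>. f (?S \<omega>))\<bar> \<le> 2 * h"
    using lip1_integrable[OF F(1) iS] lip1_integrable[OF f iS] by (simp add: prob_space)
  show ?thesis unfolding w1_const_def m_def[symmetric] h_def[symmetric]
    using 1 2 3 unfolding distrib_right by linarith
qed

section \<open>Monotone coupling on the line\<close>

text \<open>The slope of \<open>f\<close> is \<open>-1\<close> on the intervals from \<open>x\<close> to \<open>h x\<close> with \<open>x < h x\<close> and \<open>1\<close> elsewhere. By
  monotonicity of \<open>h\<close>, these intervals do not meet those with \<open>h x < x\<close>. So a single Lipschitz test
  function measures the cost of the whole coupling.\<close>

lemma monotone_coupling_lip1:
  fixes h :: "real \<Rightarrow> real"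
  assumes h: "mono h"
  shows "\<exists>f. lip1 f \<and> (\<forall>x. f x - f (h x) = \<bar>x - h x\<bar>)"
proof -
  \<comment> \<open>A union of open intervals is open, hence measurable although the union is
    uncountable.\<close>
  define P where "P = (\<Union>x. {x<..<h x})"
  have P: "P \<in> sets lborel" unfolding P_def by (auto intro!: borel_open)
  \<comment> \<open>An antiderivative of the indicator of P, normalised at 0. Subtracting it twice
    from the identity yields slope 1 off P and -1 on P.\<close>
  define \<Lambda> where "\<Lambda> x = (if x \<ge> 0 then measure lborel (P \<inter> {0<..x}) else - measure lborel (P \<inter> {x<..0}))" for x
  have split: "measure lborel (P \<inter> {a<..c}) = measure lborel (P \<inter> {a<..b}) + measure lborel (P \<inter> {b<..c})"
    if "a \<le> b" "b \<le> c" for a b c :: real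
  proof -
    have fin: "emeasure lborel (P \<inter> {s<..t}) \<noteq> \<infinity>" for s t :: real
    proof -
      have "P \<inter> {s<..t} \<subseteq> {s..t}" by auto
      from emeasure_mono[OF this, of lborel] show ?thesis
        using emeasure_lborel_Icc_eq[of s t] by (auto simp: top_unique split: if_splits)
    qed
    have "P \<inter> {a<..c} = (P \<inter> {a<..b}) \<union> (P \<inter> {b<..c})" using that by auto
    then show ?thesis using P fin by (auto intro!: measure_Union)
  qed
  have diff: "\<Lambda> b - \<Lambda> a = measure lborel (P \<inter> {a<..b})" if "a \<le> b" for a b
    using split[of 0 a b] split[of a 0 b] split[of a b 0] that by (auto simp: \<Lambda>_def)
  define f where "f x = x - 2 * \<Lambda> x" for x
  have le: "measure lborel (P \<inter> {a<..b}) \<le> b - a" if "a \<le> b" for a b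
  proof -
    have "measure lborel (P \<inter> {a<..b}) \<le> measure lborel {a<..b}"
      using P that by (intro measure_mono_fmeasurable) (auto simp: fmeasurable_def emeasure_lborel_Ioc)
    then show ?thesis using that by simp
  qed
  have lip: "\<bar>f b - f a\<bar> \<le> b - a" if "a \<le> b" for a b
    unfolding f_def using diff[OF that] le[OF that] measure_nonneg[of lborel "P \<inter> {a<..b}"] by linarith
  have "lip1 f" unfolding lip1_def
  proof (intro allI)
    fix a b :: real show "\<bar>f a - f b\<bar> \<le> \<bar>a - b\<bar>" using lip[of a b] lip[of b a] by (cases "a \<le> b") auto
  qed
  moreover have "f x - f (h x) = \<bar>x - h x\<bar>" for x
  proof (cases "x \<le> h x")
    case True
    have "measure lborel {x<..<h x} \<le> measure lborel (P \<inter> {x<..h x})"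
    proof (rule measure_mono_fmeasurable)
      show "P \<inter> {x<..h x} \<in> fmeasurable lborel"
        by (rule fmeasurableI2[of "{x<..h x}"]) (use P True in \<open>auto simp: fmeasurable_def\<close>)
    qed (auto simp: P_def)
    then have "measure lborel (P \<inter> {x<..h x}) = h x - x" using le[OF True] True by simp
    then show ?thesis using diff[OF True] True by (simp add: f_def)
  next
    case False
    then have lt: "h x < x" by simp
    \<comment> \<open>An interval of P that met the open interval from \<open>h x\<close> to x would
      start at some x' < x and reach beyond \<open>h x\<close>, against monotonicity. The end point
      x itself may belong to P, at the cost of a null set.\<close>
    have "P \<inter> {h x<..x} \<subseteq> {x}"
    proof
      fix t assume t: "t \<in> P \<inter> {h x<..x}"
      then obtain x' where x': "x' < t" "t < h x'" by (auto simp: P_def)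
      show "t \<in> {x}"
      proof (rule ccontr)
        assume "t \<notin> {x}"
        then have "x' \<le> x" using t x' by auto
        then have "h x' \<le> h x" using h by (rule monoD[rotated])
        then show False using t x' by auto
      qed
    qed
    then have "measure lborel (P \<inter> {h x<..x}) \<le> measure lborel {x}"
      by (intro measure_mono_fmeasurable) (auto simp: P[simplified] fmeasurable_def)
    then have "measure lborel (P \<inter> {h x<..x}) = 0"
    proof -
      have "measure lborel {x} = 0" by (simp add: measure_def)
      then show ?thesis
        using \<open>measure lborel (P \<inter> {h x<..x}) \<le> measure lborel {x}\<close> measure_nonneg[of lborel "P \<inter> {h x<..x}"]
        by linarith
    qed
    then show ?thesis using diff[of "h x" x] lt by (simp add: f_def)
  qed
  ultimately show ?thesis by blast
qed

section \<open>Uniform sign vectors from a normal variable\<close>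

definition sign_lists :: "nat \<Rightarrow> int list set" where
  "sign_lists m = {r. length r = m \<and> set r \<subseteq> {- 1, 1}}"

definition sorted_signs :: "nat \<Rightarrow> int list list" where
  "sorted_signs m = sort_key sum_list (List.n_lists m [- 1, 1])"

lemma set_sorted_signs: "set (sorted_signs m) = sign_lists m"
  by (auto simp: sorted_signs_def sign_lists_def set_n_lists)

lemma length_sorted_signs: "length (sorted_signs m) = 2 ^ m"
  by (simp add: sorted_signs_def length_n_lists numeral_2_eq_2)

lemma distinct_sorted_signs: "distinct (sorted_signs m)"
  by (simp add: sorted_signs_def distinct_n_lists)

lemma finite_sign_lists: "finite (sign_lists m)"
  by (simp flip: set_sorted_signs)

lemma sign_lists_Suc: "sign_lists (Suc m) = (#) 1 ` sign_lists m \<union> (#) (- 1) ` sign_lists m"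
  by (auto simp: sign_lists_def length_Suc_conv image_iff)

lemma rad_avg_eq: "rad_avg m F x = (\<Sum>r\<in>sign_lists m. F (x + real_of_int (sum_list r))) / 2 ^ m"
proof (induction m arbitrary: F)
  case 0
  have "sign_lists 0 = {[]}" by (auto simp: sign_lists_def)
  then show ?case by simp
next
  case (Suc m)
  have "(\<Sum>r\<in>sign_lists (Suc m). F (x + real_of_int (sum_list r)))
     = (\<Sum>r\<in>sign_lists m. F (x + real_of_int (sum_list r) + 1)) + (\<Sum>r\<in>sign_lists m. F (x + real_of_int (sum_list r) - 1))"
    unfolding sign_lists_Suc
    by (subst sum.union_disjoint) (auto simp: finite_sign_lists sum.reindex inj_on_def algebra_simps)
  then show ?case by (simp add: Suc sum_divide_distrib[symmetric] sum.distrib)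
qed

definition norm_cdf :: "nat \<Rightarrow> real \<Rightarrow> real" where
  "norm_cdf m = cdf (density lborel (normal_density 0 (sqrt (real m))))"

text \<open>The sign vectors are sorted by their sum. If \<open>x\<close> is normal with variance \<open>m\<close>, then \<open>norm_cdf m x\<close> is
  uniform, so the selected vector is uniform, and its sum is monotone in \<open>x\<close>. The minimum matters
  only if \<open>norm_cdf m x = 1\<close>.\<close>

definition block_signs :: "nat \<Rightarrow> real \<Rightarrow> int list" where
  "block_signs m x = sorted_signs m ! min (2 ^ m - 1) (nat \<lfloor>2 ^ m * norm_cdf m x\<rfloor>)"

lemma block_signs_in: "block_signs m x \<in> sign_lists m"
  unfolding block_signs_def set_sorted_signs[symmetric]
  by (rule nth_mem) (simp add: length_sorted_signs min_less_iff_disj)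

lemma real_distribution_normal: "m \<ge> 1 \<Longrightarrow> real_distribution (density lborel (normal_density 0 (sqrt (real m))))"
  unfolding real_distribution_def real_distribution_axioms_def
  using prob_space_normal_density[of "sqrt (real m)" 0] by simp

lemma norm_cdf_mono: "m \<ge> 1 \<Longrightarrow> x \<le> y \<Longrightarrow> norm_cdf m x \<le> norm_cdf m y"
  unfolding norm_cdf_def
  by (rule finite_borel_measure.cdf_nondecreasing[OF real_distribution.finite_borel_measure_M[OF real_distribution_normal]])

lemma norm_cdf_measurable: "m \<ge> 1 \<Longrightarrow> norm_cdf m \<in> borel_measurable borel"
  by (intro borel_measurable_mono monoI norm_cdf_mono)

lemma block_signs_measurable: "m \<ge> 1 \<Longrightarrow> block_signs m \<in> measurable borel (count_space UNIV)"
proof -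
  assume m: "m \<ge> 1"
  note [measurable] = norm_cdf_measurable[OF m]
  have "(\<lambda>x. nat \<lfloor>2 ^ m * norm_cdf m x\<rfloor>) \<in> measurable borel (count_space UNIV)"
    by measurable
  from measurable_compose[OF this, of "\<lambda>k. sorted_signs m ! min (2 ^ m - 1) k" "count_space UNIV"]
  show ?thesis by (simp add: block_signs_def[abs_def])
qed

lemma sum_block_signs_mono: "m \<ge> 1 \<Longrightarrow> mono (\<lambda>x. real_of_int (sum_list (block_signs m x)))"
proof (intro monoI)
  fix x y :: real assume m: "m \<ge> 1" and xy: "x \<le> y"
  have "nat \<lfloor>2 ^ m * norm_cdf m x\<rfloor> \<le> nat \<lfloor>2 ^ m * norm_cdf m y\<rfloor>"
    using norm_cdf_mono[OF m xy] by (intro nat_mono floor_mono) simp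
  then have le: "min (2 ^ m - 1) (nat \<lfloor>2 ^ m * norm_cdf m x\<rfloor>) \<le> min (2 ^ m - 1) (nat \<lfloor>2 ^ m * norm_cdf m y\<rfloor>)" by simp
  have lt: "min (2 ^ m - 1) k < 2 ^ m" for k :: nat by (simp add: min_less_iff_disj)
  have "sorted (map sum_list (sorted_signs m))" by (simp add: sorted_signs_def)
  from sorted_nth_mono[OF this le] lt
  show "real_of_int (sum_list (block_signs m x)) \<le> real_of_int (sum_list (block_signs m y))"
    by (simp add: block_signs_def length_sorted_signs)
qed

text \<open>The probability integral transform. By continuity every v strictly between 0 and 1 is a
  value F(x) of the distribution function. Comparing with the events X \<le> x gives the upper bound
  at v = u and the lower bound for all v < u. The end points, which F may fail to attain, are
  treated separately.\<close>

lemma (in prob_space) cdf_uniform: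
  assumes X[measurable]: "random_variable borel X" and cont: "\<And>x. measure (distr M borel X) {x} = 0"
    and u: "0 \<le> u" "u \<le> 1"
  shows "prob {\<omega>\<in>space M. cdf (distr M borel X) (X \<omega>) < u} = u"
proof -
  interpret D: real_distribution "distr M borel X" by (rule real_distribution_distr) fact
  let ?F = "cdf (distr M borel X)"
  have Fm[measurable]: "?F \<in> borel_measurable borel" by (intro borel_measurable_mono monoI D.cdf_nondecreasing)
  have P: "?F x = prob {\<omega>\<in>space M. X \<omega> \<le> x}" for x
    by (simp add: cdf_def2 measure_distr vimage_def Int_def conj_commute)
  have ex: "\<exists>x. ?F x = v" if "0 < v" "v < 1" for v
  proof -
    have "eventually (\<lambda>x. ?F x < v) at_bot" using D.cdf_lim_at_bot that by (intro order_tendstoD(2)) auto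
    then obtain a where a: "?F a < v" by (auto simp: eventually_at_bot_linorder)
    have "eventually (\<lambda>x. ?F x > v) at_top" using D.cdf_lim_at_top_prob that by (intro order_tendstoD(1)) auto
    then obtain b where b: "?F b > v" by (auto simp: eventually_at_top_linorder)
    have ab: "a \<le> b" using a b D.cdf_nondecreasing[of b a] by linarith
    have "continuous_on {a..b} ?F" using cont by (intro continuous_at_imp_continuous_on) (auto simp: D.isCont_cdf)
    from IVT'[of ?F a v b] this a b ab show ?thesis by auto
  qed
  have le: "prob {\<omega>\<in>space M. ?F (X \<omega>) < v} \<le> v" if v: "0 \<le> v" "v \<le> 1" for v
  proof -
    consider "v = 0" | "v = 1" | "0 < v" "v < 1" using v by linarith
    then show ?thesis
    proof cases
      case 1
      have e: "{\<omega>\<in>space M. ?F (X \<omega>) < v} = {}" using 1 D.cdf_nonneg by (auto simp: not_less)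
      show ?thesis unfolding e using 1 by simp
    next
      case 3
      then obtain x where x: "?F x = v" using ex by blast
      have "X \<omega> \<le> x" if "?F (X \<omega>) < v" for \<omega>
        using D.cdf_nondecreasing[of x "X \<omega>"] that x by linarith
      then have "prob {\<omega>\<in>space M. ?F (X \<omega>) < v} \<le> prob {\<omega>\<in>space M. X \<omega> \<le> x}"
        by (intro finite_measure_mono) auto
      then show ?thesis using P x by simp
    qed (simp add: prob_le_1)
  qed
  have ge: "v \<le> prob {\<omega>\<in>space M. ?F (X \<omega>) < u}" if v: "0 < v" "v < u" for v
  proof -
    obtain x where x: "?F x = v" using ex v u by force
    have "?F (X \<omega>) < u" if "X \<omega> \<le> x" for \<omega>
      using D.cdf_nondecreasing[OF that] x v by linarith
    then have "prob {\<omega>\<in>space M. X \<omega> \<le> x} \<le> prob {\<omega>\<in>space M. ?F (X \<omega>) < u}"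
      by (intro finite_measure_mono) auto
    then show ?thesis using P x by simp
  qed
  have "u \<le> prob {\<omega>\<in>space M. ?F (X \<omega>) < u}"
  proof (cases "u = 0")
    case False
    then show ?thesis using ge u by (intro dense_le_bounded[of 0 u]) auto
  qed simp
  then show ?thesis using le[OF u] by simp
qed

lemma (in prob_space) norm_cdf_uniform:
  assumes m: "m \<ge> 1" and g: "distributed M lborel g (normal_density 0 (sqrt (real m)))" and u: "0 \<le> u" "u \<le> 1"
  shows "prob {\<omega>\<in>space M. norm_cdf m (g \<omega>) < u} = u"
proof -
  have gm[measurable]: "g \<in> borel_measurable M" using distributed_measurable[OF g] by simp
  have d: "distr M borel g = density lborel (normal_density 0 (sqrt (real m)))"
    using g by (simp add: distributed_def cong: distr_cong)
  have "prob {\<omega>\<in>space M. cdf (distr M borel g) (g \<omega>) < u} = u"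
  proof (rule cdf_uniform[OF gm _ u])
    fix x :: real
    have "emeasure (density lborel (\<lambda>t. ennreal (normal_density 0 (sqrt (real m)) t))) {x} = 0"
      by (subst emeasure_density) (auto intro!: nn_integral_0_iff_AE[THEN iffD2] AE_I[where N = "{x}"])
    then show "measure (distr M borel g) {x} = 0" unfolding d by (simp add: measure_def)
  qed
  then show ?thesis by (simp add: d norm_cdf_def)
qed

lemma norm_cdf_nonneg: "0 \<le> norm_cdf m x"
  by (simp add: norm_cdf_def cdf_def)

text \<open>If r is entry k of the sorted list, the event says that the uniform variable falls into
  the k-th of 2^m intervals of equal length. For the last k the minimum in
  \<open>block_signs\<close> adds the value 1, so only the lower end counts.\<close>

lemma (in prob_space) block_signs_uniform:
  assumes m: "m \<ge> 1" and g: "distributed M lborel g (normal_density 0 (sqrt (real m)))" and r: "r \<in> sign_lists m"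
  shows "prob {\<omega>\<in>space M. block_signs m (g \<omega>) = r} = 1 / 2 ^ m"
proof -
  have gm[measurable]: "g \<in> borel_measurable M" using distributed_measurable[OF g] by simp
  note [measurable] = norm_cdf_measurable[OF m]
  obtain k where k: "k < 2 ^ m" "r = sorted_signs m ! k"
    using r by (auto simp: set_sorted_signs[symmetric] in_set_conv_nth length_sorted_signs)
  let ?U = "\<lambda>\<omega>. norm_cdf m (g \<omega>)"
  let ?L = "\<lambda>c. {\<omega>\<in>space M. ?U \<omega> < c}"
  have L: "prob (?L c) = c" if "0 \<le> c" "c \<le> 1" for c using norm_cdf_uniform[OF m g that] .
  have lt: "min (2 ^ m - 1) j < 2 ^ m" for j :: nat by (simp add: min_less_iff_disj)
  have iff: "block_signs m (g \<omega>) = r \<longleftrightarrow> min (2 ^ m - 1) (nat \<lfloor>2 ^ m * ?U \<omega>\<rfloor>) = k" for \<omega>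
    unfolding block_signs_def k(2) using lt k(1)
    by (intro nth_eq_iff_index_eq) (simp_all add: distinct_sorted_signs length_sorted_signs)
  have fl: "j \<le> nat \<lfloor>2 ^ m * ?U \<omega>\<rfloor> \<longleftrightarrow> \<not> ?U \<omega> < real j / 2 ^ m" for j \<omega>
    using norm_cdf_nonneg[of m "g \<omega>"] by (simp add: le_nat_iff le_floor_iff not_less pos_divide_le_eq mult.commute)
  have c: "real k / 2 ^ m \<le> 1" using k(1) of_nat_mono[of k "2 ^ m"] by (simp add: pos_divide_le_eq)
  show ?thesis
  proof (cases "Suc k = 2 ^ m")
    case True
    have "min (2 ^ m - 1) j = k \<longleftrightarrow> k \<le> j" for j using True by (auto simp: min_def)
    then have "{\<omega>\<in>space M. block_signs m (g \<omega>) = r} = space M - ?L (real k / 2 ^ m)"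
      unfolding iff using fl by auto
    then have "prob {\<omega>\<in>space M. block_signs m (g \<omega>) = r} = 1 - real k / 2 ^ m"
      using L[OF _ c] by (simp add: prob_compl)
    also have "real k = 2 ^ m - 1" using arg_cong[OF True, of real] by simp
    finally show ?thesis by (simp add: field_simps)
  next
    case False
    have d: "real (Suc k) / 2 ^ m \<le> 1" using k(1) False of_nat_mono[of "Suc k" "2 ^ m", where 'a = real] by (simp add: pos_divide_le_eq)
    have "min (2 ^ m - 1) j = k \<longleftrightarrow> k \<le> j \<and> \<not> Suc k \<le> j" for j using False k by (auto simp: min_def)
    then have "{\<omega>\<in>space M. block_signs m (g \<omega>) = r} = ?L (real (Suc k) / 2 ^ m) - ?L (real k / 2 ^ m)"
      unfolding iff using fl by auto
    moreover have "prob (?L (real (Suc k) / 2 ^ m) - ?L (real k / 2 ^ m)) = prob (?L (real (Suc k) / 2 ^ m)) - prob (?L (real k / 2 ^ m))"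
    proof (rule finite_measure_Diff)
      have "real k / 2 ^ m \<le> real (Suc k) / 2 ^ m" by (intro divide_right_mono) auto
      then show "?L (real k / 2 ^ m) \<subseteq> ?L (real (Suc k) / 2 ^ m)" by force
    qed measurable
    ultimately show ?thesis using L[OF _ c] L[OF _ d] by (simp add: diff_divide_distrib[symmetric] del: of_nat_Suc)
  qed
qed

text \<open>The sum of the signs is a monotone function of g. Hence for one Lipschitz f the distance
  |g - sum| equals f(g) - f(sum), whose mean depends only on the two laws and is controlled by
  \<open>wasserstein_rademacher_normal\<close>.\<close>

lemma (in prob_space) block_signs_coupling:
  fixes y :: "'i \<Rightarrow> 'a \<Rightarrow> real"
  assumes I: "finite I" "I \<noteq> {}" and ind: "indep_vars (\<lambda>_. borel) y I"
    and d: "\<And>i. i \<in> I \<Longrightarrow> distributed M lborel (y i) std_normal_density"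
  defines "m \<equiv> card I" and "g \<equiv> \<lambda>\<omega>. \<Sum>i\<in>I. y i \<omega>"
  shows "distributed M lborel g (normal_density 0 (sqrt (real m)))"
    and "integrable M (\<lambda>\<omega>. \<bar>g \<omega> - real_of_int (sum_list (block_signs m (g \<omega>)))\<bar>)"
    and "expectation (\<lambda>\<omega>. \<bar>g \<omega> - real_of_int (sum_list (block_signs m (g \<omega>)))\<bar>) \<le> w1_const * real m powr (1/3)"
proof -
  have m: "m \<ge> 1" using I by (simp add: m_def Suc_le_eq card_gt_0_iff)
  have "distributed M lborel (\<lambda>\<omega>. \<Sum>i\<in>I. y i \<omega>) (normal_density (\<Sum>i\<in>I. 0) (sqrt (\<Sum>i\<in>I. 1\<^sup>2)))"
    by (rule sum_indep_normal) (use I ind d in auto)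
  then show g: "distributed M lborel g (normal_density 0 (sqrt (real m)))"
    by (simp add: g_def m_def)
  have gm[measurable]: "g \<in> borel_measurable M" using distributed_measurable[OF g] by simp
  have ig: "integrable M g" unfolding g_def using normal_integrable[OF d] by auto
  let ?h = "\<lambda>x. real_of_int (sum_list (block_signs m x))"
  obtain f where f: "lip1 f" "\<And>x. f x - f (?h x) = \<bar>x - ?h x\<bar>"
    using monotone_coupling_lip1[OF sum_block_signs_mono[OF m]] by blast
  let ?E = "\<lambda>r. {\<omega>\<in>space M. block_signs m (g \<omega>) = r}"
  have E: "?E r \<in> events" for r
    using measurable_compose[OF gm block_signs_measurable[OF m]] by (auto intro: measurable_sets_Collect simp: measurable_count_space_const pred_def intro!: pred_sets2)
  have rep: "F (block_signs m (g \<omega>)) = (\<Sum>r\<in>sign_lists m. F r * indicator (?E r) \<omega>)" if "\<omega> \<in> space M" for F :: "int list \<Rightarrow> real" and \<omega>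
    using that block_signs_in[of m "g \<omega>"] finite_sign_lists[of m]
    by (simp add: indicator_def if_distrib[of "\<lambda>t. _ * t"] sum.delta' eq_commute[of "block_signs m (g \<omega>)"] cong: if_cong)
  have int: "integrable M (\<lambda>\<omega>. F (block_signs m (g \<omega>)))" 
    and ex: "expectation (\<lambda>\<omega>. F (block_signs m (g \<omega>))) = (\<Sum>r\<in>sign_lists m. F r) / 2 ^ m" for F :: "int list \<Rightarrow> real"
  proof -
    show "integrable M (\<lambda>\<omega>. F (block_signs m (g \<omega>)))"
      by (subst Bochner_Integration.integrable_cong[OF refl rep]) (use E in \<open>auto intro!: Bochner_Integration.integrable_sum integrable_mult_right integrable_real_indicator simp: emeasure_eq_measure\<close>)
    have "expectation (\<lambda>\<omega>. F (block_signs m (g \<omega>))) = (\<Sum>r\<in>sign_lists m. F r * prob (?E r))"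
      by (subst Bochner_Integration.integral_cong[OF refl rep], simp, subst Bochner_Integration.integral_sum)
        (use E in \<open>auto intro!: integrable_mult_right integrable_real_indicator simp: emeasure_eq_measure\<close>)
    also have "\<dots> = (\<Sum>r\<in>sign_lists m. F r * (1 / 2 ^ m))"
      by (intro sum.cong refl arg_cong2[where f = "(*)"] block_signs_uniform[OF m g])
    finally show "expectation (\<lambda>\<omega>. F (block_signs m (g \<omega>))) = (\<Sum>r\<in>sign_lists m. F r) / 2 ^ m"
      by (simp add: sum_divide_distrib)
  qed
  have i1: "integrable M (\<lambda>\<omega>. f (g \<omega>))" by (rule lip1_integrable[OF f(1) ig])
  have i2: "integrable M (\<lambda>\<omega>. f (?h (g \<omega>)))" by (rule int)
  show "integrable M (\<lambda>\<omega>. \<bar>g \<omega> - ?h (g \<omega>)\<bar>)"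
    unfolding f(2)[symmetric] using i1 i2 by auto
  have "expectation (\<lambda>\<omega>. \<bar>g \<omega> - ?h (g \<omega>)\<bar>) = expectation (\<lambda>\<omega>. f (g \<omega>)) - rad_avg m f 0"
    unfolding f(2)[symmetric] using i1 i2 ex[of "\<lambda>r. f (real_of_int (sum_list r))"] by (simp add: rad_avg_eq)
  also have "\<dots> \<le> w1_const * real m powr (1/3)"
    using wasserstein_rademacher_normal[OF I ind d f(1)] by (simp add: g_def m_def)
  finally show "expectation (\<lambda>\<omega>. \<bar>g \<omega> - ?h (g \<omega>)\<bar>) \<le> w1_const * real m powr (1/3)" .
qed

section \<open>Independent blocks\<close>

text \<open>A finite intersection of events is sorted by blocks. Its probability factors over the
  blocks because these are independent as vectors, and then inside each block.\<close>

lemma (in prob_space) indep_vars_flatten: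
  assumes disj: "disjoint_family_on J L"
    and blocks: "indep_vars (\<lambda>l. PiM (J l) M') (\<lambda>l \<omega>. \<lambda>k\<in>J l. Z k \<omega>) L"
    and within: "\<And>l. l \<in> L \<Longrightarrow> indep_vars M' Z (J l)"
  shows "indep_vars M' Z (\<Union>l\<in>L. J l)"
  unfolding indep_vars_def2
proof (intro conjI ballI)
  fix k assume "k \<in> (\<Union>l\<in>L. J l)"
  then show "random_variable (M' k) (Z k)" using within by (auto simp: indep_vars_def2)
next
  have rv: "random_variable (M' k) (Z k)" if "k \<in> J l" "l \<in> L" for k l
    using within that by (auto simp: indep_vars_def2)
  show "indep_sets (\<lambda>k. {Z k -` A \<inter> space M |A. A \<in> sets (M' k)}) (\<Union>l\<in>L. J l)"
    unfolding indep_sets_def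
  proof (intro conjI ballI allI impI)
    fix k assume "k \<in> (\<Union>l\<in>L. J l)"
    then show "{Z k -` A \<inter> space M |A. A \<in> sets (M' k)} \<subseteq> events"
      using rv by (auto intro: measurable_sets)
  next
    fix K A assume K: "K \<subseteq> (\<Union>l\<in>L. J l)" "K \<noteq> {}" "finite K"
      and A: "A \<in> (\<Pi> k\<in>K. {Z k -` A \<inter> space M |A. A \<in> sets (M' k)})"
    have "\<forall>k\<in>K. \<exists>B. B \<in> sets (M' k) \<and> A k = Z k -` B \<inter> space M" using A by (auto simp: Pi_iff)
    then obtain B where B: "\<And>k. k \<in> K \<Longrightarrow> B k \<in> sets (M' k)" "\<And>k. k \<in> K \<Longrightarrow> A k = Z k -` B k \<inter> space M"
      by metis
    have "\<forall>k\<in>K. \<exists>l. l \<in> L \<and> k \<in> J l" using K by auto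
    then obtain b where b: "\<And>k. k \<in> K \<Longrightarrow> b k \<in> L" "\<And>k. k \<in> K \<Longrightarrow> k \<in> J (b k)" by metis
    define L' where "L' = b ` K"
    define Kl where "Kl l = {k\<in>K. b k = l}" for l
    have L': "finite L'" "L' \<noteq> {}" "L' \<subseteq> L" using K b by (auto simp: L'_def)
    have Kl: "finite (Kl l)" "Kl l \<subseteq> J l" "Kl l \<subseteq> K" for l using K b by (auto simp: Kl_def)
    have Kl_ne: "Kl l \<noteq> {}" if "l \<in> L'" for l using that by (auto simp: L'_def Kl_def)
    define G where "G l = prod_emb (J l) M' (Kl l) (Pi\<^sub>E (Kl l) B)" for l
    have G: "G l \<in> sets (PiM (J l) M')" for l
      unfolding G_def by (rule sets_PiM_I[OF Kl(1,2)]) (use Kl(3) B(1) in blast)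
    have pre: "(\<lambda>\<omega>. \<lambda>k\<in>J l. Z k \<omega>) -` G l \<inter> space M = (\<Inter>k\<in>Kl l. A k)" if l: "l \<in> L'" for l
    proof -
      have lL: "l \<in> L" using l L' by auto
      have "\<omega> \<in> (\<lambda>\<omega>. \<lambda>k\<in>J l. Z k \<omega>) -` G l \<longleftrightarrow> (\<forall>k\<in>Kl l. Z k \<omega> \<in> B k)" if w: "\<omega> \<in> space M" for \<omega>
        using Kl(2)[of l] rv[OF _ lL, THEN measurable_space, OF _ w]
        by (auto simp: G_def prod_emb_def PiE_iff restrict_def extensional_def Pi_iff subset_iff)
      then show ?thesis using B(2) Kl(3)[of l] Kl_ne[OF l] by (auto simp: subset_iff)
    qed
    have "prob (\<Inter>k\<in>K. A k) = prob (\<Inter>l\<in>L'. (\<lambda>\<omega>. \<lambda>k\<in>J l. Z k \<omega>) -` G l \<inter> space M)"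
    proof (rule arg_cong[where f = prob])
      have "(\<Inter>k\<in>K. A k) = (\<Inter>l\<in>L'. \<Inter>k\<in>Kl l. A k)" by (auto simp: L'_def Kl_def)
      then show "(\<Inter>k\<in>K. A k) = (\<Inter>l\<in>L'. (\<lambda>\<omega>. \<lambda>k\<in>J l. Z k \<omega>) -` G l \<inter> space M)" using pre by simp
    qed
    also have "\<dots> = (\<Prod>l\<in>L'. prob ((\<lambda>\<omega>. \<lambda>k\<in>J l. Z k \<omega>) -` G l \<inter> space M))"
      by (rule indep_varsD[OF blocks]) (use L' G in auto)
    also have "\<dots> = (\<Prod>l\<in>L'. \<Prod>k\<in>Kl l. prob (A k))"
    proof (rule prod.cong[OF refl])
      fix l assume l: "l \<in> L'"
      have "prob (\<Inter>k\<in>Kl l. Z k -` B k \<inter> space M) = (\<Prod>k\<in>Kl l. prob (Z k -` B k \<inter> space M))"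
        by (rule indep_varsD[OF within]) (use l L' Kl[of l] Kl_ne[OF l] B in auto)
      then show "prob ((\<lambda>\<omega>. \<lambda>k\<in>J l. Z k \<omega>) -` G l \<inter> space M) = (\<Prod>k\<in>Kl l. prob (A k))"
        unfolding pre[OF l] using B(2) Kl(3)[of l] by (simp add: subset_iff cong: INF_cong prod.cong)
    qed
    also have "\<dots> = (\<Prod>k\<in>K. prob (A k))"
      unfolding L'_def Kl_def by (rule prod.image_gen[OF K(3), symmetric])
    finally show "prob (\<Inter>k\<in>K. A k) = (\<Prod>k\<in>K. prob (A k))" .
  qed
qed

lemma (in prob_space) indep_vars_reindex_inj:
  assumes X: "indep_vars (\<lambda>_. N) X I" and f: "inj_on f J" "f ` J \<subseteq> I"
  shows "indep_vars (\<lambda>_. N) (\<lambda>j. X (f j)) J"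
  unfolding indep_vars_def2 indep_sets_def
proof (intro conjI ballI allI impI)
  fix K A assume K: "K \<subseteq> J" "K \<noteq> {}" "finite K" and A: "A \<in> (\<Pi> j\<in>K. {X (f j) -` A \<inter> space M |A. A \<in> sets N})"
  have "\<forall>j\<in>K. \<exists>B. B \<in> sets N \<and> A j = X (f j) -` B \<inter> space M" using A by (auto simp: Pi_iff)
  then obtain B where B: "\<And>j. j \<in> K \<Longrightarrow> B j \<in> sets N" "\<And>j. j \<in> K \<Longrightarrow> A j = X (f j) -` B j \<inter> space M" by metis
  have inj: "inj_on f K" using f K inj_on_subset by blast
  define C where "C i = B (the_inv_into K f i)" for i
  have C: "C (f j) = B j" if "j \<in> K" for j using that inj by (simp add: C_def the_inv_into_f_f)
  have "prob (\<Inter>i\<in>f ` K. X i -` C i \<inter> space M) = (\<Prod>i\<in>f ` K. prob (X i -` C i \<inter> space M))"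
    by (rule indep_varsD[OF X]) (use K f B C in auto)
  moreover have "(\<Inter>i\<in>f ` K. X i -` C i \<inter> space M) = (\<Inter>j\<in>K. A j)" using B(2) C by auto
  moreover have "(\<Prod>i\<in>f ` K. prob (X i -` C i \<inter> space M)) = (\<Prod>j\<in>K. prob (A j))"
    using inj B(2) C by (simp add: prod.reindex)
  ultimately show "prob (\<Inter>j\<in>K. A j) = (\<Prod>j\<in>K. prob (A j))" by simp
qed (use X f in \<open>auto simp: indep_vars_def2 intro: measurable_sets\<close>)

text \<open>The number of sign vectors in a product set is a product. Under the uniform law this is
  the independence of the entries.\<close>

lemma card_sign_lists_restrict:
  "card {r\<in>sign_lists m. \<forall>j<m. r ! j \<in> B j} = (\<Prod>j<m. card (B j \<inter> {- 1, 1}))"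
proof (induction m arbitrary: B)
  case 0
  have "{r\<in>sign_lists 0. \<forall>j<0. r ! j \<in> B j} = {[]}" by (auto simp: sign_lists_def)
  then show ?case by simp
next
  case (Suc m)
  let ?T = "{r\<in>sign_lists m. \<forall>j<m. r ! j \<in> B (Suc j)}"
  have "{r\<in>sign_lists (Suc m). \<forall>j<Suc m. r ! j \<in> B j} = (\<lambda>(s, r). s # r) ` ((B 0 \<inter> {- 1, 1}) \<times> ?T)"
  proof (rule set_eqI)
    fix r
    have "r \<in> sign_lists (Suc m) \<longleftrightarrow> (\<exists>s t. r = s # t \<and> s \<in> {- 1, 1} \<and> t \<in> sign_lists m)"
      by (auto simp: sign_lists_Suc)
    moreover have "(\<forall>j<Suc m. (s # t) ! j \<in> B j) \<longleftrightarrow> s \<in> B 0 \<and> (\<forall>j<m. t ! j \<in> B (Suc j))" for s t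
      by (subst All_less_Suc2) simp
    ultimately show "r \<in> {r\<in>sign_lists (Suc m). \<forall>j<Suc m. r ! j \<in> B j} \<longleftrightarrow> r \<in> (\<lambda>(s, r). s # r) ` ((B 0 \<inter> {- 1, 1}) \<times> ?T)"
      by (simp only: mem_Collect_eq image_iff bex_simps split_paired_Ex Bex_def mem_Sigma_iff prod.case Int_iff) blast
  qed
  moreover have "inj_on (\<lambda>(s, r). s # r) ((B 0 \<inter> {- 1, 1}) \<times> ?T)" by (auto simp: inj_on_def)
  ultimately have "card {r\<in>sign_lists (Suc m). \<forall>j<Suc m. r ! j \<in> B j} = card (B 0 \<inter> {- 1, 1}) * card ?T"
    by (simp add: card_image card_cartesian_product)
  then show ?case by (simp del: prod.lessThan_Suc add: Suc.IH prod.lessThan_Suc_shift)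
qed

section \<open>Blocks of polynomial length\<close>

text \<open>The length of block \<open>i\<close> is \<open>O(i\<^bsup>15\<^esup>)\<close>, that is \<open>O(n\<^bsup>15/16\<^esup>)\<close> for \<open>n\<close> in the block, and its cube
  root is \<open>O(i\<^sup>5)\<close>.\<close>

definition blk :: "nat \<Rightarrow> nat set" where "blk i = {i ^ 16<..Suc i ^ 16}"
definition bsize :: "nat \<Rightarrow> nat" where "bsize i = Suc i ^ 16 - i ^ 16"
definition bidx :: "nat \<Rightarrow> nat" where "bidx n = (LEAST i. n \<le> Suc i ^ 16)"

lemma card_blk: "card (blk i) = bsize i" by (simp add: blk_def bsize_def)

lemma finite_blk: "finite (blk i)" by (simp add: blk_def)

lemma pow16_less: "i ^ 16 < Suc i ^ 16" by (rule power_strict_mono) auto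

lemma bsize_pos: "bsize i \<ge> 1" using pow16_less[of i] by (simp add: bsize_def)

lemma blk_nonempty: "blk i \<noteq> {}" using pow16_less[of i] by (auto simp: blk_def)

lemma blk_iff: assumes n: "n \<ge> 1" shows "n \<in> blk i \<longleftrightarrow> bidx n = i"
proof -
  have "n \<le> Suc n ^ 16" using self_le_power[of "Suc n" 16] by linarith
  then have 1: "n \<le> Suc (bidx n) ^ 16" unfolding bidx_def by (rule LeastI)
  have 2: "bidx n ^ 16 < n"
  proof (cases "bidx n")
    case (Suc c)
    then have "\<not> n \<le> Suc c ^ 16" using not_less_Least[of c "\<lambda>i. n \<le> Suc i ^ 16"] by (simp add: bidx_def)
    then show ?thesis using Suc by simp
  qed (use n in simp)
  have 3: "bidx n = i" if "i ^ 16 < n" "n \<le> Suc i ^ 16"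
  proof (rule ccontr)
    assume "bidx n \<noteq> i"
    then consider "Suc (bidx n) \<le> i" | "Suc i \<le> bidx n" by linarith
    then show False
    proof cases
      case 1
      then have "Suc (bidx n) ^ 16 \<le> i ^ 16" by (rule power_mono) simp
      then show False using that \<open>n \<le> Suc (bidx n) ^ 16\<close> by linarith
    next
      case 2
      then have "Suc i ^ 16 \<le> bidx n ^ 16" by (rule power_mono) simp
      then show False using that \<open>bidx n ^ 16 < n\<close> by linarith
    qed
  qed
  show ?thesis using 1 2 3 by (auto simp: blk_def)
qed

lemma in_blk_bidx: "n \<ge> 1 \<Longrightarrow> n \<in> blk (bidx n)" by (simp add: blk_iff)

lemma blk_ge_1: "n \<in> blk i \<Longrightarrow> n \<ge> 1" by (simp add: blk_def)

lemma bidx_blk: "n \<in> blk i \<Longrightarrow> bidx n = i" using blk_iff[OF blk_ge_1] by blast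

lemma bij_blk: "bij_betw (\<lambda>j. i ^ 16 + Suc j) {..<bsize i} (blk i)"
  by (rule bij_betw_byWitness[where f' = "\<lambda>n. n - i ^ 16 - 1"]) (auto simp: blk_def bsize_def)

section \<open>Signs read off from the normal variables\<close>

text \<open>The variables \<open>y (True, n, v)\<close> are the normal ones and \<open>y (False, n, v)\<close> the uniform ones.\<close>

locale coupling_base = prob_space M for M :: "'a measure" +
  fixes y :: "bool \<times> nat \<times> 'v::finite \<Rightarrow> 'a \<Rightarrow> real"
  assumes y_indep: "indep_vars (\<lambda>_. borel) y UNIV"
    and y_normal: "\<And>n v. distributed M lborel (y (True, n, v)) std_normal_density"
    and y_unif: "\<And>n v c. 0 \<le> c \<Longrightarrow> c \<le> 1 \<Longrightarrow> prob {\<omega>\<in>space M. y (False, n, v) \<omega> < c} = c"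
begin

lemma y_measurable[measurable]: "y k \<in> borel_measurable M"
  using y_indep unfolding indep_vars_def2 by blast

definition bsum :: "nat \<Rightarrow> 'v \<Rightarrow> 'a \<Rightarrow> real" where
  "bsum i v \<omega> = (\<Sum>j\<in>blk i. y (True, j, v) \<omega>)"

text \<open>The sign depends on the normal variables of its whole block, including those after time
  n. Positions inside the block \<open>i^16 < n\<close> are counted from 0, whence the final
  1.\<close>

definition rad :: "nat \<Rightarrow> 'v \<Rightarrow> 'a \<Rightarrow> real" where
  "rad n v \<omega> = real_of_int (block_signs (bsize (bidx n)) (bsum (bidx n) v \<omega>) ! (n - bidx n ^ 16 - 1))"

text \<open>In \<open>Z\<close>, the normal variables of \<open>y\<close> are replaced by the Rademacher variables that they
  determine.\<close>

definition Z :: "bool \<times> nat \<times> 'v \<Rightarrow> 'a \<Rightarrow> real" where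
  "Z k \<omega> = (case k of (b, n, v) \<Rightarrow> if b then rad n v \<omega> else y k \<omega>)"

lemma bsum_measurable[measurable]: "bsum i v \<in> borel_measurable M"
  unfolding bsum_def[abs_def] by measurable

lemma rad_measurable[measurable]: "rad n v \<in> borel_measurable M"
proof -
  have "(\<lambda>\<omega>. block_signs (bsize (bidx n)) (bsum (bidx n) v \<omega>)) \<in> measurable M (count_space UNIV)"
    by (rule measurable_compose[OF _ block_signs_measurable[OF bsize_pos]]) measurable
  from measurable_compose[OF this, of "\<lambda>r. real_of_int (r ! (n - bidx n ^ 16 - 1))" borel]
  show ?thesis by (simp add: rad_def[abs_def])
qed

lemma Z_measurable[measurable]: "Z k \<in> borel_measurable M"
  by (cases k) (auto simp: Z_def[abs_def])

lemma indep_block: "indep_vars (\<lambda>_. borel) (\<lambda>j. y (True, j, v)) I"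
  by (rule indep_vars_reindex_inj[OF y_indep]) (auto simp: inj_on_def)

lemmas bsum_coupling =
  block_signs_coupling[OF finite_blk blk_nonempty indep_block y_normal, folded bsum_def, unfolded card_blk]

lemma rad_in:
  assumes n: "n \<ge> 1" shows "rad n v \<omega> \<in> {- 1, 1}"
proof -
  let ?r = "block_signs (bsize (bidx n)) (bsum (bidx n) v \<omega>)"
  have r: "length ?r = bsize (bidx n)" "set ?r \<subseteq> {- 1, 1}"
    using block_signs_in[of "bsize (bidx n)" "bsum (bidx n) v \<omega>"] by (auto simp: sign_lists_def)
  have "n - bidx n ^ 16 - 1 < bsize (bidx n)" using in_blk_bidx[OF n] by (auto simp: blk_def bsize_def)
  then have "?r ! (n - bidx n ^ 16 - 1) \<in> {- 1, 1}" using r nth_mem by (metis subsetD)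
  then show ?thesis by (auto simp: rad_def)
qed

lemma sum_rad_blk: "(\<Sum>n\<in>blk i. rad n v \<omega>) = real_of_int (sum_list (block_signs (bsize i) (bsum i v \<omega>)))"
proof -
  let ?r = "block_signs (bsize i) (bsum i v \<omega>)"
  have r: "length ?r = bsize i"
    using block_signs_in[of "bsize i" "bsum i v \<omega>"] by (auto simp: sign_lists_def)
  have "(\<Sum>n\<in>blk i. rad n v \<omega>) = (\<Sum>n\<in>blk i. real_of_int (?r ! (n - i ^ 16 - 1)))"
    by (intro sum.cong refl) (simp add: rad_def bidx_blk)
  also have "\<dots> = (\<Sum>j<bsize i. real_of_int (?r ! j))"
    by (subst sum.reindex_bij_betw[OF bij_blk, symmetric]) simp
  finally show ?thesis by (simp add: sum_list_sum_nth r atLeast0LessThan)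
qed

text \<open>The sign vector of the block is uniform and the constraint describes a product set of
  vectors. Entries outside K are left free by \<open>B\<close> and contribute factors 2/2.\<close>

lemma rad_block_prob:
  assumes K: "K \<subseteq> blk i"
  shows "prob {\<omega>\<in>space M. \<forall>n\<in>K. rad n v \<omega> \<in> A n} = (\<Prod>n\<in>K. real (card ({s. real_of_int s \<in> A n} \<inter> {- 1, 1})) / 2)"
proof -
  let ?m = "bsize i" and ?b = "\<lambda>\<omega>. block_signs (bsize i) (bsum i v \<omega>)"
  define B where "B j = (if i ^ 16 + Suc j \<in> K then {s. real_of_int s \<in> A (i ^ 16 + Suc j)} else UNIV)" for j
  let ?G = "{r\<in>sign_lists ?m. \<forall>j<?m. r ! j \<in> B j}"
  have "(\<forall>n\<in>K. rad n v \<omega> \<in> A n) \<longleftrightarrow> ?b \<omega> \<in> ?G" for \<omega>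
  proof -
    have "(\<forall>n\<in>K. rad n v \<omega> \<in> A n) \<longleftrightarrow> (\<forall>n\<in>blk i. n \<in> K \<longrightarrow> real_of_int (?b \<omega> ! (n - i ^ 16 - 1)) \<in> A n)"
      using K by (auto simp: rad_def bidx_blk)
    also have "\<dots> \<longleftrightarrow> (\<forall>n\<in>(\<lambda>j. i ^ 16 + Suc j) ` {..<?m}. n \<in> K \<longrightarrow> real_of_int (?b \<omega> ! (n - i ^ 16 - 1)) \<in> A n)"
      using bij_blk[of i] by (simp add: bij_betw_def)
    also have "\<dots> \<longleftrightarrow> (\<forall>j<?m. ?b \<omega> ! j \<in> B j)" by (auto simp: B_def)
    finally show ?thesis using block_signs_in by simp
  qed
  then have eq: "{\<omega>\<in>space M. \<forall>n\<in>K. rad n v \<omega> \<in> A n} = (\<Union>r\<in>?G. {\<omega>\<in>space M. ?b \<omega> = r})" by auto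
  have bm: "?b \<in> measurable M (count_space UNIV)"
    by (rule measurable_compose[OF _ block_signs_measurable[OF bsize_pos]]) measurable
  have "prob (\<Union>r\<in>?G. {\<omega>\<in>space M. ?b \<omega> = r}) = (\<Sum>r\<in>?G. prob {\<omega>\<in>space M. ?b \<omega> = r})"
  proof (rule finite_measure_finite_Union)
    show "(\<lambda>r. {\<omega>\<in>space M. ?b \<omega> = r}) ` ?G \<subseteq> events"
      using measurable_sets[OF bm, of "{_}"] by (auto simp: vimage_def Int_def conj_commute)
  qed (auto simp: disjoint_family_on_def finite_sign_lists)
  also have "\<dots> = (\<Sum>r\<in>?G. 1 / 2 ^ ?m)"
    by (intro sum.cong refl block_signs_uniform bsize_pos bsum_coupling(1)) auto
  also have "\<dots> = real (\<Prod>j<?m. card (B j \<inter> {- 1, 1})) / 2 ^ ?m"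
    by (simp add: card_sign_lists_restrict)
  also have "\<dots> = (\<Prod>j<?m. real (card (B j \<inter> {- 1, 1})) / 2)"
    by (simp add: prod_dividef)
  also have "\<dots> = (\<Prod>j<?m. (\<lambda>n. if n \<in> K then real (card ({s. real_of_int s \<in> A n} \<inter> {- 1, 1})) / 2 else 1) (i ^ 16 + Suc j))"
    by (intro prod.cong refl) (simp add: B_def)
  also have "\<dots> = (\<Prod>n\<in>blk i. if n \<in> K then real (card ({s. real_of_int s \<in> A n} \<inter> {- 1, 1})) / 2 else 1)"
    by (rule prod.reindex_bij_betw[OF bij_blk])
  also have "\<dots> = (\<Prod>n\<in>K. real (card ({s. real_of_int s \<in> A n} \<inter> {- 1, 1})) / 2)"
    using K by (subst prod.inter_restrict[symmetric]) (auto simp: finite_blk Int_absorb1)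
  finally show ?thesis unfolding eq .
qed

lemma rad_prob:
  assumes n: "n \<ge> 1" and s: "s \<in> {- 1, 1}"
  shows "prob {\<omega>\<in>space M. rad n v \<omega> = s} = 1 / 2"
proof -
  have "{t. real_of_int t \<in> {s}} \<inter> {- 1, 1} = (if s = 1 then {1} else {- 1})" using s by auto
  then show ?thesis using rad_block_prob[of "{n}" "bidx n" v "\<lambda>_. {s}"] in_blk_bidx[OF n] by simp
qed

text \<open>The family is cut into groups such that each \<open>Z\<close> is a function of the
  \<open>y\<close> in its own group: the normal variables of one block and one vertex, or a single
  uniform variable.\<close>

definition blockset :: "(nat \<times> 'v) + (nat \<times> 'v) \<Rightarrow> (bool \<times> nat \<times> 'v) set" where
  "blockset l = (case l of Inl (i, v) \<Rightarrow> (\<lambda>n. (True, n, v)) ` blk i | Inr (n, v) \<Rightarrow> {(False, n, v)})"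

definition Zfun :: "bool \<times> nat \<times> 'v \<Rightarrow> (bool \<times> nat \<times> 'v \<Rightarrow> real) \<Rightarrow> real" where
  "Zfun k f = (case k of (b, n, v) \<Rightarrow> if b then
      real_of_int (block_signs (bsize (bidx n)) (\<Sum>j\<in>blk (bidx n). f (True, j, v)) ! (n - bidx n ^ 16 - 1)) else f k)"

lemma Z_eq_Zfun: "k \<in> blockset l \<Longrightarrow> Z k \<omega> = Zfun k (\<lambda>k\<in>blockset l. y k \<omega>)"
  by (auto simp: blockset_def Zfun_def Z_def rad_def bsum_def bidx_blk split: sum.splits cong: sum.cong)

lemma Zfun_measurable: "k \<in> blockset l \<Longrightarrow> Zfun k \<in> borel_measurable (PiM (blockset l) (\<lambda>_. borel))"
proof (cases l)
  case (Inr nv)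
  assume "k \<in> blockset l"
  then show ?thesis using Inr by (cases nv) (auto simp: blockset_def Zfun_def[abs_def])
next
  case (Inl iv)
  assume k: "k \<in> blockset l"
  obtain i v where iv: "iv = (i, v)" by (cases iv)
  obtain n where n: "k = (True, n, v)" "n \<in> blk i" using k Inl iv by (auto simp: blockset_def)
  have "(\<lambda>f. \<Sum>j\<in>blk i. f (True, j, v) :: real) \<in> borel_measurable (PiM (blockset l) (\<lambda>_. borel))"
  proof (rule Borel_Space.borel_measurable_sum)
    fix j assume "j \<in> blk i"
    then have "(True, j, v) \<in> blockset l" by (simp add: Inl iv blockset_def)
    from measurable_component_singleton[OF this, of "\<lambda>_. borel"]
    show "(\<lambda>f. f (True, j, v)) \<in> borel_measurable (PiM (blockset l) (\<lambda>_. borel))" by simp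
  qed
  from measurable_compose[OF this block_signs_measurable[OF bsize_pos[of i]]]
  have "(\<lambda>f. block_signs (bsize i) (\<Sum>j\<in>blk i. f (True, j, v))) \<in> measurable (PiM (blockset l) (\<lambda>_. borel)) (count_space UNIV)" .
  from measurable_compose[OF this, of "\<lambda>r. real_of_int (r ! (n - i ^ 16 - 1))" borel]
  show ?thesis by (simp add: Zfun_def[abs_def] n(1) bidx_blk[OF n(2)])
qed

lemma disjoint_blockset: "disjoint_family_on blockset UNIV"
  by (auto simp: disjoint_family_on_def blockset_def bidx_blk[symmetric] split: sum.splits) (metis bidx_blk)+

text \<open>Different groups inherit their independence from \<open>y\<close>. Inside a group of
  signs it has a different source, the uniform law of the sign vector, since these signs are
  functions of one common sum. Time 0 is left out because it lies in no block.\<close>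

lemma Z_indep: "indep_vars (\<lambda>_. borel) Z (UNIV \<times> {1..} \<times> UNIV)"
proof -
  have "indep_vars (\<lambda>l. PiM (blockset l) (\<lambda>_. borel)) (\<lambda>l \<omega>. \<lambda>k\<in>blockset l. y k \<omega>) UNIV"
    by (rule indep_vars_restrict[OF y_indep _ disjoint_blockset]) auto
  then have "indep_vars (\<lambda>l. PiM (blockset l) (\<lambda>_. borel)) (\<lambda>l \<omega>. (\<lambda>f. \<lambda>k\<in>blockset l. Zfun k f) (\<lambda>k\<in>blockset l. y k \<omega>)) UNIV"
    by (rule indep_vars_compose2) (rule measurable_restrict, rule Zfun_measurable)
  moreover have "(\<lambda>k\<in>blockset l. Zfun k (\<lambda>k\<in>blockset l. y k \<omega>)) = (\<lambda>k\<in>blockset l. Z k \<omega>)" for l \<omega>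
    by (auto simp: Z_eq_Zfun restrict_def)
  ultimately have blocks: "indep_vars (\<lambda>l. PiM (blockset l) (\<lambda>_. borel)) (\<lambda>l \<omega>. \<lambda>k\<in>blockset l. Z k \<omega>) UNIV"
    by simp
  have "indep_vars (\<lambda>_. borel) Z (\<Union>l\<in>UNIV. blockset l)"
  proof (rule indep_vars_flatten[OF disjoint_blockset blocks])
    fix l :: "(nat \<times> 'v) + (nat \<times> 'v)"
    show "indep_vars (\<lambda>_. borel) Z (blockset l)"
    proof (cases l)
      case (Inr nv)
      obtain n v where "nv = (n, v)" by (cases nv)
      with Inr have bl: "blockset l = {(False, n, v)}" by (simp add: blockset_def)
      show ?thesis unfolding bl indep_vars_def2 indep_sets_def
      proof (intro conjI ballI allI impI)
        fix K A assume "K \<subseteq> {(False, n, v)}" "K \<noteq> {}"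
        then have "K = {(False, n, v)}" by auto
        then show "prob (\<Inter>(A ` K)) = (\<Prod>j\<in>K. prob (A j))" by simp
      qed (auto intro: measurable_sets)
    next
      case (Inl iv)
      obtain i v where iv: "iv = (i, v)" by (cases iv)
      with Inl have bl: "blockset l = (\<lambda>n. (True, n, v)) ` blk i" by (simp add: blockset_def)
      show ?thesis unfolding bl indep_vars_def2 indep_sets_def
      proof (intro conjI ballI allI impI)
        fix K A assume K: "K \<subseteq> (\<lambda>n. (True, n, v)) ` blk i" "K \<noteq> {}" "finite K"
          and A: "A \<in> (\<Pi> k\<in>K. {Z k -` A \<inter> space M |A. A \<in> sets borel})"
        have "\<forall>k\<in>K. \<exists>B. A k = Z k -` B \<inter> space M" using A unfolding Pi_iff by blast
        then obtain B where B: "\<And>k. k \<in> K \<Longrightarrow> A k = Z k -` B k \<inter> space M" by metis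
        define N where "N = (\<lambda>k. fst (snd k)) ` K"
        have KN: "K = (\<lambda>n. (True, n, v)) ` N" and N: "N \<subseteq> blk i" using K by (force simp: N_def)+
        have P: "prob {\<omega>\<in>space M. \<forall>n\<in>N'. rad n v \<omega> \<in> B (True, n, v)} = (\<Prod>n\<in>N'. real (card ({s. real_of_int s \<in> B (True, n, v)} \<inter> {- 1, 1})) / 2)" if "N' \<subseteq> N" for N'
          by (rule rad_block_prob) (use N that in auto)
        have 1: "(\<Inter>(A ` K)) = {\<omega>\<in>space M. \<forall>n\<in>N. rad n v \<omega> \<in> B (True, n, v)}"
          using K(2) B unfolding KN by (auto simp: Z_def)
        have 2: "A (True, n, v) = {\<omega>\<in>space M. \<forall>n\<in>{n}. rad n v \<omega> \<in> B (True, n, v)}" if "n \<in> N" for n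
          using B[of "(True, n, v)"] that unfolding KN by (auto simp: Z_def)
        have "(\<Prod>k\<in>K. prob (A k)) = (\<Prod>n\<in>N. prob (A (True, n, v)))"
          unfolding KN by (subst prod.reindex) (auto simp: inj_on_def)
        also have "\<dots> = (\<Prod>n\<in>N. real (card ({s. real_of_int s \<in> B (True, n, v)} \<inter> {- 1, 1})) / 2)"
          by (intro prod.cong refl) (subst 2, simp, subst P, auto)
        finally show "prob (\<Inter>(A ` K)) = (\<Prod>k\<in>K. prob (A k))" unfolding 1 P[OF subset_refl] by simp
      qed (auto intro: measurable_sets)
    qed
  qed
  moreover have "UNIV \<times> {1..} \<times> UNIV \<subseteq> (\<Union>l\<in>UNIV. blockset l)"
  proof
    fix k :: "bool \<times> nat \<times> 'v" assume "k \<in> UNIV \<times> {1..} \<times> UNIV"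
    then obtain b n v where k: "k = (b, n, v)" "n \<ge> 1" by auto
    show "k \<in> (\<Union>l\<in>UNIV. blockset l)"
    proof (cases b)
      case True
      then show ?thesis using k in_blk_bidx[of n]
        by (intro UN_I[of "Inl (bidx n, v)"]) (auto simp: blockset_def)
    next
      case False
      then show ?thesis using k by (intro UN_I[of "Inr (n, v)"]) (auto simp: blockset_def)
    qed
  qed
  ultimately show ?thesis by (rule indep_vars_subset)
qed

lemma rad_abs: "n \<ge> 1 \<Longrightarrow> \<bar>rad n v \<omega>\<bar> \<le> 1"
  using rad_in[of n v \<omega>] by auto

lemma rad_expectation:
  assumes n: "n \<ge> 1" shows "expectation (rad n v) = 0"
proof -
  have "expectation (rad n v) = expectation (\<lambda>\<omega>. indicator {\<omega>\<in>space M. rad n v \<omega> = 1} \<omega> - indicator {\<omega>\<in>space M. rad n v \<omega> = - 1} \<omega>)"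
    by (rule Bochner_Integration.integral_cong[OF refl]) (use rad_in[OF n, of v] in \<open>auto simp: indicator_def\<close>)
  also have "\<dots> = prob {\<omega>\<in>space M. rad n v \<omega> = 1} - prob {\<omega>\<in>space M. rad n v \<omega> = - 1}"
    by (subst Bochner_Integration.integral_diff) (auto simp: emeasure_eq_measure)
  finally show ?thesis using n by (simp add: rad_prob)
qed

end

section \<open>Laws of the processes\<close>

lemma vec_lambda_measurable:
  fixes f :: "'v::finite \<Rightarrow> 'a \<Rightarrow> real"
  assumes "\<And>v. f v \<in> borel_measurable M"
  shows "(\<lambda>\<omega>. \<chi> v. f v \<omega>) \<in> borel_measurable M"
proof (subst borel_measurable_euclidean_space, intro ballI)
  fix b :: "real ^ 'v" assume "b \<in> Basis"
  then obtain v where "b = axis v 1" by (auto simp: Basis_vec_def)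
  then show "(\<lambda>\<omega>. (\<chi> v. f v \<omega>) \<bullet> b) \<in> borel_measurable M"
    using assms[of v] by (simp add: inner_axis)
qed

lemma vec_nth_measurable:
  fixes s :: "'a \<Rightarrow> real ^ 'v::finite"
  assumes s: "s \<in> borel_measurable M"
  shows "(\<lambda>\<omega>. s \<omega> $ v) \<in> borel_measurable M"
proof -
  have "(\<lambda>\<omega>. s \<omega> \<bullet> axis v 1) \<in> borel_measurable M" using s by measurable
  then show ?thesis by (simp add: inner_axis)
qed

lemma walk_borel_measurable:
  fixes X :: "nat \<Rightarrow> 'v::finite \<Rightarrow> 'a \<Rightarrow> int"
  assumes X: "\<And>j v. j \<ge> 1 \<Longrightarrow> X j v \<in> measurable M (count_space UNIV)"
    and S: "\<And>n \<omega>. \<omega> \<in> space M \<Longrightarrow> S n \<omega> = (\<Sum>j=1..n. \<chi> v. real_of_int (X j v \<omega>))"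
  shows "S n \<in> borel_measurable M"
proof -
  have vec: "(\<lambda>\<omega>. \<chi> v. real_of_int (X j v \<omega>)) \<in> borel_measurable M" if "j \<ge> 1" for j
    by (rule vec_lambda_measurable, rule measurable_compose[OF X[OF that]]) simp
  have "(\<lambda>\<omega>. \<Sum>j=1..n. \<chi> v. real_of_int (X j v \<omega>)) \<in> borel_measurable M"
    by (rule Borel_Space.borel_measurable_sum) (use vec in auto)
  then show ?thesis by (subst measurable_cong[OF S])
qed

text \<open>Up to time N there are almost surely only finitely many sign paths, so an event about
  finitely many positions of the walk is, up to a null set, a finite disjoint union of path events.
  Such events determine the law on the product space.\<close>

lemma same_law_of_path_probs:
  fixes X :: "nat \<Rightarrow> 'v::finite \<Rightarrow> 'a \<Rightarrow> int" and X' :: "nat \<Rightarrow> 'v \<Rightarrow> 'b \<Rightarrow> int"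
  assumes M: "prob_space M" "prob_space M'"
    and X: "\<And>j v. j \<ge> 1 \<Longrightarrow> X j v \<in> measurable M (count_space UNIV)"
    and X': "\<And>j v. j \<ge> 1 \<Longrightarrow> X' j v \<in> measurable M' (count_space UNIV)"
    and S: "\<And>n \<omega>. \<omega> \<in> space M \<Longrightarrow> S n \<omega> = (\<Sum>j=1..n. \<chi> v. real_of_int (X j v \<omega>))"
    and S': "\<And>n \<omega>. \<omega> \<in> space M' \<Longrightarrow> S' n \<omega> = (\<Sum>j=1..n. \<chi> v. real_of_int (X' j v \<omega>))"
    and pm: "AE \<omega> in M. \<forall>j\<ge>1. \<forall>v. X j v \<omega> \<in> {- 1, 1}" and pm': "AE \<omega> in M'. \<forall>j\<ge>1. \<forall>v. X' j v \<omega> \<in> {- 1, 1}"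
    and path: "\<And>N x. (\<And>j v. x j v \<in> {- 1, 1 :: int}) \<Longrightarrow>
       measure M {\<omega>\<in>space M. \<forall>j\<in>{1..N}. \<forall>v. X j v \<omega> = x j v} = measure M' {\<omega>\<in>space M'. \<forall>j\<in>{1..N}. \<forall>v. X' j v \<omega> = x j v}"
  shows "same_law M S M' S'"
proof -
  interpret M: prob_space M by fact
  interpret M': prob_space M' by fact
  have m: "(\<lambda>\<omega> n. S n \<omega>) \<in> measurable M (PiM UNIV (\<lambda>_. borel))"
    using walk_borel_measurable[OF X S] by (intro measurable_PiM_single') auto
  have m': "(\<lambda>\<omega> n. S' n \<omega>) \<in> measurable M' (PiM UNIV (\<lambda>_. borel))"
    using walk_borel_measurable[OF X' S'] by (intro measurable_PiM_single') auto
  have key: "measure M {\<omega>\<in>space M. \<forall>j\<in>J. S j \<omega> \<in> A j} = measure M' {\<omega>\<in>space M'. \<forall>j\<in>J. S' j \<omega> \<in> A j}"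
    if J: "finite J" and A: "\<And>j. j \<in> J \<Longrightarrow> A j \<in> sets borel" for J and A :: "nat \<Rightarrow> (real ^ 'v) set"
  proof -
    obtain N where N: "\<And>j. j \<in> J \<Longrightarrow> j \<le> N" using J by (meson finite_nat_set_iff_bounded_le)
    \<comment> \<open>A path is coded by the set of times and vertices with step 1. All values after
      time N are -1, which keeps the set finite and makes the path events of different members
      disjoint.\<close>
    define \<Xi> where "\<Xi> = (\<lambda>e j v. if (j, v) \<in> e then 1 else - 1 :: int) ` Pow ({1..N} \<times> (UNIV :: 'v set))"
    have fin: "finite \<Xi>" by (simp add: \<Xi>_def)
    have \<Xi>_pm: "x j v \<in> {- 1, 1}" if "x \<in> \<Xi>" for x j v using that by (auto simp: \<Xi>_def)
    define good where "good x \<longleftrightarrow> (\<forall>j\<in>J. (\<Sum>i=1..j. \<chi> v. real_of_int (x i v)) \<in> A j)" for x :: "nat \<Rightarrow> 'v \<Rightarrow> int"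
    \<comment> \<open>Stated for an arbitrary space, as it is applied to both walks.\<close>
    have decomp: "measure L {\<omega>\<in>space L. \<forall>j\<in>J. T j \<omega> \<in> A j} = (\<Sum>x\<in>{x\<in>\<Xi>. good x}. measure L {\<omega>\<in>space L. \<forall>j\<in>{1..N}. \<forall>v. W j v \<omega> = x j v})"
      if L: "prob_space L" and W: "\<And>j v. j \<ge> 1 \<Longrightarrow> W j v \<in> measurable L (count_space UNIV)"
       and T: "\<And>n \<omega>. \<omega> \<in> space L \<Longrightarrow> T n \<omega> = (\<Sum>j=1..n. \<chi> v. real_of_int (W j v \<omega>))"
       and pmW: "AE \<omega> in L. \<forall>j\<ge>1. \<forall>v. W j v \<omega> \<in> {- 1, 1 :: int}"
      for L :: "'c measure" and W T
    proof -
      interpret L: prob_space L by fact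
      have Wev[measurable]: "{\<omega>\<in>space L. \<forall>j\<in>{1..N}. \<forall>v. W j v \<omega> = x j v} \<in> sets L" for x
      proof -
        have "{\<omega>\<in>space L. W j v \<omega> = x j v} \<in> sets L" if "j \<in> {1..N}" for j v
          using measurable_sets[OF W[of j v], of "{x j v}"] that by (simp add: vimage_def Int_def conj_commute)
        then have "(\<Inter>j\<in>{1..N}. \<Inter>v. {\<omega>\<in>space L. W j v \<omega> = x j v}) \<inter> space L \<in> sets L"
          by (cases "N = 0") (auto intro!: sets.Int sets.finite_INT)
        moreover have "(\<Inter>j\<in>{1..N}. \<Inter>v. {\<omega>\<in>space L. W j v \<omega> = x j v}) \<inter> space L = {\<omega>\<in>space L. \<forall>j\<in>{1..N}. \<forall>v. W j v \<omega> = x j v}"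
          by auto
        ultimately show ?thesis by simp
      qed
      have Tm: "T n \<in> borel_measurable L" for n by (rule walk_borel_measurable[OF W T])
      have Tev: "{\<omega>\<in>space L. \<forall>j\<in>J. T j \<omega> \<in> A j} \<in> sets L"
      proof (rule sets.sets_Collect_finite_All[OF _ J])
        fix j assume "j \<in> J"
        from measurable_sets[OF Tm[of j] A[OF this]] show "{\<omega>\<in>space L. T j \<omega> \<in> A j} \<in> sets L"
          by (simp add: vimage_def Int_def conj_commute)
      qed
      have "measure L {\<omega>\<in>space L. \<forall>j\<in>J. T j \<omega> \<in> A j} = measure L (\<Union>x\<in>{x\<in>\<Xi>. good x}. {\<omega>\<in>space L. \<forall>j\<in>{1..N}. \<forall>v. W j v \<omega> = x j v})"
      proof (rule L.finite_measure_eq_AE)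
        show "AE \<omega> in L. \<omega> \<in> {\<omega>\<in>space L. \<forall>j\<in>J. T j \<omega> \<in> A j} \<longleftrightarrow> \<omega> \<in> (\<Union>x\<in>{x\<in>\<Xi>. good x}. {\<omega>\<in>space L. \<forall>j\<in>{1..N}. \<forall>v. W j v \<omega> = x j v})"
          using pmW AE_space
        proof eventually_elim
          case (elim \<omega>)
          have TA: "(\<forall>j\<in>J. T j \<omega> \<in> A j) \<longleftrightarrow> good x" if x: "\<And>j v. j \<in> {1..N} \<Longrightarrow> W j v \<omega> = x j v" for x
          proof -
            have "T j \<omega> = (\<Sum>i=1..j. \<chi> v. real_of_int (x i v))" if "j \<in> J" for j
              unfolding T[OF elim(2)] using N[OF that] x by (intro sum.cong refl) (simp add: vec_eq_iff)
            then show ?thesis by (simp add: good_def)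
          qed
          define x where "x = (\<lambda>j v. if (j, v) \<in> {(j, v). j \<in> {1..N} \<and> W j v \<omega> = 1} then 1 else - 1 :: int)"
          have x: "x \<in> \<Xi>" unfolding \<Xi>_def x_def by (rule imageI) auto
          have xW: "W j v \<omega> = x j v" if "j \<in> {1..N}" for j v
            using elim(1) that by (auto simp: x_def)
          show ?case
          proof
            assume "\<omega> \<in> {\<omega>\<in>space L. \<forall>j\<in>J. T j \<omega> \<in> A j}"
            then have "good x" using TA[OF xW] by simp
            then show "\<omega> \<in> (\<Union>x\<in>{x\<in>\<Xi>. good x}. {\<omega>\<in>space L. \<forall>j\<in>{1..N}. \<forall>v. W j v \<omega> = x j v})"
              using x xW elim(2) by (intro UN_I[of x]) auto
          next
            assume "\<omega> \<in> (\<Union>x\<in>{x\<in>\<Xi>. good x}. {\<omega>\<in>space L. \<forall>j\<in>{1..N}. \<forall>v. W j v \<omega> = x j v})"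
            then obtain x' where "good x'" "\<And>j v. j \<in> {1..N} \<Longrightarrow> W j v \<omega> = x' j v" by blast
            then show "\<omega> \<in> {\<omega>\<in>space L. \<forall>j\<in>J. T j \<omega> \<in> A j}" using TA[of x'] elim(2) by simp
          qed
        qed
        show "(\<Union>x\<in>{x\<in>\<Xi>. good x}. {\<omega>\<in>space L. \<forall>j\<in>{1..N}. \<forall>v. W j v \<omega> = x j v}) \<in> sets L"
          by (rule sets.finite_UN) (use fin Wev in \<open>auto simp del: One_nat_def\<close>)
      qed (rule Tev)
      also have "\<dots> = (\<Sum>x\<in>{x\<in>\<Xi>. good x}. measure L {\<omega>\<in>space L. \<forall>j\<in>{1..N}. \<forall>v. W j v \<omega> = x j v})"
      proof (rule L.finite_measure_finite_Union)
        show "disjoint_family_on (\<lambda>x. {\<omega>\<in>space L. \<forall>j\<in>{1..N}. \<forall>v. W j v \<omega> = x j v}) {x\<in>\<Xi>. good x}"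
          unfolding disjoint_family_on_def
        proof (intro ballI impI)
          fix x x' assume xx: "x \<in> {x\<in>\<Xi>. good x}" "x' \<in> {x\<in>\<Xi>. good x}" "x \<noteq> x'"
          then obtain e e' where e: "e \<subseteq> {1..N} \<times> UNIV" "e' \<subseteq> {1..N} \<times> UNIV"
            "x = (\<lambda>j v. if (j, v) \<in> e then 1 else - 1)" "x' = (\<lambda>j v. if (j, v) \<in> e' then 1 else - 1)"
            by (auto simp: \<Xi>_def)
          have "e \<noteq> e'" using e xx(3) by auto
          then obtain j v where jv: "(j, v) \<in> e \<longleftrightarrow> (j, v) \<notin> e'" by auto
          then have "j \<in> {1..N}" "x j v \<noteq> x' j v" using e by (auto split: if_splits)
          then show "{\<omega>\<in>space L. \<forall>j\<in>{1..N}. \<forall>v. W j v \<omega> = x j v} \<inter> {\<omega>\<in>space L. \<forall>j\<in>{1..N}. \<forall>v. W j v \<omega> = x' j v} = {}"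
            by fastforce
        qed
        show "(\<lambda>x. {\<omega>\<in>space L. \<forall>j\<in>{1..N}. \<forall>v. W j v \<omega> = x j v}) ` {x\<in>\<Xi>. good x} \<subseteq> sets L"
          using Wev by blast
      qed (use fin in auto)
      finally show ?thesis .
    qed
    show ?thesis
    proof -
      have "measure M {\<omega>\<in>space M. \<forall>j\<in>J. S j \<omega> \<in> A j} = (\<Sum>x\<in>{x\<in>\<Xi>. good x}. measure M {\<omega>\<in>space M. \<forall>j\<in>{1..N}. \<forall>v. X j v \<omega> = x j v})"
        by (rule decomp[OF M(1) X S pm])
      also have "\<dots> = (\<Sum>x\<in>{x\<in>\<Xi>. good x}. measure M' {\<omega>\<in>space M'. \<forall>j\<in>{1..N}. \<forall>v. X' j v \<omega> = x j v})"
        by (rule sum.cong[OF refl], rule path, rule \<Xi>_pm) auto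
      also have "\<dots> = measure M' {\<omega>\<in>space M'. \<forall>j\<in>J. S' j \<omega> \<in> A j}"
        by (rule decomp[OF M(2) X' S' pm', symmetric])
      finally show ?thesis .
    qed
  qed
  show ?thesis unfolding same_law_def
  proof (rule measure_eqI_PiM_infinite[where I = UNIV and M = "\<lambda>_. borel"])
    show "finite_measure (distr M (PiM UNIV (\<lambda>_. borel)) (\<lambda>\<omega> n. S n \<omega>))"
      using m by (intro prob_space.finite_measure M.prob_space_distr)
    fix A :: "nat \<Rightarrow> (real ^ 'v) set" and J assume J: "finite J" "J \<subseteq> UNIV" and A: "\<And>j. j \<in> J \<Longrightarrow> A j \<in> sets borel"
    have E: "prod_emb UNIV (\<lambda>_. borel) J (Pi\<^sub>E J A) \<in> sets (PiM UNIV (\<lambda>_. borel))"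
      using J A by (intro sets_PiM_I) auto
    have 1: "(\<lambda>\<omega> n. S n \<omega>) -` prod_emb UNIV (\<lambda>_. borel) J (Pi\<^sub>E J A) \<inter> space M = {\<omega>\<in>space M. \<forall>j\<in>J. S j \<omega> \<in> A j}"
      by (auto simp: prod_emb_def PiE_iff space_PiM)
    have 2: "(\<lambda>\<omega> n. S' n \<omega>) -` prod_emb UNIV (\<lambda>_. borel) J (Pi\<^sub>E J A) \<inter> space M' = {\<omega>\<in>space M'. \<forall>j\<in>J. S' j \<omega> \<in> A j}"
      by (auto simp: prod_emb_def PiE_iff space_PiM)
    show "emeasure (distr M (PiM UNIV (\<lambda>_. borel)) (\<lambda>\<omega> n. S n \<omega>)) (prod_emb UNIV (\<lambda>_. borel) J (Pi\<^sub>E J A))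
       = emeasure (distr M' (PiM UNIV (\<lambda>_. borel)) (\<lambda>\<omega> n. S' n \<omega>)) (prod_emb UNIV (\<lambda>_. borel) J (Pi\<^sub>E J A))"
      using key[OF J(1) A] by (simp add: emeasure_distr[OF m E] emeasure_distr[OF m' E] 1 2 M.emeasure_eq_measure M'.emeasure_eq_measure)
  qed simp_all
qed

text \<open>This replaces the random past inside F by the fixed path x. On the right only the
  innovations are random, so the events for different times and vertices are independent and path
  probabilities factor without conditioning. The two inclusions need that F looks at strictly
  earlier times.\<close>

lemma path_iff:
  fixes X :: "nat \<Rightarrow> 'v \<Rightarrow> int"
  assumes X: "\<And>n v. n \<ge> 1 \<Longrightarrow> X n v = F n v X"
    and F: "\<And>n v x x'. n \<ge> 1 \<Longrightarrow> (\<And>j v. 1 \<le> j \<Longrightarrow> j < n \<Longrightarrow> x j v = x' j v) \<Longrightarrow> F n v x = F n v x'"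
  shows "(\<forall>n\<in>{1..N}. \<forall>v. X n v = x n v) \<longleftrightarrow> (\<forall>n\<in>{1..N}. \<forall>v. F n v x = x n v)"
proof
  assume L: "\<forall>n\<in>{1..N}. \<forall>v. X n v = x n v"
  show "\<forall>n\<in>{1..N}. \<forall>v. F n v x = x n v"
  proof (intro ballI allI)
    fix n v assume n: "n \<in> {1..N}"
    have "F n v x = F n v X" using L n by (intro F) auto
    then show "F n v x = x n v" using X[of n v] L n by simp
  qed
next
  assume R: "\<forall>n\<in>{1..N}. \<forall>v. F n v x = x n v"
  have "n \<in> {1..N} \<longrightarrow> (\<forall>v. X n v = x n v)" for n
  proof (induction n rule: less_induct)
    case (less n)
    show ?case
    proof (intro impI allI)
      fix v assume n: "n \<in> {1..N}"
      have "F n v X = F n v x" using less n by (intro F) auto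
      then show "X n v = x n v" using X[of n v] R n by simp
    qed
  qed
  then show "\<forall>n\<in>{1..N}. \<forall>v. X n v = x n v" by blast
qed

lemma (in prob_space) path_prob_indep:
  fixes F :: "nat \<Rightarrow> 'v::finite \<Rightarrow> 'a \<Rightarrow> int"
  assumes ind: "indep_vars (\<lambda>_. count_space UNIV) (\<lambda>(n, v). F n v) ({1..} \<times> UNIV)"
  shows "prob {\<omega>\<in>space M. \<forall>n\<in>{1..N}. \<forall>v. F n v \<omega> = x n v} = (\<Prod>n=1..N. \<Prod>v\<in>UNIV. prob {\<omega>\<in>space M. F n v \<omega> = x n v})"
proof (cases "N = 0")
  case False
  let ?I = "{1..N} \<times> (UNIV :: 'v set)"
  have "prob (\<Inter>i\<in>?I. (case i of (n, v) \<Rightarrow> F n v) -` {x (fst i) (snd i)} \<inter> space M)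
      = (\<Prod>i\<in>?I. prob ((case i of (n, v) \<Rightarrow> F n v) -` {x (fst i) (snd i)} \<inter> space M))"
    by (rule indep_varsD[OF ind]) (use False in auto)
  moreover have "(\<Inter>i\<in>?I. (case i of (n, v) \<Rightarrow> F n v) -` {x (fst i) (snd i)} \<inter> space M) = {\<omega>\<in>space M. \<forall>n\<in>{1..N}. \<forall>v. F n v \<omega> = x n v}"
    using False by fastforce
  moreover have "(case i of (n, v) \<Rightarrow> F n v) -` {x (fst i) (snd i)} \<inter> space M = {\<omega>\<in>space M. F (fst i) (snd i) \<omega> = x (fst i) (snd i)}" for i
    by (auto split: prod.splits)
  ultimately show ?thesis by (simp add: prod.cartesian_product split_beta)
qed (simp add: prob_space)

section \<open>Transition probabilities\<close>

definition drift :: "real ^ 'v ^ 'v \<Rightarrow> nat \<Rightarrow> 'v \<Rightarrow> real ^ 'v::finite \<Rightarrow> real" where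
  "drift B n v s = (s v* B) $ v / real n"

definition path_sum :: "(nat \<Rightarrow> 'v \<Rightarrow> int) \<Rightarrow> nat \<Rightarrow> real ^ 'v::finite" where
  "path_sum x n = (\<Sum>j=1..n. \<chi> v. real_of_int (x j v))"

text \<open>The conditional probability that coordinate v of step n follows x, given that the walk
  has followed x so far: a sign with mean a takes the value s with probability (1 + s a) / 2, and
  \<open>drift\<close> is this mean.\<close>

definition trans_prob :: "real ^ 'v ^ 'v \<Rightarrow> ('v \<Rightarrow> real) \<Rightarrow> nat \<Rightarrow> 'v \<Rightarrow> (nat \<Rightarrow> 'v::finite \<Rightarrow> int) \<Rightarrow> real" where
  "trans_prob B q n v x = (if n = 1 then (if x 1 v = 1 then q v else 1 - q v)
     else (1 + real_of_int (x n v) * drift B (n - 1) v (path_sum x (n - 1))) / 2)"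

lemma memory_drift:
  "drift (memory_matrix E p) n v s
    = (2 * p v - 1) / real (card (in_nbrs E v)) * (\<Sum>i\<in>in_nbrs E v. s $ i) / real n"
proof -
  have "(s v* memory_matrix E p) $ v = (\<Sum>i\<in>UNIV. if i \<in> in_nbrs E v then (2 * p v - 1) / real (card (in_nbrs E v)) * s $ i else 0)"
    by (auto simp: vector_matrix_mult_def memory_matrix_def in_nbrs_def intro!: sum.cong)
  also have "\<dots> = (2 * p v - 1) / real (card (in_nbrs E v)) * (\<Sum>i\<in>in_nbrs E v. s $ i)"
    by (subst sum.inter_filter[symmetric]) (auto simp: sum_distrib_left)
  finally show ?thesis by (simp add: drift_def)
qed

lemma rad_pmf_prob:
  assumes "0 \<le> p" "p \<le> 1" "s \<in> {- 1, 1}"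
  shows "measure (measure_pmf (rad_pmf p)) {s} = (1 + real_of_int s * (2 * p - 1)) / 2"
proof -
  have "(\<lambda>b. if b then 1 else - 1 :: int) -` {s} = {s = 1}" using assms(3) by (auto split: if_splits)
  then have "measure (measure_pmf (rad_pmf p)) {s} = pmf (bernoulli_pmf p) (s = 1)"
    unfolding rad_pmf_def measure_map_pmf by (simp add: measure_pmf_single)
  then show ?thesis using assms by (cases "s = 1") (auto simp: field_simps)
qed

lemma measurable_compose3_countable:
  fixes a b c :: "'x \<Rightarrow> 'k::countable"
  assumes "a \<in> measurable N (count_space UNIV)" "b \<in> measurable N (count_space UNIV)" "c \<in> measurable N (count_space UNIV)"
  shows "(\<lambda>f. G (a f) (b f) (c f)) \<in> measurable N (count_space UNIV)"
proof -
  have 1: "(\<lambda>f. G i j (c f)) \<in> measurable N (count_space UNIV)" for i j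
    using measurable_compose[OF assms(3), of "G i j" "count_space UNIV"] by simp
  have 2: "(\<lambda>f. G i (b f) (c f)) \<in> measurable N (count_space UNIV)" for i
    by (rule measurable_compose_countable[where f = "\<lambda>j f. G i j (c f)" and g = b, OF 1 assms(2)])
  show ?thesis
    by (rule measurable_compose_countable[where f = "\<lambda>i f. G i (b f) (c f)" and g = a, OF 2 assms(1)])
qed

section \<open>Path probabilities of the original walk\<close>

context
  fixes M :: "'a measure" and E :: "('v::finite \<times> 'v) set" and p q :: "'v \<Rightarrow> real" and \<sigma> \<xi> D u
  assumes M: "prob_space M" and innov: "erwg_innovations M E p q \<sigma> \<xi> D u"
    and in_degree: "\<And>v. card (in_nbrs E v) \<ge> 1" and p: "\<And>v. p v \<in> {0..1}" and q: "\<And>v. q v \<in> {0..1}"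
begin

interpretation prob_space M by (rule M)

abbreviation "fam \<equiv> innov_family \<sigma> \<xi> D u"

lemma fam_indep: "indep_vars (\<lambda>_. count_space UNIV) fam innov_indices"
  using innov by (simp add: erwg_innovations_def)

lemma fam_measurable: "i \<in> innov_indices \<Longrightarrow> fam i \<in> measurable M (count_space UNIV)"
  using fam_indep unfolding indep_vars_def2 by blast

lemma \<sigma>_measurable: "\<sigma> v \<in> measurable M (count_space UNIV)"
  using measurable_compose[OF fam_measurable[of "Start v"], of projl "count_space UNIV"]
  by (simp add: innov_indices_def innov_family_def)

lemma innov_measurable:
  assumes n: "n \<ge> 1"
  shows "\<xi> n v \<in> measurable M (count_space UNIV)" "D n v \<in> measurable M (count_space UNIV)" "u n v \<in> measurable M (count_space UNIV)"
proof -
  have i: "Flip n v \<in> innov_indices" "Memory n v \<in> innov_indices" "Nbr n v \<in> innov_indices"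
    using n by (simp_all add: innov_indices_def)
  show "\<xi> n v \<in> measurable M (count_space UNIV)"
    using measurable_compose[OF fam_measurable[OF i(1)], of projl "count_space UNIV"] by (simp add: innov_family_def)
  show "D n v \<in> measurable M (count_space UNIV)"
    using measurable_compose[OF fam_measurable[OF i(2)], of "\<lambda>x. projl (projr x)" "count_space UNIV"] by (simp add: innov_family_def)
  show "u n v \<in> measurable M (count_space UNIV)"
    using measurable_compose[OF fam_measurable[OF i(3)], of "\<lambda>x. projr (projr x)" "count_space UNIV"] by (simp add: innov_family_def)
qed

lemma distr_innov:
  shows "distr M (count_space UNIV) (\<sigma> v) = measure_pmf (rad_pmf (q v))"
    and "n \<ge> 1 \<Longrightarrow> distr M (count_space UNIV) (\<xi> n v) = measure_pmf (rad_pmf (p v))"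
    and "n \<ge> 1 \<Longrightarrow> distr M (count_space UNIV) (D n v) = measure_pmf (pmf_of_set {1..n})"
    and "n \<ge> 1 \<Longrightarrow> distr M (count_space UNIV) (u n v) = measure_pmf (pmf_of_set (in_nbrs E v))"
proof -
  note i = innov[unfolded erwg_innovations_def]
  show "distr M (count_space UNIV) (\<sigma> v) = measure_pmf (rad_pmf (q v))"
    by (rule i[THEN conjunct2, THEN conjunct1, rule_format])
  assume n: "n \<ge> 1"
  note d = i[THEN conjunct2, THEN conjunct2, rule_format, OF n, of v]
  show "distr M (count_space UNIV) (\<xi> n v) = measure_pmf (rad_pmf (p v))"
    by (rule d[THEN conjunct1])
  show "distr M (count_space UNIV) (D n v) = measure_pmf (pmf_of_set {1..n})"
    by (rule d[THEN conjunct2, THEN conjunct1])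
  show "distr M (count_space UNIV) (u n v) = measure_pmf (pmf_of_set (in_nbrs E v))"
    by (rule d[THEN conjunct2, THEN conjunct2])
qed

lemma prob_distr_pmf:
  assumes "Y \<in> measurable M (count_space UNIV)" "distr M (count_space UNIV) Y = measure_pmf P"
  shows "prob {\<omega>\<in>space M. Y \<omega> \<in> A} = measure (measure_pmf P) A"
  using measure_distr[OF assms(1), of A] unfolding assms(2) by (simp add: vimage_def Int_def conj_commute)

lemma \<sigma>_prob: "s \<in> {- 1, 1} \<Longrightarrow> prob {\<omega>\<in>space M. \<sigma> v \<omega> = s} = (1 + real_of_int s * (2 * q v - 1)) / 2"
  using prob_distr_pmf[OF \<sigma>_measurable distr_innov(1), of v "{s}"] q[of v] rad_pmf_prob[of "q v" s]
  by simp

lemma \<xi>_prob: "n \<ge> 1 \<Longrightarrow> s \<in> {- 1, 1} \<Longrightarrow> prob {\<omega>\<in>space M. \<xi> n v \<omega> = s} = (1 + real_of_int s * (2 * p v - 1)) / 2"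
  using prob_distr_pmf[OF innov_measurable(1) distr_innov(2), of n v "{s}"] p[of v] rad_pmf_prob[of "p v" s]
  by simp

lemma D_prob: "n \<ge> 1 \<Longrightarrow> d \<in> {1..n} \<Longrightarrow> prob {\<omega>\<in>space M. D n v \<omega> = d} = 1 / real n"
  using prob_distr_pmf[OF innov_measurable(2) distr_innov(3), of n v "{d}"]
  by (simp add: measure_pmf_single)

lemma nbrs_nonempty: "in_nbrs E v \<noteq> {}"
  using in_degree[of v] by auto

lemma u_prob: "n \<ge> 1 \<Longrightarrow> i \<in> in_nbrs E v \<Longrightarrow> prob {\<omega>\<in>space M. u n v \<omega> = i} = 1 / real (card (in_nbrs E v))"
  using prob_distr_pmf[OF innov_measurable(3) distr_innov(4), of n v "{i}"] nbrs_nonempty[of v]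
  by (simp add: measure_pmf_single pmf_of_set)

lemma AE_distr_pmf:
  assumes "Y \<in> measurable M (count_space UNIV)" "distr M (count_space UNIV) Y = measure_pmf P"
  shows "AE \<omega> in M. Y \<omega> \<in> set_pmf P"
  using AE_measure_pmf[of P] unfolding assms(2)[symmetric] by (rule AE_distrD[OF assms(1)])

lemma set_rad_pmf: "set_pmf (rad_pmf r) \<subseteq> {- 1, 1}"
  by (auto simp: rad_pmf_def)

lemma \<sigma>_AE: "AE \<omega> in M. \<sigma> v \<omega> \<in> {- 1, 1}"
  using AE_distr_pmf[OF \<sigma>_measurable distr_innov(1)] by eventually_elim (use set_rad_pmf[of "q v"] in blast)

lemma innov_AE:
  assumes n: "n \<ge> 1"
  shows "AE \<omega> in M. \<xi> n v \<omega> \<in> {- 1, 1} \<and> D n v \<omega> \<in> {1..n} \<and> u n v \<omega> \<in> in_nbrs E v"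
proof -
  have 1: "AE \<omega> in M. \<xi> n v \<omega> \<in> set_pmf (rad_pmf (p v))"
    by (rule AE_distr_pmf[OF innov_measurable(1)[OF n] distr_innov(2)[OF n]])
  have 2: "AE \<omega> in M. D n v \<omega> \<in> set_pmf (pmf_of_set {1..n})"
    by (rule AE_distr_pmf[OF innov_measurable(2)[OF n] distr_innov(3)[OF n]])
  have 3: "AE \<omega> in M. u n v \<omega> \<in> set_pmf (pmf_of_set (in_nbrs E v))"
    by (rule AE_distr_pmf[OF innov_measurable(3)[OF n] distr_innov(4)[OF n]])
  have s: "set_pmf (pmf_of_set {1..n}) = {1..n}" "set_pmf (pmf_of_set (in_nbrs E v)) = in_nbrs E v"
    using n nbrs_nonempty[of v] by (auto intro!: set_pmf_of_set)
  show ?thesis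
    using 1 2 3 unfolding s by eventually_elim (use set_rad_pmf[of "p v"] in blast)
qed

text \<open>The value \<open>0\<close> only occurs on the null event where \<open>D (n - 1) v\<close> leaves \<open>{1..n - 1}\<close>.\<close>

definition orig_step :: "nat \<Rightarrow> 'v \<Rightarrow> (nat \<Rightarrow> 'v \<Rightarrow> int) \<Rightarrow> 'a \<Rightarrow> int" where
  "orig_step n v x \<omega> = (if n = 1 then \<sigma> v \<omega>
     else if D (n - 1) v \<omega> \<in> {1..n - 1} then \<xi> (n - 1) v \<omega> * x (D (n - 1) v \<omega>) (u (n - 1) v \<omega>) else 0)"

definition step_set :: "nat \<times> 'v \<Rightarrow> 'v innov_index set" where
  "step_set nv = (case nv of (n, v) \<Rightarrow> if n = 1 then {Start v} else {Flip (n - 1) v, Memory (n - 1) v, Nbr (n - 1) v})"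

definition step_fun :: "(nat \<Rightarrow> 'v \<Rightarrow> int) \<Rightarrow> nat \<times> 'v \<Rightarrow> ('v innov_index \<Rightarrow> int + nat + 'v) \<Rightarrow> int" where
  "step_fun x nv f = (case nv of (n, v) \<Rightarrow> if n = 1 then projl (f (Start v))
     else if projl (projr (f (Memory (n - 1) v))) \<in> {1..n - 1}
       then projl (f (Flip (n - 1) v)) * x (projl (projr (f (Memory (n - 1) v)))) (projr (projr (f (Nbr (n - 1) v)))) else 0)"

text \<open>With the path x fixed, the step of vertex v at time n involves only its own innovations,
  and these groups are disjoint.\<close>

lemma orig_step_indep:
  "indep_vars (\<lambda>_. count_space UNIV) (\<lambda>(n, v). orig_step n v x) ({1..} \<times> UNIV)"
proof -
  have "indep_vars (\<lambda>nv. PiM (step_set nv) (\<lambda>_. count_space UNIV)) (\<lambda>nv \<omega>. \<lambda>i\<in>step_set nv. fam i \<omega>) ({1..} \<times> UNIV)"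
    by (rule indep_vars_restrict[OF fam_indep])
      (auto simp: step_set_def innov_indices_def disjoint_family_on_def split: if_splits)
  then have "indep_vars (\<lambda>_. count_space UNIV) (\<lambda>nv \<omega>. step_fun x nv (\<lambda>i\<in>step_set nv. fam i \<omega>)) ({1..} \<times> UNIV)"
  proof (rule indep_vars_compose2)
    fix nv :: "nat \<times> 'v" assume "nv \<in> {1..} \<times> UNIV"
    obtain n v where nv: "nv = (n, v)" by (cases nv)
    have c: "(\<lambda>f. f i :: int + nat + 'v) \<in> measurable (PiM (step_set nv) (\<lambda>_. count_space UNIV)) (count_space UNIV)" if "i \<in> step_set nv"
      for i using measurable_component_singleton[OF that, of "\<lambda>_. count_space UNIV"] by simp
    show "step_fun x nv \<in> measurable (PiM (step_set nv) (\<lambda>_. count_space UNIV)) (count_space UNIV)"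
    proof (cases "n = 1")
      case True
      then have "step_fun x nv = (\<lambda>f. projl (f (Start v)))" by (simp add: step_fun_def nv fun_eq_iff)
      then show ?thesis
        using measurable_compose[OF c[of "Start v"], of projl "count_space UNIV"] by (simp add: step_set_def nv True)
    next
      case False
      define G where "G a b c = (if projl (projr b) \<in> {1..n - 1}
        then projl a * x (projl (projr b)) (projr (projr c)) else 0)" for a b c :: "int + nat + 'v"
      have "step_fun x nv = (\<lambda>f. G (f (Flip (n - 1) v)) (f (Memory (n - 1) v)) (f (Nbr (n - 1) v)))"
        using False by (simp add: step_fun_def nv fun_eq_iff G_def)
      moreover have "(\<lambda>f. G (f (Flip (n - 1) v)) (f (Memory (n - 1) v)) (f (Nbr (n - 1) v)))
          \<in> measurable (PiM (step_set nv) (\<lambda>_. count_space UNIV)) (count_space UNIV)"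
        by (rule measurable_compose3_countable[OF c[of "Flip (n - 1) v"] c[of "Memory (n - 1) v"] c[of "Nbr (n - 1) v"]]) (use False in \<open>auto simp: step_set_def nv\<close>)
      ultimately show ?thesis by simp
    qed
  qed
  moreover have "step_fun x (n, v) (\<lambda>i\<in>step_set (n, v). fam i \<omega>) = orig_step n v x \<omega>" for n v \<omega>
    by (cases "n = 1") (simp_all add: step_fun_def step_set_def orig_step_def innov_family_def)
  then have "(\<lambda>nv \<omega>. step_fun x nv (\<lambda>i\<in>step_set nv. fam i \<omega>)) = (\<lambda>(n, v). orig_step n v x)"
    by (auto simp: fun_eq_iff)
  ultimately show ?thesis by simp
qed

text \<open>After a decomposition by the remembered time d and the neighbour i, the flip has to
  equal the product of the signs \<open>x n v\<close> and \<open>x d i\<close>. Summation over the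
  uniform d turns the remembered signs into \<open>path_sum\<close>, and the average over neighbours
  gives the memory matrix.\<close>

lemma orig_step_prob:
  assumes n: "n \<ge> 1" and x: "\<And>j v. x j v \<in> {- 1, 1}"
  shows "prob {\<omega>\<in>space M. orig_step n v x \<omega> = x n v} = trans_prob (memory_matrix E p) q n v x"
proof (cases "n = 1")
  case True
  then show ?thesis using \<sigma>_prob[of "x 1 v" v] x[of 1 v] by (auto simp: orig_step_def trans_prob_def field_simps)
next
  case False
  define m where "m = n - 1"
  have m: "m \<ge> 1" "n = Suc m" using n False by (auto simp: m_def)
  let ?N = "in_nbrs E v"
  let ?G = "\<lambda>(d, i). {\<omega>\<in>space M. \<xi> m v \<omega> = x n v * x d i \<and> D m v \<omega> = d \<and> u m v \<omega> = i}"
  have G: "prob (?G (d, i)) = (1 + real_of_int (x n v * x d i) * (2 * p v - 1)) / 2 * (1 / real m) * (1 / real (card ?N))"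
    if "d \<in> {1..m}" "i \<in> ?N" for d i
  proof -
    define A where "A k = (case k of Flip a b \<Rightarrow> {Inl (x n v * x d i) :: int + nat + 'v} | Memory a b \<Rightarrow> {Inr (Inl d)} | Nbr a b \<Rightarrow> {Inr (Inr i)} | Start a \<Rightarrow> {})" for k :: "'v innov_index"
    have "prob (\<Inter>k\<in>{Flip m v, Memory m v, Nbr m v}. fam k -` A k \<inter> space M)
      = (\<Prod>k\<in>{Flip m v, Memory m v, Nbr m v}. prob (fam k -` A k \<inter> space M))"
      by (rule indep_varsD[OF fam_indep]) (use m in \<open>auto simp: innov_indices_def\<close>)
    moreover have "(\<Inter>k\<in>{Flip m v, Memory m v, Nbr m v}. fam k -` A k \<inter> space M) = ?G (d, i)"
      by (auto simp: A_def innov_family_def)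
    moreover have "fam (Flip m v) -` A (Flip m v) \<inter> space M = {\<omega>\<in>space M. \<xi> m v \<omega> = x n v * x d i}"
      "fam (Memory m v) -` A (Memory m v) \<inter> space M = {\<omega>\<in>space M. D m v \<omega> = d}"
      "fam (Nbr m v) -` A (Nbr m v) \<inter> space M = {\<omega>\<in>space M. u m v \<omega> = i}"
      by (auto simp: A_def innov_family_def)
    moreover have "x n v * x d i \<in> {- 1, 1}" using x[of n v] x[of d i] by auto
    note \<xi>_prob[OF m(1) this, of v]
    ultimately show ?thesis using D_prob[OF m(1) that(1)] u_prob[OF m(1) that(2)] by simp
  qed
  have [measurable]: "\<xi> m v \<in> measurable M (count_space UNIV)" "D m v \<in> measurable M (count_space UNIV)" "u m v \<in> measurable M (count_space UNIV)"
    using innov_measurable[OF m(1)] by auto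
  have Gev: "?G di \<in> events" for di by (cases di) (simp, measurable)
  have "prob {\<omega>\<in>space M. orig_step n v x \<omega> = x n v} = prob (\<Union>di\<in>{1..m} \<times> ?N. ?G di)"
  proof (rule finite_measure_eq_AE)
    show "AE \<omega> in M. \<omega> \<in> {\<omega>\<in>space M. orig_step n v x \<omega> = x n v} \<longleftrightarrow> \<omega> \<in> (\<Union>di\<in>{1..m} \<times> ?N. ?G di)"
      using innov_AE[OF m(1), of v]
    proof eventually_elim
      case (elim \<omega>)
      have "a * b = c \<longleftrightarrow> a = c * b" if "b \<in> {- 1, 1}" for a b c :: int using that by auto
      then have "orig_step n v x \<omega> = x n v \<longleftrightarrow> \<xi> m v \<omega> = x n v * x (D m v \<omega>) (u m v \<omega>)"
        using elim x[of "D m v \<omega>" "u m v \<omega>"] m by (simp add: orig_step_def)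
      then show ?case using elim by auto
    qed
    have "orig_step n v x \<in> measurable M (count_space UNIV)"
      using orig_step_indep[of x] n unfolding indep_vars_def2 by auto
    from measurable_sets[OF this, of "{x n v}"] show "{\<omega>\<in>space M. orig_step n v x \<omega> = x n v} \<in> events"
      by (simp add: vimage_def Int_def conj_commute)
    show "(\<Union>di\<in>{1..m} \<times> ?N. ?G di) \<in> events" using Gev by (intro sets.finite_UN) auto
  qed
  also have "\<dots> = (\<Sum>di\<in>{1..m} \<times> ?N. prob (?G di))"
    by (rule finite_measure_finite_Union) (use Gev in \<open>auto simp: disjoint_family_on_def\<close>)
  also have "\<dots> = (\<Sum>di\<in>{1..m} \<times> ?N. (1 + real_of_int (x n v * x (fst di) (snd di)) * (2 * p v - 1)) / 2 * (1 / real m) * (1 / real (card ?N)))"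
    by (intro sum.cong refl) (use G in auto)
  also have "\<dots> = (\<Sum>d\<in>{1..m}. \<Sum>i\<in>?N. (1 + real_of_int (x n v * x d i) * (2 * p v - 1)) / (2 * real m * real (card ?N)))"
    by (simp add: sum.cartesian_product split_beta)
  also have "\<dots> = (real m * real (card ?N) + real_of_int (x n v) * (2 * p v - 1) * (\<Sum>d\<in>{1..m}. \<Sum>i\<in>?N. real_of_int (x d i))) / (2 * real m * real (card ?N))"
    by (simp add: sum_divide_distrib[symmetric] sum.distrib sum_distrib_left mult_ac)
  also have "(\<Sum>d\<in>{1..m}. \<Sum>i\<in>?N. real_of_int (x d i)) = (\<Sum>i\<in>?N. path_sum x m $ i)"
    by (subst sum.swap) (simp add: path_sum_def)
  also have "(real m * real (card ?N) + real_of_int (x n v) * (2 * p v - 1) * (\<Sum>i\<in>?N. path_sum x m $ i)) / (2 * real m * real (card ?N))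
     = trans_prob (memory_matrix E p) q n v x"
  proof -
    have arith: "(a * c + y * w * s) / (2 * a * c) = (1 + y * (w / c * s / a)) / 2" if "a > 0" "c > 0" for a c y w s :: real
      using that by (simp add: field_simps)
    have "n \<noteq> 1" "n - 1 = m" using m by auto
    then show ?thesis unfolding trans_prob_def memory_drift
      using m in_degree[of v] by (subst arith) auto
  qed
  finally show ?thesis .
qed

lemma orig_path_prob:
  assumes X1: "AE \<omega> in M. \<forall>v. X 1 v \<omega> = \<sigma> v \<omega>"
    and X: "AE \<omega> in M. \<forall>n\<ge>1. \<forall>v. X (n + 1) v \<omega> = \<xi> n v \<omega> * X (D n v \<omega>) (u n v \<omega>) \<omega>"
    and Xm: "\<And>n v. n \<ge> 1 \<Longrightarrow> X n v \<in> measurable M (count_space UNIV)"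
    and x: "\<And>j v. x j v \<in> {- 1, 1}"
  shows "prob {\<omega>\<in>space M. \<forall>n\<in>{1..N}. \<forall>v. X n v \<omega> = x n v} = (\<Prod>n=1..N. \<Prod>v\<in>UNIV. trans_prob (memory_matrix E p) q n v x)"
    and "AE \<omega> in M. \<forall>n\<ge>1. \<forall>v. X n v \<omega> \<in> {- 1, 1}"
proof -
  have AE: "AE \<omega> in M. \<forall>n\<ge>1. \<forall>v. \<xi> n v \<omega> \<in> {- 1, 1} \<and> D n v \<omega> \<in> {1..n} \<and> u n v \<omega> \<in> in_nbrs E v"
    using innov_AE by (simp add: AE_all_countable)
  have AE\<sigma>: "AE \<omega> in M. \<forall>v. \<sigma> v \<omega> \<in> {- 1, 1}" using \<sigma>_AE by (simp add: AE_all_countable)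
  have step: "AE \<omega> in M. \<forall>n\<ge>1. \<forall>v. X n v \<omega> = orig_step n v (\<lambda>j v. X j v \<omega>) \<omega>"
    using X1 X AE
  proof eventually_elim
    case (elim \<omega>)
    show ?case
    proof (intro allI impI)
      fix n v assume n: "n \<ge> (1::nat)"
      show "X n v \<omega> = orig_step n v (\<lambda>j v. X j v \<omega>) \<omega>"
      proof (cases "n = 1")
        case False
        then obtain m where m: "n = Suc m" "m \<ge> 1" using n by (cases n) auto
        then show ?thesis using elim(2,3) by (simp add: orig_step_def)
      next
        case True
        show ?thesis unfolding True orig_step_def using elim(1) by simp
      qed
    qed
  qed
  have ev: "{\<omega>\<in>space M. \<forall>n\<in>{1..N}. \<forall>v. Y n v \<omega> = x n v} \<in> events"
    if "\<And>n v. n \<ge> 1 \<Longrightarrow> Y n v \<in> measurable M (count_space UNIV)" for Y :: "nat \<Rightarrow> 'v \<Rightarrow> 'a \<Rightarrow> int"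
  proof (rule sets.sets_Collect_finite_All)
    fix n assume n: "n \<in> {1..N}"
    have "{\<omega>\<in>space M. \<forall>v\<in>UNIV. Y n v \<omega> = x n v} \<in> events"
    proof (rule sets.sets_Collect_finite_All)
      show "{\<omega>\<in>space M. Y n v \<omega> = x n v} \<in> events" for v
      proof -
        have "n \<ge> 1" using n by simp
        from measurable_sets[OF that[OF this, of v], of "{x n v}"] show ?thesis
          by (simp add: vimage_def Int_def conj_commute)
      qed
    qed simp
    then show "{\<omega>\<in>space M. \<forall>v. Y n v \<omega> = x n v} \<in> events" by simp
  qed simp
  have sm: "orig_step n v x \<in> measurable M (count_space UNIV)" if "n \<ge> 1" for n v
    using orig_step_indep[of x] that unfolding indep_vars_def2 by auto
  have "prob {\<omega>\<in>space M. \<forall>n\<in>{1..N}. \<forall>v. X n v \<omega> = x n v} = prob {\<omega>\<in>space M. \<forall>n\<in>{1..N}. \<forall>v. orig_step n v x \<omega> = x n v}"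
  proof (rule finite_measure_eq_AE)
    show "AE \<omega> in M. \<omega> \<in> {\<omega>\<in>space M. \<forall>n\<in>{1..N}. \<forall>v. X n v \<omega> = x n v} \<longleftrightarrow>
        \<omega> \<in> {\<omega>\<in>space M. \<forall>n\<in>{1..N}. \<forall>v. orig_step n v x \<omega> = x n v}"
      using step
    proof eventually_elim
      case (elim \<omega>)
      have "(\<forall>n\<in>{1..N}. \<forall>v. X n v \<omega> = x n v) \<longleftrightarrow> (\<forall>n\<in>{1..N}. \<forall>v. orig_step n v x \<omega> = x n v)"
        by (rule path_iff[where F = "\<lambda>n v x. orig_step n v x \<omega>"]) (use elim in \<open>auto simp: orig_step_def\<close>)
      then show ?case by simp
    qed
    show "{\<omega>\<in>space M. \<forall>n\<in>{1..N}. \<forall>v. X n v \<omega> = x n v} \<in> events" by (rule ev) (rule Xm)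
    show "{\<omega>\<in>space M. \<forall>n\<in>{1..N}. \<forall>v. orig_step n v x \<omega> = x n v} \<in> events" by (rule ev) (rule sm)
  qed
  also have "\<dots> = (\<Prod>n=1..N. \<Prod>v\<in>UNIV. prob {\<omega>\<in>space M. orig_step n v x \<omega> = x n v})"
    by (rule path_prob_indep[OF orig_step_indep])
  also have "\<dots> = (\<Prod>n=1..N. \<Prod>v\<in>UNIV. trans_prob (memory_matrix E p) q n v x)"
    by (intro prod.cong refl orig_step_prob) (use x in auto)
  finally show "prob {\<omega>\<in>space M. \<forall>n\<in>{1..N}. \<forall>v. X n v \<omega> = x n v} = (\<Prod>n=1..N. \<Prod>v\<in>UNIV. trans_prob (memory_matrix E p) q n v x)" .
  show "AE \<omega> in M. \<forall>n\<ge>1. \<forall>v. X n v \<omega> \<in> {- 1, 1}"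
    using X1 X AE AE\<sigma>
  proof eventually_elim
    case (elim \<omega>)
    have "n \<ge> 1 \<longrightarrow> (\<forall>v. X n v \<omega> \<in> {- 1, 1})" for n
    proof (induction n rule: less_induct)
      case (less n)
      show ?case
      proof (intro impI allI)
        fix v assume n: "n \<ge> 1"
        show "X n v \<omega> \<in> {- 1, 1}"
        proof (cases "n = 1")
          case False
          then obtain m where m: "n = Suc m" "m \<ge> 1" using n by (cases n) auto
          have D: "D m v \<omega> \<in> {1..m}" using elim(3) m by blast
          have 1: "X (D m v \<omega>) (u m v \<omega>) \<omega> \<in> {- 1, 1}"
            by (rule less[rule_format]) (use D m in simp_all)
          have 2: "\<xi> m v \<omega> \<in> {- 1, 1}" using elim(3) m by blast
          have "X n v \<omega> = \<xi> m v \<omega> * X (D m v \<omega>) (u m v \<omega>) \<omega>" using elim(2) m by simp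
          then show ?thesis using 1 2 by auto
        next
          case True
          have "X n v \<omega> = \<sigma> v \<omega>" using elim(1) unfolding True by blast
          then show ?thesis using elim(4) by (simp only:)
        qed
      qed
    qed
    then show ?case by blast
  qed
qed

end

section \<open>The coupled walk\<close>

lemma drift_eq: "drift B n v s = (\<Sum>i\<in>UNIV. B $ i $ v * s $ i) / real n"
  by (simp add: drift_def vector_matrix_mult_def mult.commute)

lemma drift_measurable:
  assumes s: "s \<in> borel_measurable M"
  shows "(\<lambda>\<omega>. drift B n v (s \<omega>)) \<in> borel_measurable M"
  unfolding drift_eq using vec_nth_measurable[OF s] by measurable

text \<open>The bound on the column sums keeps the drift in [-1, 1] at every position with
  coordinates bounded by n, so that it can be the mean of a sign.\<close>

locale coupled_walk = coupling_base M y for M :: "'a measure" and y :: "bool \<times> nat \<times> 'v::finite \<Rightarrow> 'a \<Rightarrow> real" +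
  fixes B :: "real ^ 'v ^ 'v" and q :: "'v \<Rightarrow> real"
  assumes colsum: "\<And>v. (\<Sum>i\<in>UNIV. \<bar>B $ i $ v\<bar>) \<le> 1" and q: "\<And>v. q v \<in> {0..1}"
begin

text \<open>Here n counts the steps already made. The case n = 0 is the first step, a sign that
  takes the value 1 with probability \<open>q v\<close>.\<close>

definition step :: "nat \<Rightarrow> 'v \<Rightarrow> real ^ 'v \<Rightarrow> real \<Rightarrow> real \<Rightarrow> real" where
  "step n v s r w = (if n = 0 then (if w < q v then 1 else - 1)
     else if w < \<bar>drift B n v s\<bar> then (if drift B n v s \<ge> 0 then 1 else - 1) else r)"

text \<open>\<open>Sf\<close> expresses the walk by the family \<open>z\<close> of all Rademacher and uniform variables. Its value at
  time \<open>n\<close> can be computed from the restriction \<open>Pz n\<close> to the past.\<close>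

primrec Sf :: "nat \<Rightarrow> (bool \<times> nat \<times> 'v \<Rightarrow> real) \<Rightarrow> real ^ 'v" where
  "Sf 0 z = 0"
| "Sf (Suc n) z = Sf n z + (\<chi> v. step n v (Sf n z) (z (True, Suc n, v)) (z (False, Suc n, v)))"

definition Past :: "nat \<Rightarrow> (bool \<times> nat \<times> 'v) set" where "Past n = UNIV \<times> {1..n} \<times> UNIV"

abbreviation "PastM n \<equiv> PiM (Past n) (\<lambda>_. borel :: real measure)"

definition Pz :: "nat \<Rightarrow> 'a \<Rightarrow> bool \<times> nat \<times> 'v \<Rightarrow> real" where
  "Pz n \<omega> = (\<lambda>k\<in>Past n. Z k \<omega>)"

definition W :: "nat \<Rightarrow> 'v \<Rightarrow> 'a \<Rightarrow> real" where "W n v = y (False, n, v)"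

definition S :: "nat \<Rightarrow> 'a \<Rightarrow> real ^ 'v" where "S n \<omega> = Sf n (\<lambda>k. Z k \<omega>)"

definition X :: "nat \<Rightarrow> 'v \<Rightarrow> 'a \<Rightarrow> real" where
  "X n v \<omega> = step (n - 1) v (S (n - 1) \<omega>) (rad n v \<omega>) (W n v \<omega>)"

definition a :: "nat \<Rightarrow> 'v \<Rightarrow> 'a \<Rightarrow> real" where "a n v \<omega> = drift B n v (S n \<omega>)"

lemma Z_simps: "Z (True, n, v) \<omega> = rad n v \<omega>" "Z (False, n, v) \<omega> = W n v \<omega>"
  by (simp_all add: Z_def W_def)

lemma W_measurable[measurable]: "W n v \<in> borel_measurable M" by (simp add: W_def)

lemma W_unif: "0 \<le> c \<Longrightarrow> c \<le> 1 \<Longrightarrow> prob {\<omega>\<in>space M. W n v \<omega> < c} = c"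
  by (simp add: W_def y_unif)

lemma S_0: "S 0 \<omega> = 0" by (simp add: S_def)

lemma S_Suc: "S (Suc n) \<omega> = S n \<omega> + (\<chi> v. X (Suc n) v \<omega>)"
  by (simp add: S_def X_def Z_simps)

lemma S_eq_sum: "S n \<omega> = (\<Sum>j=1..n. \<chi> v. X j v \<omega>)"
  by (induction n) (simp_all add: S_0 S_Suc)

lemma X_in: "n \<ge> 1 \<Longrightarrow> X n v \<omega> \<in> {- 1, 1}"
  using rad_in[of n v \<omega>] by (auto simp: X_def step_def)

lemma S_nth_le: "\<bar>S n \<omega> $ v\<bar> \<le> real n"
proof (induction n)
  case (Suc n)
  have "\<bar>X (Suc n) v \<omega>\<bar> \<le> 1" using X_in[of "Suc n" v \<omega>] by auto
  then show ?case using Suc by (simp add: S_Suc)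
qed (simp add: S_0)

lemma drift_le_1:
  assumes "\<And>i. \<bar>s $ i\<bar> \<le> real n" shows "\<bar>drift B n v s\<bar> \<le> 1"
proof (cases "n = 0")
  case False
  have "\<bar>\<Sum>i\<in>UNIV. B $ i $ v * s $ i\<bar> \<le> (\<Sum>i\<in>UNIV. \<bar>B $ i $ v\<bar> * real n)"
    by (rule order_trans[OF sum_abs], intro sum_mono) (auto simp: abs_mult intro!: mult_left_mono assms)
  also have "\<dots> \<le> 1 * real n" unfolding sum_distrib_right[symmetric] by (intro mult_right_mono colsum) simp
  finally show ?thesis using False by (simp add: drift_eq)
qed (simp add: drift_def)

lemma a_le_1: "\<bar>a n v \<omega>\<bar> \<le> 1"
  unfolding a_def by (rule drift_le_1) (rule S_nth_le)

lemma Past_mono: "n \<le> m \<Longrightarrow> Past n \<subseteq> Past m" by (auto simp: Past_def)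

lemma Sf_cong: "(\<And>k. k \<in> Past n \<Longrightarrow> z k = z' k) \<Longrightarrow> Sf n z = Sf n z'"
proof (induction n)
  case (Suc n)
  have "Sf n z = Sf n z'" using Suc Past_mono[of n "Suc n"] by auto
  moreover have "z (b, Suc n, v) = z' (b, Suc n, v)" for b v by (rule Suc.prems) (simp add: Past_def)
  ultimately show ?case by simp
qed simp

lemma Sf_Pz: "n \<le> m \<Longrightarrow> Sf n (Pz m \<omega>) = S n \<omega>"
  unfolding S_def by (rule Sf_cong) (use Past_mono[of n m] in \<open>auto simp: Pz_def\<close>)

lemma Pz_rad: "1 \<le> j \<Longrightarrow> j \<le> n \<Longrightarrow> Pz n \<omega> (True, j, v) = rad j v \<omega>"
  by (simp add: Pz_def Past_def Z_simps)

lemma Pz_W: "1 \<le> j \<Longrightarrow> j \<le> n \<Longrightarrow> Pz n \<omega> (False, j, v) = W j v \<omega>"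
  by (simp add: Pz_def Past_def Z_simps)

lemma step_measurable:
  assumes [measurable]: "s \<in> borel_measurable N" "r \<in> borel_measurable N" "w \<in> borel_measurable N"
  shows "(\<lambda>x. step n v (s x) (r x) (w x)) \<in> borel_measurable N"
proof -
  note [measurable] = drift_measurable[OF assms(1)]
  show ?thesis unfolding step_def by measurable
qed

lemma coord_measurable: "k \<in> Past n \<Longrightarrow> (\<lambda>z. z k) \<in> borel_measurable (PastM n)"
  using measurable_component_singleton[of k "Past n" "\<lambda>_. borel"] by simp

lemma Sf_measurable: "n \<le> m \<Longrightarrow> Sf n \<in> borel_measurable (PastM m)"
proof (induction n)
  case (Suc n)
  have "(\<lambda>z. \<chi> v. step n v (Sf n z) (z (True, Suc n, v)) (z (False, Suc n, v))) \<in> borel_measurable (PastM m)"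
    by (intro vec_lambda_measurable step_measurable Suc.IH coord_measurable)
      (use Suc.prems in \<open>auto simp: Past_def\<close>)
  then show ?case using Suc by (simp add: borel_measurable_add)
next
  case 0
  have "Sf 0 = (\<lambda>z. 0)" by (rule ext) simp
  then show ?case by simp
qed

lemma Pz_measurable[measurable]: "Pz n \<in> measurable M (PastM n)"
  unfolding Pz_def[abs_def] by (intro measurable_restrict) simp

lemma S_measurable[measurable]: "S n \<in> borel_measurable M"
  using measurable_compose[OF Pz_measurable[of n] Sf_measurable[OF order_refl, of n]] by (simp add: Sf_Pz)

lemma a_measurable[measurable]: "a n v \<in> borel_measurable M"
  unfolding a_def[abs_def] by (rule drift_measurable) measurable

lemma X_measurable[measurable]: "X n v \<in> borel_measurable M"
  unfolding X_def[abs_def] by (rule step_measurable) measurable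

lemma integrable_bounded:
  assumes "f \<in> borel_measurable M" "\<And>\<omega>. \<omega> \<in> space M \<Longrightarrow> \<bar>f \<omega>\<bar> \<le> (c::real)"
  shows "integrable M f"
  by (rule integrable_const_bound[of _ c]) (use assms in auto)

lemma rad_W_indep:
  assumes n: "n \<ge> 1"
  shows "indep_var borel (rad n v) borel (W n v)"
proof -
  have "indep_var (borel) (\<lambda>\<omega>. (\<lambda>k\<in>{(True, n, v)}. Z k \<omega>) (True, n, v)) borel (\<lambda>\<omega>. (\<lambda>k\<in>{(False, n, v)}. Z k \<omega>) (False, n, v))"
    using indep_var_compose[OF indep_var_restrict[OF Z_indep, of "{(True, n, v)}" "{(False, n, v)}"],
      of "\<lambda>f. f (True, n, v)" borel "\<lambda>f. f (False, n, v)" borel] n by (simp add: comp_def)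
  then show ?thesis by (simp add: Z_simps)
qed

text \<open>Overwriting happens with probability |a| and contributes the sign of a times |a|, that
  is a. Otherwise the fair sign is kept, which has mean 0 and is independent of that event.\<close>

lemma step_expectation:
  assumes s: "\<And>i. \<bar>s $ i\<bar> \<le> real n" and n: "n \<ge> 1"
  shows "expectation (\<lambda>\<omega>. step n v s (rad (Suc n) v \<omega>) (W (Suc n) v \<omega>)) = drift B n v s"
proof -
  let ?a = "drift B n v s" and ?sg = "if drift B n v s \<ge> 0 then 1 else - 1 :: real"
  let ?L = "{\<omega>\<in>space M. W (Suc n) v \<omega> < \<bar>?a\<bar>}"
  let ?h = "\<lambda>w. if w < \<bar>?a\<bar> then 0 else 1 :: real"
  have ir: "integrable M (rad (Suc n) v)"
    by (rule integrable_bounded[of _ 1]) (simp_all add: rad_abs)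
  have "indep_var borel (rad (Suc n) v) borel (?h \<circ> W (Suc n) v)"
    using indep_var_compose[OF rad_W_indep[of "Suc n" v], of id borel ?h borel] by simp
  then have prod: "expectation (\<lambda>\<omega>. rad (Suc n) v \<omega> * ?h (W (Suc n) v \<omega>)) = expectation (rad (Suc n) v) * expectation (\<lambda>\<omega>. ?h (W (Suc n) v \<omega>))"
    and ip: "integrable M (\<lambda>\<omega>. rad (Suc n) v \<omega> * ?h (W (Suc n) v \<omega>))"
    using indep_var_lebesgue_integral[of "rad (Suc n) v" "?h \<circ> W (Suc n) v"]
      indep_var_integrable[of "rad (Suc n) v" "?h \<circ> W (Suc n) v"] ir
      integrable_bounded[of "?h \<circ> W (Suc n) v" 1] by (auto simp: comp_def)
  have "expectation (\<lambda>\<omega>. step n v s (rad (Suc n) v \<omega>) (W (Suc n) v \<omega>))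
      = expectation (\<lambda>\<omega>. ?sg * indicator ?L \<omega> + rad (Suc n) v \<omega> * ?h (W (Suc n) v \<omega>))"
    by (rule Bochner_Integration.integral_cong[OF refl]) (use n in \<open>auto simp: step_def indicator_def\<close>)
  also have "\<dots> = ?sg * prob ?L"
    using ip prod rad_expectation[of "Suc n" v]
    by (subst Bochner_Integration.integral_add) (auto simp: emeasure_eq_measure)
  also have "prob ?L = \<bar>?a\<bar>" by (rule W_unif) (use drift_le_1[OF s] in auto)
  finally show ?thesis by auto
qed

lemma step_expectation_0:
  "expectation (\<lambda>\<omega>. step 0 v s (rad n v \<omega>) (W n v \<omega>)) = 2 * q v - 1"
proof -
  let ?L = "{\<omega>\<in>space M. W n v \<omega> < q v}"
  have "expectation (\<lambda>\<omega>. step 0 v s (rad n v \<omega>) (W n v \<omega>)) = expectation (\<lambda>\<omega>. 2 * indicator ?L \<omega> - 1)"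
    by (rule Bochner_Integration.integral_cong[OF refl]) (auto simp: step_def indicator_def)
  also have "\<dots> = 2 * prob ?L - 1"
    by (subst Bochner_Integration.integral_diff) (auto simp: emeasure_eq_measure prob_space)
  also have "prob ?L = q v" by (rule W_unif) (use q in auto)
  finally show ?thesis .
qed

lemma sign_prob:
  assumes f[measurable]: "f \<in> borel_measurable M" and pm: "\<And>\<omega>. \<omega> \<in> space M \<Longrightarrow> f \<omega> \<in> {- 1, 1}" and s: "s \<in> {- 1, 1 :: real}"
  shows "prob {\<omega>\<in>space M. f \<omega> = s} = (1 + s * expectation f) / 2"
proof -
  let ?L = "{\<omega>\<in>space M. f \<omega> = s}"
  have "expectation f = expectation (\<lambda>\<omega>. s * (2 * indicator ?L \<omega> - 1))"
  proof (rule Bochner_Integration.integral_cong[OF refl])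
    fix \<omega> assume "\<omega> \<in> space M"
    then show "f \<omega> = s * (2 * indicator ?L \<omega> - 1)"
      using pm[of \<omega>] s by (auto simp: indicator_def)
  qed
  also have "\<dots> = s * (2 * prob ?L - 1)"
    by (subst integral_mult_right_zero, subst Bochner_Integration.integral_diff) (auto simp: emeasure_eq_measure prob_space)
  finally have "s * expectation f = (s * s) * (2 * prob ?L - 1)" by simp
  then show ?thesis using s by auto
qed

section \<open>Conditioning on the past\<close>

definition new :: "nat \<Rightarrow> 'v \<Rightarrow> (bool \<times> nat \<times> 'v) set" where
  "new n v = {(True, n, v), (False, n, v)}"

lemma past_new_indep:
  "indep_var (PastM n) (Pz n) (PiM (new (Suc n) v) (\<lambda>_. borel)) (\<lambda>\<omega>. \<lambda>k\<in>new (Suc n) v. Z k \<omega>)"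
  unfolding Pz_def[abs_def]
  by (rule indep_var_restrict[OF Z_indep]) (auto simp: Past_def new_def)

text \<open>The variables of time n + 1 are independent of \<open>Pz n\<close>, so the past can be
  frozen and the new pair integrated over a second copy of the same space. Whatever depends on the
  past has to be written as a function of \<open>Pz n\<close>.\<close>

lemma past_new_expectation:
  fixes G :: "(bool \<times> nat \<times> 'v \<Rightarrow> real) \<Rightarrow> real \<Rightarrow> real \<Rightarrow> real"
  assumes G: "(\<lambda>(z, r, w). G z r w) \<in> borel_measurable (PastM n \<Otimes>\<^sub>M borel \<Otimes>\<^sub>M borel)"
    and bd: "\<And>\<omega>. \<omega> \<in> space M \<Longrightarrow> \<bar>G (Pz n \<omega>) (rad (Suc n) v \<omega>) (W (Suc n) v \<omega>)\<bar> \<le> c"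
  shows "expectation (\<lambda>\<omega>. G (Pz n \<omega>) (rad (Suc n) v \<omega>) (W (Suc n) v \<omega>))
     = expectation (\<lambda>\<omega>. expectation (\<lambda>\<omega>'. G (Pz n \<omega>) (rad (Suc n) v \<omega>') (W (Suc n) v \<omega>')))"
    and "integrable M (\<lambda>\<omega>. G (Pz n \<omega>) (rad (Suc n) v \<omega>) (W (Suc n) v \<omega>))"
proof -
  let ?L = "PiM (new (Suc n) v) (\<lambda>_. borel :: real measure)" and ?b = "\<lambda>\<omega>. \<lambda>k\<in>new (Suc n) v. Z k \<omega>"
  let ?h = "\<lambda>(z, f). G z (f (True, Suc n, v)) (f (False, Suc n, v))"
  have c[measurable]: "(\<lambda>f. f (True, Suc n, v)) \<in> borel_measurable ?L" "(\<lambda>f. f (False, Suc n, v)) \<in> borel_measurable ?L"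
    using measurable_component_singleton[of "(True, Suc n, v)" "new (Suc n) v" "\<lambda>_. borel :: real measure"]
      measurable_component_singleton[of "(False, Suc n, v)" "new (Suc n) v" "\<lambda>_. borel :: real measure"]
    by (simp_all add: new_def)
  have "(\<lambda>x. (fst x, (snd x) (True, Suc n, v), (snd x) (False, Suc n, v))) \<in> measurable (PastM n \<Otimes>\<^sub>M ?L) (PastM n \<Otimes>\<^sub>M borel \<Otimes>\<^sub>M borel)"
    by (intro measurable_Pair measurable_fst measurable_compose[OF measurable_snd c(1)] measurable_compose[OF measurable_snd c(2)])
  from measurable_compose[OF this G] have h: "?h \<in> borel_measurable (PastM n \<Otimes>\<^sub>M ?L)"
    by (simp add: split_beta')
  have b: "?b \<omega> (True, Suc n, v) = rad (Suc n) v \<omega>" "?b \<omega> (False, Suc n, v) = W (Suc n) v \<omega>" for \<omega>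
    by (simp_all add: new_def Z_simps)
  have bm: "?b \<in> measurable M ?L" by (intro measurable_restrict) simp
  have hm: "(\<lambda>\<omega>. G (Pz n \<omega>) (rad (Suc n) v \<omega>) (W (Suc n) v \<omega>)) \<in> borel_measurable M"
    using measurable_compose[OF measurable_Pair[OF Pz_measurable bm] h] by (simp only: prod.case b)
  show int: "integrable M (\<lambda>\<omega>. G (Pz n \<omega>) (rad (Suc n) v \<omega>) (W (Suc n) v \<omega>))"
    by (rule integrable_bounded[OF hm bd])
  have "expectation (\<lambda>\<omega>. ?h (Pz n \<omega>, ?b \<omega>)) = expectation (\<lambda>\<omega>. \<integral>f. ?h (Pz n \<omega>, f) \<partial>distr M ?L ?b)"
    by (rule indep_var_integral(1)[OF past_new_indep h]) (use int in \<open>simp only: prod.case b\<close>)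
  then have 1: "expectation (\<lambda>\<omega>. G (Pz n \<omega>) (rad (Suc n) v \<omega>) (W (Suc n) v \<omega>))
     = expectation (\<lambda>\<omega>. \<integral>f. ?h (Pz n \<omega>, f) \<partial>distr M ?L ?b)" by (simp only: prod.case b)
  have 2: "(\<integral>f. ?h (Pz n \<omega>, f) \<partial>distr M ?L ?b) = expectation (\<lambda>\<omega>'. G (Pz n \<omega>) (rad (Suc n) v \<omega>') (W (Suc n) v \<omega>'))"
    if "\<omega> \<in> space M" for \<omega>
  proof -
    have "Pz n \<omega> \<in> space (PastM n)" using measurable_space[OF Pz_measurable that] .
    from measurable_compose[OF measurable_Pair1'[OF this] h]
    have "(\<lambda>f. ?h (Pz n \<omega>, f)) \<in> borel_measurable ?L" .
    from integral_distr[OF bm this] show ?thesis by (simp only: prod.case b)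
  qed
  show "expectation (\<lambda>\<omega>. G (Pz n \<omega>) (rad (Suc n) v \<omega>) (W (Suc n) v \<omega>))
     = expectation (\<lambda>\<omega>. expectation (\<lambda>\<omega>'. G (Pz n \<omega>) (rad (Suc n) v \<omega>') (W (Suc n) v \<omega>')))"
    unfolding 1 by (rule Bochner_Integration.integral_cong[OF refl 2])
qed

text \<open>The martingale difference property in weak form, as orthogonality to bounded functions
  of the past. The inner integral vanishes by \<open>step_expectation\<close>.\<close>

lemma orth_X:
  assumes f: "f \<in> borel_measurable (PastM n)" and bd: "\<And>\<omega>. \<omega> \<in> space M \<Longrightarrow> \<bar>f (Pz n \<omega>)\<bar> \<le> c" and n: "n \<ge> 1"
  shows "expectation (\<lambda>\<omega>. f (Pz n \<omega>) * (X (Suc n) v \<omega> - a n v \<omega>)) = 0"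
    and "integrable M (\<lambda>\<omega>. f (Pz n \<omega>) * (X (Suc n) v \<omega> - a n v \<omega>))"
proof -
  define G where "G z r w = f z * (step n v (Sf n z) r w - drift B n v (Sf n z))" for z r w
  have Sm: "(\<lambda>x. Sf n (fst x)) \<in> borel_measurable (PastM n \<Otimes>\<^sub>M borel \<Otimes>\<^sub>M borel)"
    by (rule measurable_compose[OF measurable_fst Sf_measurable]) simp
  have G: "(\<lambda>(z, r, w). G z r w) \<in> borel_measurable (PastM n \<Otimes>\<^sub>M (borel :: real measure) \<Otimes>\<^sub>M (borel :: real measure))"
    unfolding G_def split_beta'
    by (intro borel_measurable_times borel_measurable_diff measurable_compose[OF measurable_fst f] drift_measurable step_measurable Sm)
      (auto intro!: measurable_compose[OF measurable_snd measurable_fst] measurable_compose[OF measurable_snd measurable_snd])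
  have eq: "f (Pz n \<omega>) * (X (Suc n) v \<omega> - a n v \<omega>) = G (Pz n \<omega>) (rad (Suc n) v \<omega>) (W (Suc n) v \<omega>)" for \<omega>
    by (simp add: G_def Sf_Pz X_def a_def)
  have Gbd: "\<bar>G (Pz n \<omega>) (rad (Suc n) v \<omega>) (W (Suc n) v \<omega>)\<bar> \<le> c * 2" if "\<omega> \<in> space M" for \<omega>
    unfolding eq[symmetric] abs_mult
    by (intro mult_mono bd that) (use X_in[of "Suc n" v \<omega>] a_le_1[of n v \<omega>] order_trans[OF abs_ge_zero bd[OF that]] in auto)
  show "integrable M (\<lambda>\<omega>. f (Pz n \<omega>) * (X (Suc n) v \<omega> - a n v \<omega>))"
    unfolding eq by (rule past_new_expectation(2)[OF G Gbd])
  have z: "expectation (\<lambda>\<omega>'. G (Pz n \<omega>) (rad (Suc n) v \<omega>') (W (Suc n) v \<omega>')) = 0" for \<omega>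
  proof -
    have "integrable M (\<lambda>\<omega>'. step n v (S n \<omega>) (rad (Suc n) v \<omega>') (W (Suc n) v \<omega>'))"
      by (rule integrable_bounded[of _ 1]) (use rad_abs[of "Suc n" v] in \<open>auto intro!: step_measurable simp: step_def\<close>)
    then show ?thesis
      using step_expectation[where s = "S n \<omega>", OF S_nth_le n, of v] by (simp add: G_def Sf_Pz prob_space)
  qed
  show "expectation (\<lambda>\<omega>. f (Pz n \<omega>) * (X (Suc n) v \<omega> - a n v \<omega>)) = 0"
    unfolding eq by (subst past_new_expectation(1)[OF G Gbd], assumption) (simp add: z)
qed

lemma orth_rad:
  assumes f: "f \<in> borel_measurable (PastM n)" and bd: "\<And>\<omega>. \<omega> \<in> space M \<Longrightarrow> \<bar>f (Pz n \<omega>)\<bar> \<le> c"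
  shows "expectation (\<lambda>\<omega>. f (Pz n \<omega>) * rad (Suc n) v \<omega>) = 0"
    and "integrable M (\<lambda>\<omega>. f (Pz n \<omega>) * rad (Suc n) v \<omega>)"
proof -
  define G where "G z r w = f z * r" for z and r w :: real
  have G: "(\<lambda>(z, r, w). G z r w) \<in> borel_measurable (PastM n \<Otimes>\<^sub>M (borel :: real measure) \<Otimes>\<^sub>M (borel :: real measure))"
    unfolding G_def split_beta'
    by (intro borel_measurable_times measurable_compose[OF measurable_fst f] measurable_compose[OF measurable_snd measurable_fst])
  have Gbd: "\<bar>G (Pz n \<omega>) (rad (Suc n) v \<omega>) (W (Suc n) v \<omega>)\<bar> \<le> c * 1" if "\<omega> \<in> space M" for \<omega>
    unfolding G_def abs_mult
    by (intro mult_mono bd that) (use rad_in[of "Suc n" v \<omega>] order_trans[OF abs_ge_zero bd[OF that]] in auto)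
  show "integrable M (\<lambda>\<omega>. f (Pz n \<omega>) * rad (Suc n) v \<omega>)"
    using past_new_expectation(2)[OF G Gbd] by (simp add: G_def)
  show "expectation (\<lambda>\<omega>. f (Pz n \<omega>) * rad (Suc n) v \<omega>) = 0"
    using past_new_expectation(1)[OF G Gbd] by (simp add: G_def rad_expectation)
qed

lemma flip_expectation:
  "expectation (\<lambda>\<omega>. if W (Suc n) v \<omega> < \<bar>a n v \<omega>\<bar> then 1 else 0) = expectation (\<lambda>\<omega>. \<bar>a n v \<omega>\<bar>)"
proof -
  define G where "G z r w = (if w < \<bar>drift B n v (Sf n z)\<bar> then 1 else 0 :: real)" for z and r w :: real
  have Sm: "(\<lambda>x. Sf n (fst x)) \<in> borel_measurable (PastM n \<Otimes>\<^sub>M borel \<Otimes>\<^sub>M borel)"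
    by (rule measurable_compose[OF measurable_fst Sf_measurable]) simp
  note [measurable] = drift_measurable[OF Sm, of B n v]
  have G: "(\<lambda>(z, r, w). G z r w) \<in> borel_measurable (PastM n \<Otimes>\<^sub>M (borel :: real measure) \<Otimes>\<^sub>M (borel :: real measure))"
    unfolding G_def split_beta' by measurable
  have eq: "(if W (Suc n) v \<omega> < \<bar>a n v \<omega>\<bar> then 1 else 0) = G (Pz n \<omega>) (rad (Suc n) v \<omega>) (W (Suc n) v \<omega>)" for \<omega>
    by (simp add: G_def Sf_Pz a_def)
  have "expectation (\<lambda>\<omega>'. G (Pz n \<omega>) (rad (Suc n) v \<omega>') (W (Suc n) v \<omega>')) = \<bar>a n v \<omega>\<bar>" for \<omega>
  proof -
    have "expectation (\<lambda>\<omega>'. G (Pz n \<omega>) (rad (Suc n) v \<omega>') (W (Suc n) v \<omega>')) = expectation (indicator {\<omega>'\<in>space M. W (Suc n) v \<omega>' < \<bar>a n v \<omega>\<bar>})"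
      by (rule Bochner_Integration.integral_cong[OF refl]) (auto simp: G_def Sf_Pz a_def indicator_def)
    then show ?thesis using W_unif[of "\<bar>a n v \<omega>\<bar>" "Suc n" v] a_le_1 by simp
  qed
  then show ?thesis
    unfolding eq by (subst past_new_expectation(1)[OF G, of v 1]) (auto simp: G_def)
qed

text \<open>As for the original walk, \<open>path_iff\<close> fixes the past, and along a fixed path
  the steps are functions of disjoint pairs of \<open>Z\<close>. The floor only turns the real signs
  into integers, the form in which the two walks are compared.\<close>

lemma walk_path_prob:
  assumes x: "\<And>j v. x j v \<in> {- 1, 1 :: int}"
  shows "prob {\<omega>\<in>space M. \<forall>n\<in>{1..N}. \<forall>v. \<lfloor>X n v \<omega>\<rfloor> = x n v} = (\<Prod>n=1..N. \<Prod>v\<in>UNIV. trans_prob B q n v x)"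
proof -
  define F where "F n v x \<omega> = \<lfloor>step (n - 1) v (path_sum x (n - 1)) (rad n v \<omega>) (W n v \<omega>)\<rfloor>" for n v and x :: "nat \<Rightarrow> 'v \<Rightarrow> int" and \<omega>
  have XF: "\<lfloor>X n v \<omega>\<rfloor> = F n v (\<lambda>j v. \<lfloor>X j v \<omega>\<rfloor>) \<omega>" if "n \<ge> 1" for n v \<omega>
  proof -
    have "real_of_int \<lfloor>X j v \<omega>\<rfloor> = X j v \<omega>" if "j \<ge> 1" for j v
    proof -
      have "X j v \<omega> = - 1 \<or> X j v \<omega> = 1" using X_in[OF that, of v \<omega>] by blast
      then show ?thesis by (metis floor_of_int of_int_1 of_int_minus)
    qed
    then have "path_sum (\<lambda>j v. \<lfloor>X j v \<omega>\<rfloor>) (n - 1) = S (n - 1) \<omega>"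
      unfolding path_sum_def S_eq_sum by (intro sum.cong refl) (simp add: vec_eq_iff)
    then show ?thesis by (simp add: F_def X_def)
  qed
  have "indep_vars (\<lambda>nv. PiM (new (fst nv) (snd nv)) (\<lambda>_. borel)) (\<lambda>nv \<omega>. \<lambda>k\<in>new (fst nv) (snd nv). Z k \<omega>) ({1..} \<times> UNIV)"
    by (rule indep_vars_restrict[OF Z_indep]) (auto simp: new_def disjoint_family_on_def)
  then have "indep_vars (\<lambda>_. count_space UNIV) (\<lambda>nv \<omega>. (\<lambda>f. \<lfloor>step (fst nv - 1) (snd nv) (path_sum x (fst nv - 1)) (f (True, fst nv, snd nv)) (f (False, fst nv, snd nv))\<rfloor>)
      (\<lambda>k\<in>new (fst nv) (snd nv). Z k \<omega>)) ({1..} \<times> UNIV)"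
  proof (rule indep_vars_compose2)
    fix nv :: "nat \<times> 'v"
    have [measurable]: "(\<lambda>f. f (True, fst nv, snd nv)) \<in> borel_measurable (PiM (new (fst nv) (snd nv)) (\<lambda>_. borel :: real measure))"
      "(\<lambda>f. f (False, fst nv, snd nv)) \<in> borel_measurable (PiM (new (fst nv) (snd nv)) (\<lambda>_. borel :: real measure))"
      using measurable_component_singleton[of "(True, fst nv, snd nv)" "new (fst nv) (snd nv)" "\<lambda>_. borel :: real measure"]
        measurable_component_singleton[of "(False, fst nv, snd nv)" "new (fst nv) (snd nv)" "\<lambda>_. borel :: real measure"]
      by (simp_all add: new_def)
    have "(\<lambda>f. step (fst nv - 1) (snd nv) (path_sum x (fst nv - 1)) (f (True, fst nv, snd nv)) (f (False, fst nv, snd nv))) \<in> borel_measurable (PiM (new (fst nv) (snd nv)) (\<lambda>_. borel))"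
      by (rule step_measurable) measurable
    then show "(\<lambda>f. \<lfloor>step (fst nv - 1) (snd nv) (path_sum x (fst nv - 1)) (f (True, fst nv, snd nv)) (f (False, fst nv, snd nv))\<rfloor>)
      \<in> measurable (PiM (new (fst nv) (snd nv)) (\<lambda>_. borel)) (count_space UNIV)" by measurable
  qed
  then have ind: "indep_vars (\<lambda>_. count_space UNIV) (\<lambda>(n, v). F n v x) ({1..} \<times> UNIV)"
  proof -
    assume *: "indep_vars (\<lambda>_. count_space UNIV) (\<lambda>nv \<omega>. (\<lambda>f. \<lfloor>step (fst nv - 1) (snd nv) (path_sum x (fst nv - 1)) (f (True, fst nv, snd nv)) (f (False, fst nv, snd nv))\<rfloor>)
      (\<lambda>k\<in>new (fst nv) (snd nv). Z k \<omega>)) ({1..} \<times> UNIV)"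
    have eq: "(\<lambda>nv \<omega>. (\<lambda>f. \<lfloor>step (fst nv - 1) (snd nv) (path_sum x (fst nv - 1)) (f (True, fst nv, snd nv)) (f (False, fst nv, snd nv))\<rfloor>)
      (\<lambda>k\<in>new (fst nv) (snd nv). Z k \<omega>)) = (\<lambda>(n, v). F n v x)"
      by (intro ext) (auto simp: F_def new_def Z_simps)
    show ?thesis using * unfolding eq .
  qed
  have "{\<omega>\<in>space M. \<forall>n\<in>{1..N}. \<forall>v. \<lfloor>X n v \<omega>\<rfloor> = x n v} = {\<omega>\<in>space M. \<forall>n\<in>{1..N}. \<forall>v. F n v x \<omega> = x n v}"
  proof (rule Collect_cong, rule conj_cong[OF refl])
    fix \<omega>
    show "(\<forall>n\<in>{1..N}. \<forall>v. \<lfloor>X n v \<omega>\<rfloor> = x n v) \<longleftrightarrow> (\<forall>n\<in>{1..N}. \<forall>v. F n v x \<omega> = x n v)"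
    proof (rule path_iff[where F = "\<lambda>n v x. F n v x \<omega>"], rule XF)
      fix n :: nat and v :: 'v and x x' :: "nat \<Rightarrow> 'v \<Rightarrow> int"
      assume n: "n \<ge> 1" and xx: "\<And>j v. 1 \<le> j \<Longrightarrow> j < n \<Longrightarrow> x j v = x' j v"
      have "path_sum x (n - 1) = path_sum x' (n - 1)"
        unfolding path_sum_def by (intro sum.cong refl) (use xx n in \<open>auto simp: vec_eq_iff\<close>)
      then show "F n v x \<omega> = F n v x' \<omega>" by (simp add: F_def)
    qed
  qed
  then have "prob {\<omega>\<in>space M. \<forall>n\<in>{1..N}. \<forall>v. \<lfloor>X n v \<omega>\<rfloor> = x n v} = (\<Prod>n=1..N. \<Prod>v\<in>UNIV. prob {\<omega>\<in>space M. F n v x \<omega> = x n v})"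
    using path_prob_indep[OF ind] by simp
  also have "\<dots> = (\<Prod>n=1..N. \<Prod>v\<in>UNIV. trans_prob B q n v x)"
  proof (intro prod.cong refl)
    fix n v assume n: "n \<in> {1..N}"
    let ?s = "\<lambda>\<omega>. step (n - 1) v (path_sum x (n - 1)) (rad n v \<omega>) (W n v \<omega>)"
    have pm: "?s \<omega> \<in> {- 1, 1}" for \<omega> using rad_in[of n v \<omega>] n by (auto simp: step_def)
    have xr: "real_of_int (x n v) \<in> {- 1, 1}" using x[of n v] by auto
    have "F n v x \<omega> = x n v \<longleftrightarrow> ?s \<omega> = real_of_int (x n v)" for \<omega>
    proof -
      have "\<lfloor>- 1 :: real\<rfloor> = - 1" using floor_of_int[of "- 1", where 'a = real] by simp
      then show ?thesis using pm[of \<omega>] x[of n v] by (auto simp: F_def)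
    qed
    then have "prob {\<omega>\<in>space M. F n v x \<omega> = x n v} = prob {\<omega>\<in>space M. ?s \<omega> = real_of_int (x n v)}" by simp
    also have "\<dots> = (1 + real_of_int (x n v) * expectation ?s) / 2"
      by (rule sign_prob[OF _ pm xr]) (auto intro!: step_measurable)
    also have "\<dots> = trans_prob B q n v x"
    proof (cases "n = 1")
      case True
      then show ?thesis using x[of 1 v] by (auto simp: trans_prob_def step_expectation_0 field_simps)
    next
      case False
      then have n2: "n - 1 \<ge> 1" "Suc (n - 1) = n" using n by auto
      have "\<bar>path_sum x m $ i\<bar> \<le> real m" for m i
      proof (induction m)
        case (Suc m)
        have "\<bar>real_of_int (x (Suc m) i)\<bar> \<le> 1" using x[of "Suc m" i] by auto
        then show ?case using Suc by (simp add: path_sum_def)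
      qed (simp add: path_sum_def)
      from step_expectation[OF this n2(1), of v] show ?thesis
        using False n2(2) by (simp add: trans_prob_def)
    qed
    finally show "prob {\<omega>\<in>space M. F n v x \<omega> = x n v} = trans_prob B q n v x" .
  qed
  finally show ?thesis .
qed

end

section \<open>Maximal inequality and Borel-Cantelli arguments\<close>

text \<open>Kolmogorov's inequality. The event is split by the first index k with |D k| \<ge> c;
  there (D n)^2 is at least (D k)^2 plus twice the product of D k with D n - D k, and
  \<open>orth\<close> removes that product in the mean.\<close>

lemma (in prob_space) maximal_inequality:
  fixes D :: "nat \<Rightarrow> 'a \<Rightarrow> real"
  assumes D[measurable]: "\<And>k. D k \<in> borel_measurable M" and bd: "\<And>k \<omega>. \<omega> \<in> space M \<Longrightarrow> \<bar>D k \<omega>\<bar> \<le> b k" and c: "c > 0"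
    and orth: "\<And>k. k \<le> n \<Longrightarrow> expectation (\<lambda>\<omega>. (if c \<le> \<bar>D k \<omega>\<bar> \<and> (\<forall>j<k. \<bar>D j \<omega>\<bar> < c) then D k \<omega> else 0) * (D n \<omega> - D k \<omega>)) = 0"
  shows "prob {\<omega>\<in>space M. \<exists>k\<le>n. c \<le> \<bar>D k \<omega>\<bar>} \<le> expectation (\<lambda>\<omega>. (D n \<omega>)\<^sup>2) / c\<^sup>2"
proof -
  define P where "P k \<omega> \<longleftrightarrow> c \<le> \<bar>D k \<omega>\<bar> \<and> (\<forall>j<k. \<bar>D j \<omega>\<bar> < c)" for k \<omega>
  have Pm[measurable]: "Measurable.pred M (P k)" for k unfolding P_def by measurable
  let ?I = "\<lambda>k \<omega>. if P k \<omega> then 1 else 0 :: real"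
  have b: "b k \<ge> 0" for k
  proof -
    obtain \<omega> where "\<omega> \<in> space M" using not_empty by blast
    from bd[OF this, of k] show ?thesis by linarith
  qed
  have sq: "\<bar>(D k \<omega>)\<^sup>2\<bar> \<le> (b k)\<^sup>2" if "\<omega> \<in> space M" for k \<omega>
    using power_mono[OF bd[OF that, of k] abs_ge_zero, of 2] by simp
  have i1: "integrable M (\<lambda>\<omega>. ?I k \<omega> * (D j \<omega>)\<^sup>2)" for k j
    by (rule integrable_const_bound[of _ "(b j)\<^sup>2"]) (use sq in \<open>auto intro!: AE_I2\<close>)
  have i0: "integrable M (\<lambda>\<omega>. (D j \<omega>)\<^sup>2)" for j
    by (rule integrable_const_bound[of _ "(b j)\<^sup>2"]) (use sq in \<open>auto intro!: AE_I2\<close>)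
  have i2: "integrable M (\<lambda>\<omega>. (if P k \<omega> then D k \<omega> else 0) * (D n \<omega> - D k \<omega>))" for k
  proof (rule integrable_const_bound[of _ "b k * (b n + b k)"])
    show "AE \<omega> in M. norm ((if P k \<omega> then D k \<omega> else 0) * (D n \<omega> - D k \<omega>)) \<le> b k * (b n + b k)"
    proof (rule AE_I2)
      fix \<omega> assume w: "\<omega> \<in> space M"
      have "\<bar>D n \<omega> - D k \<omega>\<bar> \<le> b n + b k" using bd[OF w, of n] bd[OF w, of k] by linarith
      then have "\<bar>if P k \<omega> then D k \<omega> else 0\<bar> * \<bar>D n \<omega> - D k \<omega>\<bar> \<le> b k * (b n + b k)"
        by (intro mult_mono) (use bd[OF w, of k] b[of k] in auto)
      then show "norm ((if P k \<omega> then D k \<omega> else 0) * (D n \<omega> - D k \<omega>)) \<le> b k * (b n + b k)"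
        by (simp only: real_norm_def abs_mult)
    qed
  qed measurable
  have k: "c\<^sup>2 * expectation (?I k) \<le> expectation (\<lambda>\<omega>. ?I k \<omega> * (D n \<omega>)\<^sup>2)" if kn: "k \<le> n" for k
  proof -
    have "c\<^sup>2 * expectation (?I k) = expectation (\<lambda>\<omega>. c\<^sup>2 * ?I k \<omega>)" by simp
    also have "\<dots> \<le> expectation (\<lambda>\<omega>. ?I k \<omega> * (D n \<omega>)\<^sup>2 - 2 * ((if P k \<omega> then D k \<omega> else 0) * (D n \<omega> - D k \<omega>)))"
    proof (rule integral_mono)
      show "integrable M (\<lambda>\<omega>. c\<^sup>2 * ?I k \<omega>)"
        by (rule integrable_const_bound[of _ "c\<^sup>2"]) (auto intro!: AE_I2)
      show "integrable M (\<lambda>\<omega>. ?I k \<omega> * (D n \<omega>)\<^sup>2 - 2 * ((if P k \<omega> then D k \<omega> else 0) * (D n \<omega> - D k \<omega>)))"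
        using i1 i2 by (intro Bochner_Integration.integrable_diff integrable_mult_right) auto
      fix \<omega> assume "\<omega> \<in> space M"
      show "c\<^sup>2 * ?I k \<omega> \<le> ?I k \<omega> * (D n \<omega>)\<^sup>2 - 2 * ((if P k \<omega> then D k \<omega> else 0) * (D n \<omega> - D k \<omega>))"
      proof (cases "P k \<omega>")
        case True
        have h1: "c\<^sup>2 \<le> (D k \<omega>)\<^sup>2" using True c by (intro abs_le_square_iff[THEN iffD1]) (auto simp: P_def)
        have h2: "(D n \<omega>)\<^sup>2 - 2 * (D k \<omega> * (D n \<omega> - D k \<omega>)) = (D k \<omega>)\<^sup>2 + (D n \<omega> - D k \<omega>)\<^sup>2"
          by (simp add: power2_eq_square algebra_simps)
        have h3: "(D n \<omega> - D k \<omega>)\<^sup>2 \<ge> 0" by simp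
        show ?thesis using h1 h2 h3 unfolding if_P[OF True] mult_1_left mult_1_right by linarith
      qed simp
    qed
    also have "\<dots> = expectation (\<lambda>\<omega>. ?I k \<omega> * (D n \<omega>)\<^sup>2)"
      using i1 i2[of k] orth[OF kn] by (simp add: P_def)
    finally show ?thesis .
  qed
  have one: "(\<Sum>k\<le>n. ?I k \<omega>) = (if \<exists>k\<le>n. c \<le> \<bar>D k \<omega>\<bar> then 1 else 0)" for \<omega>
  proof (cases "\<exists>k\<le>n. c \<le> \<bar>D k \<omega>\<bar>")
    case True
    define k0 where "k0 = (LEAST k. c \<le> \<bar>D k \<omega>\<bar>)"
    from True obtain k where "k \<le> n" "c \<le> \<bar>D k \<omega>\<bar>" by blast
    then have k0: "k0 \<le> n" "c \<le> \<bar>D k0 \<omega>\<bar>" 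
      unfolding k0_def using Least_le[of "\<lambda>k. c \<le> \<bar>D k \<omega>\<bar>" k] LeastI[of "\<lambda>k. c \<le> \<bar>D k \<omega>\<bar>" k] by auto
    have less: "\<bar>D j \<omega>\<bar> < c" if "j < k0" for j using not_less_Least[of j] that by (force simp: k0_def)
    have "P k \<omega> \<longleftrightarrow> k = k0" for k
      using k0 less by (cases k k0 rule: linorder_cases) (auto simp: P_def not_le[symmetric])
    then show ?thesis using True k0 by simp
  qed (auto simp: P_def)
  have iI: "integrable M (?I k)" for k by (rule integrable_const_bound[of _ 1]) auto
  have "c\<^sup>2 * prob {\<omega>\<in>space M. \<exists>k\<le>n. c \<le> \<bar>D k \<omega>\<bar>} = c\<^sup>2 * expectation (\<lambda>\<omega>. \<Sum>k\<le>n. ?I k \<omega>)"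
  proof -
    have "expectation (\<lambda>\<omega>. \<Sum>k\<le>n. ?I k \<omega>) = expectation (indicator {\<omega>\<in>space M. \<exists>k\<le>n. c \<le> \<bar>D k \<omega>\<bar>})"
      by (rule Bochner_Integration.integral_cong[OF refl]) (simp add: one indicator_def)
    then show ?thesis by simp
  qed
  also have "\<dots> = (\<Sum>k\<le>n. c\<^sup>2 * expectation (?I k))"
    using iI by (simp add: sum_distrib_left)
  also have "\<dots> \<le> (\<Sum>k\<le>n. expectation (\<lambda>\<omega>. ?I k \<omega> * (D n \<omega>)\<^sup>2))" by (intro sum_mono k) simp
  also have "\<dots> = expectation (\<lambda>\<omega>. \<Sum>k\<le>n. ?I k \<omega> * (D n \<omega>)\<^sup>2)" using i1 by simp
  also have "\<dots> \<le> expectation (\<lambda>\<omega>. (D n \<omega>)\<^sup>2)"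
  proof (rule integral_mono)
    show "integrable M (\<lambda>\<omega>. \<Sum>k\<le>n. ?I k \<omega> * (D n \<omega>)\<^sup>2)" using i1 by auto
    show "(\<Sum>k\<le>n. ?I k \<omega> * (D n \<omega>)\<^sup>2) \<le> (D n \<omega>)\<^sup>2" for \<omega>
      unfolding sum_distrib_right[symmetric] one by simp
  qed (rule i0)
  finally show ?thesis using c by (simp add: pos_le_divide_eq mult.commute)
qed

lemma (in prob_space) AE_summable:
  fixes f :: "nat \<Rightarrow> 'a \<Rightarrow> real"
  assumes int: "\<And>i. integrable M (f i)" and nn: "\<And>i \<omega>. f i \<omega> \<ge> 0" and sm: "summable (\<lambda>i. expectation (f i))"
  shows "AE \<omega> in M. summable (\<lambda>i. f i \<omega>)"
proof -
  have [measurable]: "f i \<in> borel_measurable M" for i using int by auto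
  have "(\<integral>\<^sup>+\<omega>. (\<Sum>i. ennreal (f i \<omega>)) \<partial>M) = (\<Sum>i. \<integral>\<^sup>+\<omega>. ennreal (f i \<omega>) \<partial>M)"
    by (rule nn_integral_suminf) measurable
  also have "\<dots> = (\<Sum>i. ennreal (expectation (f i)))"
    using int nn by (simp add: nn_integral_eq_integral)
  also have "\<dots> = ennreal (\<Sum>i. expectation (f i))"
    using sm nn by (intro suminf_ennreal2) auto
  finally have "(\<integral>\<^sup>+\<omega>. (\<Sum>i. ennreal (f i \<omega>)) \<partial>M) \<noteq> \<infinity>" by simp
  then have "AE \<omega> in M. (\<Sum>i. ennreal (f i \<omega>)) \<noteq> \<infinity>"
    by (intro nn_integral_PInf_AE) auto
  then show ?thesis
  proof eventually_elim
    case (elim \<omega>)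
    then show ?case using nn by (intro summable_suminf_not_top) auto
  qed
qed

text \<open>Borel-Cantelli leaves finitely many exceptional n, which are absorbed into the random
  constant.\<close>

lemma (in prob_space) AE_eventually_bound:
  fixes f :: "nat \<Rightarrow> 'a \<Rightarrow> real"
  assumes [measurable]: "\<And>n. f n \<in> borel_measurable M" and g: "\<And>n. n \<ge> 1 \<Longrightarrow> g n > 0"
    and P: "\<And>n. n \<ge> 1 \<Longrightarrow> prob {\<omega>\<in>space M. g n \<le> \<bar>f n \<omega>\<bar>} \<le> C / (real n)\<^sup>2"
  shows "AE \<omega> in M. \<exists>K\<ge>0. \<forall>n\<ge>1. \<bar>f n \<omega>\<bar> \<le> K * g n"
proof -
  have "AE \<omega> in M. eventually (\<lambda>n. \<omega> \<in> space M - {\<omega>\<in>space M. g n \<le> \<bar>f n \<omega>\<bar>}) sequentially"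
  proof (rule borel_cantelli_AE1)
    have "summable (\<lambda>n. C * inverse (real n ^ 2))"
      by (intro summable_mult inverse_power_summable) simp
    then show "summable (\<lambda>n. prob {\<omega>\<in>space M. g n \<le> \<bar>f n \<omega>\<bar>})"
      by (rule summable_comparison_test'[where N = 1]) (use P in \<open>simp add: divide_inverse\<close>)
  qed (auto simp: emeasure_eq_measure)
  then show ?thesis
  proof eventually_elim
    case (elim \<omega>)
    then obtain N where N: "\<And>n. n \<ge> N \<Longrightarrow> \<omega> \<in> space M - {\<omega>\<in>space M. g n \<le> \<bar>f n \<omega>\<bar>}"
      by (auto simp: eventually_sequentially)
    define K where "K = 1 + (\<Sum>n=1..N. \<bar>f n \<omega>\<bar> / g n)"
    have nn: "(\<Sum>n=1..N. \<bar>f n \<omega>\<bar> / g n) \<ge> 0" using g by (intro sum_nonneg) (auto simp: less_imp_le)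
    have "\<bar>f n \<omega>\<bar> \<le> K * g n" if n: "n \<ge> 1" for n
    proof (cases "n \<ge> N")
      case True
      then have "\<bar>f n \<omega>\<bar> < g n" using N[of n] by auto
      also have "\<dots> \<le> K * g n" using g[OF n] nn by (simp add: K_def)
      finally show ?thesis by simp
    next
      case False
      have "\<bar>f n \<omega>\<bar> / g n \<le> (\<Sum>n=1..N. \<bar>f n \<omega>\<bar> / g n)"
        using False n g by (intro member_le_sum) (auto simp: less_imp_le)
      then have "\<bar>f n \<omega>\<bar> / g n \<le> K" by (simp add: K_def)
      then show ?thesis using g[OF n] by (simp add: pos_divide_le_eq)
    qed
    moreover have "K \<ge> 0" using nn by (simp add: K_def)
    ultimately show ?case by blast
  qed
qed

text \<open>Borel-Cantelli at times 2^j and levels 2^(\<kappa> j), where the probabilities are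
  dominated by a geometric series with ratio 2^(\<beta> - 2\<kappa>). As the events concern maxima,
  they also cover the times between two powers of 2, at the cost of a factor 2^\<kappa>.\<close>

lemma (in prob_space) AE_dyadic_bound:
  fixes D :: "nat \<Rightarrow> 'a \<Rightarrow> real"
  assumes [measurable]: "\<And>k. D k \<in> borel_measurable M" and \<kappa>: "\<kappa> > 0" "\<beta> < 2 * \<kappa>"
    and P: "\<And>n c. n \<ge> 1 \<Longrightarrow> c > 0 \<Longrightarrow> prob {\<omega>\<in>space M. \<exists>k\<le>n. c \<le> \<bar>D k \<omega>\<bar>} \<le> C * real n powr \<beta> / c\<^sup>2"
  shows "AE \<omega> in M. \<exists>K\<ge>0. \<forall>n\<ge>1. \<bar>D n \<omega>\<bar> \<le> K * real n powr \<kappa>"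
proof -
  let ?c = "\<lambda>j. (2 powr \<kappa>) ^ j"
  have c: "?c j > 0" for j by simp
  have "AE \<omega> in M. eventually (\<lambda>j. \<omega> \<in> space M - {\<omega>\<in>space M. \<exists>k\<le>2 ^ j. ?c j \<le> \<bar>D k \<omega>\<bar>}) sequentially"
  proof (rule borel_cantelli_AE1)
    have sm: "summable (\<lambda>j. C * (2 powr (\<beta> - 2 * \<kappa>)) ^ j)"
    proof (intro summable_mult summable_geometric)
      have "2 powr (\<beta> - 2 * \<kappa>) < 2 powr 0" using \<kappa> by (subst powr_less_cancel_iff) auto
      then show "norm (2 powr (\<beta> - 2 * \<kappa>) :: real) < 1" by simp
    qed
    have le: "norm (prob {\<omega>\<in>space M. \<exists>k\<le>2 ^ j. ?c j \<le> \<bar>D k \<omega>\<bar>}) \<le> C * (2 powr (\<beta> - 2 * \<kappa>)) ^ j" for j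
    proof -
      have eq: "real (2 ^ j) powr \<beta> / (?c j)\<^sup>2 = (2 powr (\<beta> - 2 * \<kappa>)) ^ j"
      proof -
        have "real (2 ^ j) powr \<beta> = 2 powr (real j * \<beta>)"
          by (simp add: powr_realpow[symmetric] powr_powr)
        moreover have "(?c j)\<^sup>2 = 2 powr (real j * (2 * \<kappa>))"
          by (simp add: powr_power power_mult[symmetric] mult_ac)
        moreover have "(2 powr (\<beta> - 2 * \<kappa>)) ^ j = 2 powr (real j * (\<beta> - 2 * \<kappa>))"
          by (simp add: powr_power)
        ultimately show ?thesis by (simp only: right_diff_distrib powr_diff)
      qed
      have "(2::nat) ^ j \<ge> 1" by simp
      from P[OF this c, of j] show ?thesis unfolding times_divide_eq_right[symmetric] eq by simp
    qed
    show "summable (\<lambda>j. prob {\<omega>\<in>space M. \<exists>k\<le>2 ^ j. ?c j \<le> \<bar>D k \<omega>\<bar>})"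
      by (rule summable_comparison_test'[OF sm, of 0]) (rule le)
  qed (auto simp: emeasure_eq_measure)
  then show ?thesis
  proof eventually_elim
    case (elim \<omega>)
    then obtain N where N: "\<And>j. j \<ge> N \<Longrightarrow> \<omega> \<in> space M - {\<omega>\<in>space M. \<exists>k\<le>2 ^ j. ?c j \<le> \<bar>D k \<omega>\<bar>}"
      by (auto simp: eventually_sequentially)
    define K where "K = 2 powr \<kappa> + ?c N"
    have Kp: "K \<ge> 0" "2 powr \<kappa> \<le> K" unfolding K_def using c[of N] powr_ge_zero[of 2 \<kappa>] by linarith+
    have "\<bar>D n \<omega>\<bar> \<le> K * real n powr \<kappa>" if n: "n \<ge> 1" for n
    proof (cases "n \<le> 2 ^ N")
      case True
      have "\<not> (\<exists>k\<le>2 ^ N. ?c N \<le> \<bar>D k \<omega>\<bar>)" using N[OF order_refl] by blast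
      then have "\<bar>D n \<omega>\<bar> < ?c N" using True not_le by blast
      also have "\<dots> \<le> K * 1" unfolding K_def mult_1_right using powr_ge_zero[of 2 \<kappa>] by linarith
      also have "\<dots> \<le> K * real n powr \<kappa>" 
        using n \<kappa> Kp by (intro mult_left_mono ge_one_powr_ge_zero) auto
      finally show ?thesis by simp
    next
      case False
      define j where "j = (LEAST j. n \<le> 2 ^ j)"
      have ex: "n \<le> 2 ^ n" using less_exp[of n] by simp
      have nj: "n \<le> 2 ^ j" unfolding j_def by (rule LeastI[where P = "\<lambda>j. n \<le> 2 ^ j", OF ex])
      have jN: "j > N"
      proof (rule ccontr)
        assume "\<not> j > N"
        then have "(2::nat) ^ j \<le> 2 ^ N" by (intro power_increasing) auto
        then show False using False nj by linarith
      qed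
      then obtain i where i: "j = Suc i" by (cases j) auto
      then have "\<not> n \<le> 2 ^ i" using not_less_Least[of i "\<lambda>j. n \<le> 2 ^ j"] by (simp add: j_def)
      then have ni: "2 ^ i \<le> n" by simp
      have "\<not> (\<exists>k\<le>2 ^ j. ?c j \<le> \<bar>D k \<omega>\<bar>)" using N[of j] jN by auto
      then have "\<bar>D n \<omega>\<bar> < ?c j" using nj not_le by blast
      also have "\<dots> = 2 powr \<kappa> * real (2 ^ i) powr \<kappa>"
      proof -
        have "real (2 ^ i) powr \<kappa> = (2 powr \<kappa>) ^ i"
          by (simp add: powr_realpow[symmetric] powr_powr powr_power mult.commute)
        then show ?thesis by (simp only: i power_Suc)
      qed
      also have "\<dots> \<le> 2 powr \<kappa> * real n powr \<kappa>"
        using ni \<kappa> of_nat_mono[OF ni, where 'a = real] by (intro mult_left_mono powr_mono2) auto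
      also have "\<dots> \<le> K * real n powr \<kappa>" using Kp(2) by (intro mult_right_mono) auto
      finally show ?thesis by simp
    qed
    then show ?case using Kp(1) by blast
  qed
qed

section \<open>The martingale of corrections\<close>

context coupled_walk
begin

text \<open>The effect of overwriting on a sign, centred by its conditional mean
  \<open>a n v\<close>. The index is that of the past: \<open>dlt n\<close> belongs to step n +
  1.\<close>

definition dlt :: "nat \<Rightarrow> 'v \<Rightarrow> 'a \<Rightarrow> real" where
  "dlt n v \<omega> = X (Suc n) v \<omega> - a n v \<omega> - rad (Suc n) v \<omega>"

definition D :: "nat \<Rightarrow> 'v \<Rightarrow> 'a \<Rightarrow> real" where "D n v \<omega> = (\<Sum>j=1..<n. dlt j v \<omega>)"

text \<open>The same sum as a function on the family of all variables. Evaluated at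
  \<open>Pz m\<close>, it shows that \<open>D n v\<close> is determined by the past of any time m
  \<ge> n.\<close>

definition Df :: "nat \<Rightarrow> 'v \<Rightarrow> (bool \<times> nat \<times> 'v \<Rightarrow> real) \<Rightarrow> real" where
  "Df n v z = (\<Sum>j=1..<n. step j v (Sf j z) (z (True, Suc j, v)) (z (False, Suc j, v)) - drift B j v (Sf j z) - z (True, Suc j, v))"

lemma Df_Pz: "n \<le> m \<Longrightarrow> Df n v (Pz m \<omega>) = D n v \<omega>"
  unfolding Df_def D_def by (intro sum.cong refl) (auto simp: dlt_def X_def a_def Sf_Pz Pz_rad Pz_W)

lemma Df_measurable: "n \<le> m \<Longrightarrow> Df n v \<in> borel_measurable (PastM m)"
  unfolding Df_def[abs_def]
  by (intro borel_measurable_sum borel_measurable_diff step_measurable drift_measurable Sf_measurable coord_measurable)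
    (auto simp: Past_def)

lemma dlt_measurable[measurable]: "dlt n v \<in> borel_measurable M"
  unfolding dlt_def[abs_def] by measurable

lemma D_measurable[measurable]: "D n v \<in> borel_measurable M"
  unfolding D_def[abs_def] by measurable

lemma X_abs: "n \<ge> 1 \<Longrightarrow> \<bar>X n v \<omega>\<bar> \<le> 1"
  using X_in[of n v \<omega>] by auto

lemma dlt_le: "\<bar>dlt n v \<omega>\<bar> \<le> 3"
  using X_abs[of "Suc n" v \<omega>] a_le_1[of n v \<omega>] rad_abs[of "Suc n" v \<omega>] by (simp add: dlt_def)

lemma D_le: "\<bar>D n v \<omega>\<bar> \<le> 3 * real n"
proof -
  have "\<bar>D n v \<omega>\<bar> \<le> (\<Sum>j=1..<n. 3)"
    unfolding D_def by (rule order_trans[OF sum_abs]) (intro sum_mono dlt_le)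
  then show ?thesis by simp
qed

lemma orth_dlt:
  assumes f: "f \<in> borel_measurable (PastM n)" and bd: "\<And>\<omega>. \<omega> \<in> space M \<Longrightarrow> \<bar>f (Pz n \<omega>)\<bar> \<le> c" and n: "n \<ge> 1"
  shows "expectation (\<lambda>\<omega>. f (Pz n \<omega>) * dlt n v \<omega>) = 0"
    and "integrable M (\<lambda>\<omega>. f (Pz n \<omega>) * dlt n v \<omega>)"
proof -
  note X = orth_X[OF f bd n, of v] and R = orth_rad[OF f bd, of v]
  have eq: "f (Pz n \<omega>) * dlt n v \<omega> = f (Pz n \<omega>) * (X (Suc n) v \<omega> - a n v \<omega>) - f (Pz n \<omega>) * rad (Suc n) v \<omega>" for \<omega>
    by (simp add: dlt_def algebra_simps)
  show "integrable M (\<lambda>\<omega>. f (Pz n \<omega>) * dlt n v \<omega>)" unfolding eq using X(2) R(2) by auto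
  show "expectation (\<lambda>\<omega>. f (Pz n \<omega>) * dlt n v \<omega>) = 0"
    unfolding eq using X R by (subst Bochner_Integration.integral_diff) auto
qed

lemma dlt_sq_integrable: "integrable M (\<lambda>\<omega>. (dlt n v \<omega>)\<^sup>2)"
proof (rule integrable_bounded[of _ 9])
  show "\<bar>(dlt n v \<omega>)\<^sup>2\<bar> \<le> 9" for \<omega>
    using power_mono[OF dlt_le abs_ge_zero, of n v \<omega> 2] by simp
qed measurable

lemma D_sq_integrable: "integrable M (\<lambda>\<omega>. (D n v \<omega>)\<^sup>2)"
proof (rule integrable_bounded[of _ "(3 * real n)\<^sup>2"])
  show "\<bar>(D n v \<omega>)\<^sup>2\<bar> \<le> (3 * real n)\<^sup>2" for \<omega>
    using power_mono[OF D_le abs_ge_zero, of n v \<omega> 2] by simp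
qed measurable

lemma D_second_moment_Suc:
  assumes n: "n \<ge> 1"
  shows "expectation (\<lambda>\<omega>. (D (Suc n) v \<omega>)\<^sup>2) = expectation (\<lambda>\<omega>. (D n v \<omega>)\<^sup>2) + expectation (\<lambda>\<omega>. (dlt n v \<omega>)\<^sup>2)"
proof -
  have o: "expectation (\<lambda>\<omega>. D n v \<omega> * dlt n v \<omega>) = 0" "integrable M (\<lambda>\<omega>. D n v \<omega> * dlt n v \<omega>)"
    using orth_dlt[OF Df_measurable[OF order_refl] _ n, of v "3 * real n" v] D_le by (simp_all add: Df_Pz)
  have "(D (Suc n) v \<omega>)\<^sup>2 = (D n v \<omega>)\<^sup>2 + (dlt n v \<omega>)\<^sup>2 + 2 * (D n v \<omega> * dlt n v \<omega>)" for \<omega>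
    using n by (simp add: D_def power2_eq_square algebra_simps)
  then show ?thesis using o D_sq_integrable dlt_sq_integrable by simp
qed

lemma D_maximal:
  assumes c: "c > 0" and n: "n \<ge> 1"
  shows "prob {\<omega>\<in>space M. \<exists>k\<le>n. c \<le> \<bar>D k v \<omega>\<bar>} \<le> expectation (\<lambda>\<omega>. (D n v \<omega>)\<^sup>2) / c\<^sup>2"
proof (rule maximal_inequality[where b = "\<lambda>k. 3 * real k"])
  fix k assume k: "k \<le> n"
  \<comment> \<open>The factor that singles out k as the first crossing time. It is a function of
    the past of every j \<ge> k and hence orthogonal to each of the later increments.\<close>
  define f where "f z = (if c \<le> \<bar>Df k v z\<bar> \<and> (\<forall>j<k. \<bar>Df j v z\<bar> < c) then Df k v z else 0)" for z
  have f: "f \<in> borel_measurable (PastM j)" if "k \<le> j" for j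
  proof -
    have "{z\<in>space (PastM j). \<forall>i\<in>{..<k}. \<bar>Df i v z\<bar> < c} \<in> sets (PastM j)"
    proof (rule sets.sets_Collect_finite_All)
      fix i assume "i \<in> {..<k}"
      then have [measurable]: "Df i v \<in> borel_measurable (PastM j)" using that by (intro Df_measurable) auto
      show "{z\<in>space (PastM j). \<bar>Df i v z\<bar> < c} \<in> sets (PastM j)" by measurable
    qed simp
    moreover have Dk: "Df k v \<in> borel_measurable (PastM j)" using that by (rule Df_measurable)
    then have "{z\<in>space (PastM j). c \<le> \<bar>Df k v z\<bar>} \<in> sets (PastM j)"
      by (intro borel_measurable_le borel_measurable_const borel_measurable_abs)
    ultimately have "{z\<in>space (PastM j). c \<le> \<bar>Df k v z\<bar> \<and> (\<forall>j<k. \<bar>Df j v z\<bar> < c)} \<in> sets (PastM j)"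
      unfolding Ball_def lessThan_iff by (intro sets.sets_Collect_conj)
    then show ?thesis unfolding f_def by (rule measurable_If[OF Dk borel_measurable_const])
  qed
  have fP: "f (Pz j \<omega>) = (if c \<le> \<bar>D k v \<omega>\<bar> \<and> (\<forall>j<k. \<bar>D j v \<omega>\<bar> < c) then D k v \<omega> else 0)" if "k \<le> j" for j \<omega>
  proof -
    have "Df i v (Pz j \<omega>) = D i v \<omega>" if "i \<le> k" for i using that \<open>k \<le> j\<close> by (simp add: Df_Pz)
    then show ?thesis unfolding f_def by (metis less_imp_le order_refl)
  qed
  show "expectation (\<lambda>\<omega>. (if c \<le> \<bar>D k v \<omega>\<bar> \<and> (\<forall>j<k. \<bar>D j v \<omega>\<bar> < c) then D k v \<omega> else 0) * (D n v \<omega> - D k v \<omega>)) = 0"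
  \<comment> \<open>At k = 0 the sum \<open>D\<close> is empty and c > 0, so there is no crossing.
    The orthogonality of the increments is available from time 1 on.\<close>
  proof (cases "k = 0")
    case False
    have "D n v \<omega> - D k v \<omega> = (\<Sum>j=k..<n. dlt j v \<omega>)" for \<omega>
      using sum.atLeastLessThan_concat[of 1 k n "\<lambda>j. dlt j v \<omega>"] k False by (simp add: D_def)
    then have "expectation (\<lambda>\<omega>. (if c \<le> \<bar>D k v \<omega>\<bar> \<and> (\<forall>j<k. \<bar>D j v \<omega>\<bar> < c) then D k v \<omega> else 0) * (D n v \<omega> - D k v \<omega>))
        = expectation (\<lambda>\<omega>. \<Sum>j=k..<n. f (Pz j \<omega>) * dlt j v \<omega>)"
      unfolding \<open>\<And>\<omega>. D n v \<omega> - D k v \<omega> = (\<Sum>j=k..<n. dlt j v \<omega>)\<close> sum_distrib_left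
      by (intro Bochner_Integration.integral_cong sum.cong refl) (simp only: fP atLeastLessThan_iff)
    also have "\<dots> = (\<Sum>j=k..<n. expectation (\<lambda>\<omega>. f (Pz j \<omega>) * dlt j v \<omega>))"
      by (rule Bochner_Integration.integral_sum, rule orth_dlt(2)[OF f, of _ "3 * real k"])
        (use False D_le[of k v] in \<open>auto simp: fP\<close>)
    also have "\<dots> = 0"
      by (intro sum.neutral ballI orth_dlt(1)[OF f, of _ "3 * real k"]) (use False D_le[of k v] in \<open>auto simp: fP\<close>)
    finally show ?thesis .
  qed (use c in \<open>simp add: D_def\<close>)
qed (use c D_le in auto)

text \<open>Overwriting moves a sign by at most 2 and happens with mean probability E|a|; the
  centring adds a^2 \<le> |a|. With (p - q)^2 \<le> 2 p^2 + 2 q^2, the constant is 2 times 4 plus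
  2.\<close>

lemma dlt_second_moment: "expectation (\<lambda>\<omega>. (dlt n v \<omega>)\<^sup>2) \<le> 10 * expectation (\<lambda>\<omega>. \<bar>a n v \<omega>\<bar>)" if n: "n \<ge> 1"
proof -
  let ?F = "\<lambda>\<omega>. if W (Suc n) v \<omega> < \<bar>a n v \<omega>\<bar> then 1 else 0 :: real"
  have iF: "integrable M ?F" by (rule integrable_bounded[of _ 1]) auto
  have ia: "integrable M (\<lambda>\<omega>. \<bar>a n v \<omega>\<bar>)" by (rule integrable_bounded[of _ 1]) (use a_le_1 in auto)
  have "expectation (\<lambda>\<omega>. (dlt n v \<omega>)\<^sup>2) \<le> expectation (\<lambda>\<omega>. 8 * ?F \<omega> + 2 * \<bar>a n v \<omega>\<bar>)"
  proof (rule integral_mono[OF dlt_sq_integrable])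
    show "integrable M (\<lambda>\<omega>. 8 * ?F \<omega> + 2 * \<bar>a n v \<omega>\<bar>)" using iF ia by auto
    fix \<omega>
    let ?x = "X (Suc n) v \<omega> - rad (Suc n) v \<omega>"
    have "(p - q)\<^sup>2 \<le> 2 * p\<^sup>2 + 2 * q\<^sup>2" for p q :: real
      using zero_le_power2[of "p + q"] by (simp add: power2_eq_square algebra_simps)
    moreover have "dlt n v \<omega> = ?x - a n v \<omega>" by (simp add: dlt_def)
    ultimately have "(dlt n v \<omega>)\<^sup>2 \<le> 2 * ?x\<^sup>2 + 2 * (a n v \<omega>)\<^sup>2" by simp
    also have "?x\<^sup>2 \<le> 4 * ?F \<omega>"
    proof (cases "W (Suc n) v \<omega> < \<bar>a n v \<omega>\<bar>")
      case True
      have "\<bar>?x\<bar> \<le> 2" using X_abs[of "Suc n" v \<omega>] rad_abs[of "Suc n" v \<omega>] by linarith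
      from power_mono[OF this abs_ge_zero, of 2] show ?thesis using True by simp
    next
      case False
      then have "?x = 0" using n by (simp add: X_def step_def a_def)
      then show ?thesis using False by simp
    qed
    also have "(a n v \<omega>)\<^sup>2 \<le> \<bar>a n v \<omega>\<bar>"
      using mult_left_le[OF a_le_1[of n v \<omega>] abs_ge_zero[of "a n v \<omega>"]] by (simp add: power2_eq_square abs_mult[symmetric])
    finally show "(dlt n v \<omega>)\<^sup>2 \<le> 8 * ?F \<omega> + 2 * \<bar>a n v \<omega>\<bar>" by simp
  qed
  also have "\<dots> = 10 * expectation (\<lambda>\<omega>. \<bar>a n v \<omega>\<bar>)"
    using iF ia flip_expectation[of n v] by simp
  finally show ?thesis .
qed

end

section \<open>Almost sure bounds\<close>

lemma pow_powr: "x > 0 \<Longrightarrow> (x ^ a) powr b = x powr (real a * b)" for x :: real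
  by (simp add: powr_powr flip: powr_realpow)

text \<open>Bernoulli's inequality for the 16th power of 1 - 1/(i+1).\<close>

lemma bsize_le: "real (bsize i) \<le> 16 * real (Suc i) ^ 15"
proof -
  let ?x = "real (Suc i)"
  have x: "?x > 0" by simp
  have "1 + real 16 * (- 1 / ?x) \<le> (1 + (- 1 / ?x)) ^ 16" by (rule Bernoulli_inequality) simp
  then have "?x ^ 16 * (1 - 16 / ?x) \<le> ?x ^ 16 * (1 - 1 / ?x) ^ 16"
    by (intro mult_left_mono) simp_all
  also have "\<dots> = (?x * (1 - 1 / ?x)) ^ 16" by (simp only: power_mult_distrib)
  also have "?x * (1 - 1 / ?x) = real i" by (simp add: field_simps)
  also have "?x ^ 16 * (1 - 16 / ?x) = ?x ^ 16 - 16 * ?x ^ 15"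
  proof -
    have "?x ^ 16 = ?x * ?x ^ 15" by (subst power_Suc[symmetric]) simp
    then show ?thesis using x by (simp add: right_diff_distrib)
  qed
  finally have "?x ^ 16 - real i ^ 16 \<le> 16 * ?x ^ 15" by simp
  moreover have "real (bsize i) = ?x ^ 16 - real i ^ 16"
    unfolding bsize_def using pow16_less[of i] by (subst of_nat_diff) (simp_all only: of_nat_power less_imp_le)
  ultimately show ?thesis by simp
qed

lemma sum_blk_eq: "(\<Sum>j=1..I ^ 16. f j) = (\<Sum>i<I. \<Sum>j\<in>blk i. f j)" for f :: "nat \<Rightarrow> real"
proof (induction I)
  case (Suc I)
  have "{1..Suc I ^ 16} = {1..I ^ 16} \<union> blk I" using pow16_less[of I] by (auto simp: blk_def)
  moreover have "{1..I ^ 16} \<inter> blk I = {}" by (auto simp: blk_def)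
  ultimately have "(\<Sum>j=1..Suc I ^ 16. f j) = (\<Sum>j=1..I ^ 16. f j) + (\<Sum>j\<in>blk I. f j)"
    by (simp add: sum.union_disjoint finite_blk)
  then show ?case using Suc by simp
qed simp

text \<open>The unfinished block at time n: the coupling matches the two sums only over complete
  blocks.\<close>

definition inblk :: "nat \<Rightarrow> nat set" where "inblk n = {bidx n ^ 16<..n}"

lemma bidx_pow_less: "n \<ge> 1 \<Longrightarrow> bidx n ^ 16 < n"
  using in_blk_bidx[of n] by (simp add: blk_def)

lemma inblk_nonempty: "n \<ge> 1 \<Longrightarrow> inblk n \<noteq> {}"
  using bidx_pow_less[of n] by (auto simp: inblk_def)

lemma finite_inblk: "finite (inblk n)" by (simp add: inblk_def)

lemma inblk_ge_1: "inblk n \<subseteq> {1..}" by (auto simp: inblk_def)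

text \<open>The constant is 16 times 2^15, from \<open>bsize_le\<close> and i + 1 \<le> 2 i. This
  last inequality fails for block 0, which has length 1.\<close>

lemma card_inblk_le:
  assumes n: "n \<ge> 1" shows "real (card (inblk n)) \<le> 2 ^ 19 * real n powr (15 / 16)"
proof -
  let ?i = "bidx n"
  have "inblk n \<subseteq> blk ?i" using in_blk_bidx[OF n] by (auto simp: inblk_def blk_def)
  then have c: "card (inblk n) \<le> bsize ?i" using card_mono[OF finite_blk] by (simp add: card_blk[symmetric])
  show ?thesis
  proof (cases "?i = 0")
    case True
    have "real (card (inblk n)) \<le> 1" using c by (simp add: True bsize_def)
    also have "1 \<le> real n powr (15 / 16)" using n by (intro ge_one_powr_ge_zero) auto
    also have "\<dots> \<le> 2 ^ 19 * real n powr (15 / 16)" by simp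
    finally show ?thesis .
  next
    case False
    then have i: "real ?i > 0" "real (Suc ?i) \<le> 2 * real ?i" by auto
    have "real (card (inblk n)) \<le> 16 * real (Suc ?i) ^ 15" using c bsize_le[of ?i] by linarith
    also have "\<dots> \<le> 16 * (2 * real ?i) ^ 15" using i by (intro mult_left_mono power_mono) auto
    also have "\<dots> = 2 ^ 19 * real ?i ^ 15" by (simp add: power_mult_distrib)
    also have "real ?i ^ 15 = (real ?i ^ 16) powr (15 / 16)"
      using pow_powr[OF i(1), of 16 "15 / 16"] i by simp
    also have "\<dots> \<le> real n powr (15 / 16)"
    proof (rule powr_mono2)
      have "real (?i ^ 16) \<le> real n" using bidx_pow_less[OF n] by linarith
      then show "real ?i ^ 16 \<le> real n" by simp
    qed auto
    finally show ?thesis by simp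
  qed
qed

lemma sum_split_blk:
  fixes f :: "nat \<Rightarrow> real"
  assumes n: "n \<ge> 1"
  shows "(\<Sum>j=1..n. f j) = (\<Sum>i<bidx n. \<Sum>j\<in>blk i. f j) + (\<Sum>j\<in>inblk n. f j)"
proof -
  have "{1..n} = {1..bidx n ^ 16} \<union> inblk n" "{1..bidx n ^ 16} \<inter> inblk n = {}"
    using bidx_pow_less[OF n] by (auto simp: inblk_def)
  then have "(\<Sum>j=1..n. f j) = (\<Sum>j=1..bidx n ^ 16. f j) + (\<Sum>j\<in>inblk n. f j)"
    by (simp add: sum.union_disjoint finite_inblk)
  then show ?thesis by (simp only: sum_blk_eq)
qed

text \<open>One term of the exponential series. It brings Hoeffding's bound to the polynomial form
  of the moment bound in \<open>normal_tail\<close>.\<close>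

lemma exp_minus_le:
  fixes x :: real assumes "x > 0" shows "exp (- x) \<le> fact k / x ^ k"
proof -
  have "x ^ k /\<^sub>R fact k \<le> exp x"
    using exp_lower_Taylor_quadratic[of x] sum_le_suminf[OF summable_exp_generic[of x], of "{k}"] assms
    by (simp add: exp_def)
  then have "x ^ k \<le> fact k * exp x" by (simp add: field_simps)
  then show ?thesis using assms by (simp add: exp_minus field_simps)
qed

context coupling_base
begin

lemma rad_indep: "I \<subseteq> {1..} \<Longrightarrow> indep_vars (\<lambda>_. borel) (\<lambda>j. rad j v) I"
proof -
  assume I: "I \<subseteq> {1..}"
  have "indep_vars (\<lambda>_. borel) (\<lambda>j. Z (True, j, v)) I"
    by (rule indep_vars_reindex_inj[OF Z_indep]) (use I in \<open>auto simp: inj_on_def\<close>)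
  moreover have "Z (True, j, v) = rad j v" for j by (rule ext) (simp add: Z_def)
  ultimately show ?thesis by simp
qed

lemma rad_tail:
  assumes I: "I \<subseteq> {1..}" "finite I" "I \<noteq> {}" and t: "t > 0"
  shows "prob {\<omega>\<in>space M. t \<le> \<bar>\<Sum>j\<in>I. rad j v \<omega>\<bar>} \<le> 2 * (fact k * (2 * real (card I)) ^ k / t ^ (2 * k))"
proof -
  interpret H: Hoeffding_ineq M I "\<lambda>j. rad j v" "\<lambda>_. - 1" "\<lambda>_. 1" "\<Sum>j\<in>I. expectation (rad j v)"
  proof unfold_locales
    show "indep_vars (\<lambda>_. borel) (\<lambda>j. rad j v) I" by (rule rad_indep) fact
    fix j assume "j \<in> I"
    then have "j \<ge> 1" using I by auto
    then show "AE \<omega> in M. rad j v \<omega> \<in> {- 1..1}" using rad_abs[of j v] by (auto simp: abs_le_iff minus_le_iff)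
  qed (use I in auto)
  have mean: "(\<Sum>j\<in>I. expectation (rad j v)) = 0" using I by (intro sum.neutral) (auto simp: rad_expectation)
  have m: "card I > 0" using I by (simp add: card_gt_0_iff)
  let ?x = "t\<^sup>2 / (2 * real (card I))"
  have x: "?x > 0" using m t by simp
  have "prob {\<omega>\<in>space M. t \<le> \<bar>\<Sum>j\<in>I. rad j v \<omega>\<bar>} \<le> 2 * exp (- 2 * t\<^sup>2 / (\<Sum>j\<in>I. (1 - - 1)\<^sup>2))"
    using H.Hoeffding_ineq_abs_ge[of t] t m by (simp add: mean)
  also have "- 2 * t\<^sup>2 / (\<Sum>j\<in>I. (1 - - 1)\<^sup>2) = - ?x" by simp
  also have "2 * exp (- ?x) \<le> 2 * (fact k / ?x ^ k)" using exp_minus_le[OF x, of k] by simp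
  also have "fact k / ?x ^ k = fact k * (2 * real (card I)) ^ k / t ^ (2 * k)"
    by (simp add: power_divide power_mult)
  finally show ?thesis .
qed

lemma normal_tail:
  assumes I: "finite I" "I \<noteq> {}" and t: "t > 0"
  shows "prob {\<omega>\<in>space M. t \<le> \<bar>\<Sum>j\<in>I. y (True, j, v) \<omega>\<bar>} \<le> fact (2 * k) / (2 ^ k * fact k) * real (card I) ^ k / t ^ (2 * k)"
proof -
  let ?G = "\<lambda>\<omega>. \<Sum>j\<in>I. y (True, j, v) \<omega>" and ?m = "real (card I)"
  have m: "?m > 0" using I by (simp add: card_gt_0_iff)
  have d: "distributed M lborel ?G (normal_density 0 (sqrt ?m))"
    by (rule block_signs_coupling(1)[OF I indep_block y_normal])
  have Gm[measurable]: "?G \<in> borel_measurable M" by measurable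
  have hb: "has_bochner_integral lborel (\<lambda>x. normal_density 0 (sqrt ?m) x * x ^ (2 * k)) (fact (2 * k) / ((2 / (sqrt ?m)\<^sup>2) ^ k * fact k))"
    using normal_moment_even[of "sqrt ?m" 0 k] m by simp
  have dd: "distr M lborel ?G = density lborel (normal_density 0 (sqrt ?m))" using d by (simp add: distributed_def)
  have int: "integrable M (\<lambda>\<omega>. ?G \<omega> ^ (2 * k))"
  proof -
    have "integrable (density lborel (normal_density 0 (sqrt ?m))) (\<lambda>x. x ^ (2 * k))"
      using hb by (subst integrable_real_density) (auto simp: has_bochner_integral_iff)
    then have "integrable (distr M lborel ?G) (\<lambda>x. x ^ (2 * k))" by (simp only: dd)
    then show ?thesis by (subst (asm) integrable_distr_eq) auto
  qed
  have ex: "expectation (\<lambda>\<omega>. ?G \<omega> ^ (2 * k)) = fact (2 * k) / (2 ^ k * fact k) * ?m ^ k"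
  proof -
    have "expectation (\<lambda>\<omega>. ?G \<omega> ^ (2 * k)) = (\<integral>x. x ^ (2 * k) \<partial>distr M lborel ?G)"
      by (rule integral_distr[symmetric]) auto
    also have "\<dots> = (\<integral>x. normal_density 0 (sqrt ?m) x * x ^ (2 * k) \<partial>lborel)"
      unfolding dd by (subst integral_real_density) auto
    also have "\<dots> = fact (2 * k) / ((2 / (sqrt ?m)\<^sup>2) ^ k * fact k)"
      using hb by (rule has_bochner_integral_integral_eq)
    also have "\<dots> = fact (2 * k) / (2 ^ k * fact k) * ?m ^ k" using m by (simp add: power_divide)
    finally show ?thesis .
  qed
  have "prob {\<omega>\<in>space M. t \<le> \<bar>?G \<omega>\<bar>} \<le> prob {\<omega>\<in>space M. t ^ (2 * k) \<le> ?G \<omega> ^ (2 * k)}"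
  proof (rule finite_measure_mono)
    show "{\<omega>\<in>space M. t \<le> \<bar>?G \<omega>\<bar>} \<subseteq> {\<omega>\<in>space M. t ^ (2 * k) \<le> ?G \<omega> ^ (2 * k)}"
    proof (intro Collect_mono impI conjI; elim conjE)
      fix \<omega> assume "t \<le> \<bar>?G \<omega>\<bar>"
      then have "t ^ (2 * k) \<le> \<bar>?G \<omega>\<bar> ^ (2 * k)" using t by (intro power_mono) auto
      then show "t ^ (2 * k) \<le> ?G \<omega> ^ (2 * k)" by (simp add: power_even_abs)
    qed auto
  qed measurable
  also have "\<dots> \<le> expectation (\<lambda>\<omega>. ?G \<omega> ^ (2 * k)) / t ^ (2 * k)"
    by (rule integral_Markov_inequality_measure[where A = "space M"]) (use int t in auto)
  finally show ?thesis by (simp only: ex)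
qed

text \<open>Why the moment of order 128 is taken: the 64th power of the block length is of order
  n^60, since 64 times 15/16 is 60, and the 128th power of the level n^(31/64) is n^62. The quotient
  n^(-2) is summable.\<close>

lemma card_pow_le:
  assumes n: "n \<ge> 1"
  shows "(c * real (card (inblk n))) ^ 64 / (real n powr (31 / 64)) ^ (2 * 64) \<le> (\<bar>c\<bar> * 2 ^ 19) ^ 64 / (real n)\<^sup>2"
proof -
  have "(c * real (card (inblk n))) ^ 64 \<le> (\<bar>c\<bar> * (2 ^ 19 * real n powr (15 / 16))) ^ 64"
  proof -
    have "(c * real (card (inblk n))) ^ 64 = (\<bar>c\<bar> * real (card (inblk n))) ^ 64" by (simp add: power_mult_distrib)
    also have "\<dots> \<le> (\<bar>c\<bar> * (2 ^ 19 * real n powr (15 / 16))) ^ 64"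
      by (intro power_mono mult_left_mono card_inblk_le n) auto
    finally show ?thesis .
  qed
  also have "\<dots> = (\<bar>c\<bar> * 2 ^ 19) ^ 64 * (real n powr (15 / 16)) ^ 64" by (simp only: power_mult_distrib mult.assoc)
  also have "(real n powr (15 / 16)) ^ 64 = real n powr 60" using n by (simp add: powr_power)
  finally have "(c * real (card (inblk n))) ^ 64 / (real n powr (31 / 64)) ^ (2 * 64) \<le> (\<bar>c\<bar> * 2 ^ 19) ^ 64 * real n powr 60 / (real n powr (31 / 64)) ^ (2 * 64)"
    by (rule divide_right_mono) simp
  also have e62: "(real n powr (31 / 64)) ^ (2 * 64) = real n powr 62" using n by (simp add: powr_power)
  also have "(\<bar>c\<bar> * 2 ^ 19) ^ 64 * real n powr 60 / real n powr 62 = (\<bar>c\<bar> * 2 ^ 19) ^ 64 * (real n powr 60 / real n powr 62)"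
    by (simp only: times_divide_eq_right)
  also have "real n powr 60 / real n powr 62 = 1 / (real n)\<^sup>2"
  proof -
    have "real n powr 62 = real n powr 60 * real n powr 2" by (simp only: powr_add[symmetric]) simp
    moreover have "real n powr 60 \<noteq> 0" using n by simp
    ultimately have "real n powr 60 / real n powr 62 = 1 / real n powr 2"
      by (metis nonzero_divide_mult_cancel_left)
    then show ?thesis by simp
  qed
  finally show ?thesis unfolding e62 by (simp only: times_divide_eq_right mult_1_right)
qed

section \<open>Almost sure distance between signs and normal variables\<close>

lemma rad_inblk_AE: "AE \<omega> in M. \<exists>K\<ge>0. \<forall>n\<ge>1. \<bar>\<Sum>j\<in>inblk n. rad j v \<omega>\<bar> \<le> K * real n powr (31 / 64)"
proof (rule AE_eventually_bound)
  fix n :: nat assume n: "n \<ge> 1"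
  then have t: "real n powr (31 / 64) > 0" by simp
  have "prob {\<omega>\<in>space M. real n powr (31 / 64) \<le> \<bar>\<Sum>j\<in>inblk n. rad j v \<omega>\<bar>} \<le> 2 * (fact 64 * (2 * real (card (inblk n))) ^ 64 / (real n powr (31 / 64)) ^ (2 * 64))"
    by (rule rad_tail[OF inblk_ge_1 finite_inblk inblk_nonempty[OF n] t])
  also have "\<dots> = (2 * fact 64) * ((2 * real (card (inblk n))) ^ 64 / (real n powr (31 / 64)) ^ (2 * 64))" by (simp only: times_divide_eq_right mult.assoc)
  also have "\<dots> \<le> (2 * fact 64) * ((\<bar>2\<bar> * 2 ^ 19) ^ 64 / (real n)\<^sup>2)"
    by (rule mult_left_mono[OF card_pow_le[OF n]]) (rule mult_nonneg_nonneg, simp, rule fact_ge_zero)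
  finally show "prob {\<omega>\<in>space M. real n powr (31 / 64) \<le> \<bar>\<Sum>j\<in>inblk n. rad j v \<omega>\<bar>} \<le> (2 * fact 64) * (\<bar>2\<bar> * 2 ^ 19) ^ 64 / (real n)\<^sup>2"
    by (simp only: times_divide_eq_right)
qed auto

lemma normal_inblk_AE: "AE \<omega> in M. \<exists>K\<ge>0. \<forall>n\<ge>1. \<bar>\<Sum>j\<in>inblk n. y (True, j, v) \<omega>\<bar> \<le> K * real n powr (31 / 64)"
proof (rule AE_eventually_bound)
  fix n :: nat assume n: "n \<ge> 1"
  then have t: "real n powr (31 / 64) > 0" by simp
  define C where "C = (fact (2 * 64) / (2 ^ 64 * fact 64) :: real)"
  have C: "C \<ge> 0" unfolding C_def by (rule divide_nonneg_nonneg) (rule fact_ge_zero, rule mult_nonneg_nonneg, simp, rule fact_ge_zero)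
  have "prob {\<omega>\<in>space M. real n powr (31 / 64) \<le> \<bar>\<Sum>j\<in>inblk n. y (True, j, v) \<omega>\<bar>} \<le> C * real (card (inblk n)) ^ 64 / (real n powr (31 / 64)) ^ (2 * 64)"
    unfolding C_def by (rule normal_tail[OF finite_inblk inblk_nonempty[OF n] t])
  also have "\<dots> = C * ((1 * real (card (inblk n))) ^ 64 / (real n powr (31 / 64)) ^ (2 * 64))" by (simp only: times_divide_eq_right mult_1_left)
  also have "\<dots> \<le> C * ((\<bar>1\<bar> * 2 ^ 19) ^ 64 / (real n)\<^sup>2)"
    by (rule mult_left_mono[OF card_pow_le[OF n] C])
  finally show "prob {\<omega>\<in>space M. real n powr (31 / 64) \<le> \<bar>\<Sum>j\<in>inblk n. y (True, j, v) \<omega>\<bar>} \<le> (fact (2 * 64) / (2 ^ 64 * fact 64)) * (\<bar>1\<bar> * 2 ^ 19) ^ 64 / (real n)\<^sup>2"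
    unfolding C_def by (simp only: times_divide_eq_right)
qed auto

text \<open>Block i costs O(i^5) in the mean, so the costs divided by (i+1)^7 have a finite expected
  sum. The series then converges almost surely, and multiplying back by the largest weight bounds
  the partial sums.\<close>

lemma block_diff_AE:
  "AE \<omega> in M. \<exists>K\<ge>0. \<forall>I. (\<Sum>i<I. \<bar>bsum i v \<omega> - (\<Sum>n\<in>blk i. rad n v \<omega>)\<bar>) \<le> K * real I ^ 7"
proof -
  let ?d = "\<lambda>i \<omega>. \<bar>bsum i v \<omega> - (\<Sum>n\<in>blk i. rad n v \<omega>)\<bar>"
  have int: "integrable M (?d i)" for i
    using bsum_coupling(2)[of i v] by (simp add: sum_rad_blk)
  have ex: "expectation (?d i) \<le> 3 * w1_const * real (Suc i) ^ 5" for i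
  proof -
    \<comment> \<open>The constant 16 is rounded up to 27 to make the cube root explicit.\<close>
    have "real (bsize i) powr (1/3) \<le> (27 * real (Suc i) ^ 15) powr (1/3)"
      using bsize_le[of i] by (intro powr_mono2) (auto intro: order_trans)
    also have "27 * real (Suc i) ^ 15 = (3 * real (Suc i) ^ 5) ^ 3" by (simp only: power_mult_distrib power_mult[symmetric]) simp
    also have "((3 * real (Suc i) ^ 5) ^ 3) powr (1/3) = 3 * real (Suc i) ^ 5"
      using pow_powr[of "3 * real (Suc i) ^ 5" 3 "1 / 3"] by (simp del: of_nat_Suc)
    finally have "real (bsize i) powr (1/3) \<le> 3 * real (Suc i) ^ 5" .
    from mult_left_mono[OF this w1_const_nonneg]
    have "w1_const * real (bsize i) powr (1/3) \<le> 3 * w1_const * real (Suc i) ^ 5" by (simp add: mult_ac)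
    moreover have "expectation (?d i) \<le> w1_const * real (bsize i) powr (1/3)"
      using bsum_coupling(3)[of i v] by (simp add: sum_rad_blk)
    ultimately show ?thesis by linarith
  qed
  have "AE \<omega> in M. summable (\<lambda>i. ?d i \<omega> / real (Suc i) ^ 7)"
  proof (rule AE_summable)
    show "integrable M (\<lambda>\<omega>. ?d i \<omega> / real (Suc i) ^ 7)" for i using int by simp
    have "summable (\<lambda>i. inverse (real (Suc i) ^ 2))"
      using inverse_power_summable[of 2] by (subst summable_Suc_iff[of "\<lambda>i. inverse (real i ^ 2)"]) simp
    then have sm: "summable (\<lambda>i. 3 * w1_const * inverse (real (Suc i) ^ 2))" by (rule summable_mult)
    show "summable (\<lambda>i. expectation (\<lambda>\<omega>. ?d i \<omega> / real (Suc i) ^ 7))"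
    proof (rule summable_comparison_test'[OF sm, of 0])
      fix i
      have "expectation (\<lambda>\<omega>. ?d i \<omega> / real (Suc i) ^ 7) = expectation (?d i) / real (Suc i) ^ 7" by simp
      also have "\<dots> \<le> 3 * w1_const * real (Suc i) ^ 5 / real (Suc i) ^ 7" by (intro divide_right_mono ex) simp
      also have "\<dots> = 3 * w1_const * inverse (real (Suc i) ^ 2)"
      proof -
        have "real (Suc i) ^ 7 = real (Suc i) ^ 5 * real (Suc i) ^ 2" by (simp only: power_add[symmetric]) simp
        moreover have "c * a / (a * b) = c * inverse b" if "a \<noteq> 0" for a b c :: real
          using that by (simp add: divide_inverse)
        ultimately show ?thesis by (metis power_not_zero of_nat_eq_0_iff nat.distinct(2))
      qed
      finally show "norm (expectation (\<lambda>\<omega>. ?d i \<omega> / real (Suc i) ^ 7)) \<le> 3 * w1_const * inverse (real (Suc i) ^ 2)" by simp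
    qed
  qed simp
  then show ?thesis
  proof eventually_elim
    case (elim \<omega>)
    define K where "K = (\<Sum>i. ?d i \<omega> / real (Suc i) ^ 7)"
    have "K \<ge> 0" unfolding K_def by (rule suminf_nonneg[OF elim]) simp
    moreover have "(\<Sum>i<I. ?d i \<omega>) \<le> K * real I ^ 7" for I
    proof -
      have "(\<Sum>i<I. ?d i \<omega>) \<le> (\<Sum>i<I. ?d i \<omega> / real (Suc i) ^ 7 * real I ^ 7)"
      proof (rule sum_mono)
        fix i assume "i \<in> {..<I}"
        then have "real (Suc i) ^ 7 \<le> real I ^ 7" by (intro power_mono) auto
        from mult_left_mono[OF this, of "?d i \<omega> / real (Suc i) ^ 7"]
        show "?d i \<omega> \<le> ?d i \<omega> / real (Suc i) ^ 7 * real I ^ 7" by (simp del: of_nat_Suc)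
      qed
      also have "\<dots> \<le> K * real I ^ 7"
        unfolding sum_distrib_right[symmetric] K_def
        by (intro mult_right_mono sum_le_suminf[OF elim]) auto
      finally show ?thesis .
    qed
    ultimately show ?case by blast
  qed
qed

text \<open>Complete blocks contribute the coupling costs, of order i^7 \<le> n^(7/16) for i =
  \<open>bidx n\<close>. In the unfinished block the two sums are bounded separately.\<close>

lemma rad_normal_AE:
  "AE \<omega> in M. \<exists>K\<ge>0. \<forall>n\<ge>1. \<bar>\<Sum>j=1..n. rad j v \<omega> - y (True, j, v) \<omega>\<bar> \<le> K * real n powr (31 / 64)"
  using rad_inblk_AE[of v] normal_inblk_AE[of v] block_diff_AE[of v]
proof eventually_elim
  case (elim \<omega>)
  obtain K1 where K1: "K1 \<ge> 0" "\<And>n. n \<ge> 1 \<Longrightarrow> \<bar>\<Sum>j\<in>inblk n. rad j v \<omega>\<bar> \<le> K1 * real n powr (31 / 64)" using elim(1) by blast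
  obtain K2 where K2: "K2 \<ge> 0" "\<And>n. n \<ge> 1 \<Longrightarrow> \<bar>\<Sum>j\<in>inblk n. y (True, j, v) \<omega>\<bar> \<le> K2 * real n powr (31 / 64)" using elim(2) by blast
  obtain K3 where K3: "K3 \<ge> 0" "\<And>I. (\<Sum>i<I. \<bar>bsum i v \<omega> - (\<Sum>n\<in>blk i. rad n v \<omega>)\<bar>) \<le> K3 * real I ^ 7" using elim(3) by blast
  have "\<bar>\<Sum>j=1..n. rad j v \<omega> - y (True, j, v) \<omega>\<bar> \<le> (K1 + K2 + K3) * real n powr (31 / 64)" if n: "n \<ge> 1" for n
  proof -
    let ?i = "bidx n"
    have 1: "\<bar>\<Sum>i<?i. \<Sum>j\<in>blk i. rad j v \<omega> - y (True, j, v) \<omega>\<bar> \<le> K3 * real ?i ^ 7"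
    proof -
      have "\<bar>\<Sum>i<?i. \<Sum>j\<in>blk i. rad j v \<omega> - y (True, j, v) \<omega>\<bar> \<le> (\<Sum>i<?i. \<bar>\<Sum>j\<in>blk i. rad j v \<omega> - y (True, j, v) \<omega>\<bar>)"
        by (rule sum_abs)
      also have "\<dots> = (\<Sum>i<?i. \<bar>bsum i v \<omega> - (\<Sum>n\<in>blk i. rad n v \<omega>)\<bar>)"
        by (intro sum.cong refl) (simp add: sum_subtractf bsum_def abs_minus_commute)
      finally show ?thesis using K3(2)[of ?i] by linarith
    qed
    have "real ?i ^ 7 \<le> real n powr (31 / 64)"
    proof (cases "?i = 0")
      case False
      have "real ?i ^ 7 = (real ?i ^ 16) powr (7 / 16)" using pow_powr[of "real ?i" 16 "7 / 16"] False by simp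
      also have "\<dots> \<le> real n powr (7 / 16)"
      proof (rule powr_mono2)
        have "real (?i ^ 16) \<le> real n" using bidx_pow_less[OF n] by linarith
        then show "real ?i ^ 16 \<le> real n" by simp
      qed auto
      also have "\<dots> \<le> real n powr (31 / 64)" using n by (intro powr_mono) auto
      finally show ?thesis .
    qed simp
    from mult_left_mono[OF this K3(1)] have 2: "K3 * real ?i ^ 7 \<le> K3 * real n powr (31 / 64)" .
    have "(\<Sum>j=1..n. rad j v \<omega> - y (True, j, v) \<omega>) = (\<Sum>i<?i. \<Sum>j\<in>blk i. rad j v \<omega> - y (True, j, v) \<omega>)
        + (\<Sum>j\<in>inblk n. rad j v \<omega>) - (\<Sum>j\<in>inblk n. y (True, j, v) \<omega>)"
      unfolding sum_split_blk[OF n] by (simp add: sum_subtractf)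
    then show ?thesis using 1 2 K1(2)[OF n] K2(2)[OF n] unfolding distrib_right by linarith
  qed
  then show ?case using K1(1) K2(1) K3(1) by (intro exI[of _ "K1 + K2 + K3"]) auto
qed

end

section \<open>Second moments of the walk\<close>

lemma pair_col_measurable: "(\<lambda>y. pair_col y c) \<in> borel_measurable borel"
  using linear_pair_col[of c] by (intro borel_measurable_continuous_onI linear_continuous_on) (simp add: linear_conv_bounded_linear)

lemma one_plus_powr_three_halves:
  fixes x :: real assumes x: "x \<ge> 0" shows "1 + 3 / 2 * x \<le> (1 + x) powr (3 / 2)"
proof -
  have "(1 + 3 / 2 * x)\<^sup>2 \<le> (1 + x) ^ 3"
    using x by (simp add: power2_eq_square power3_eq_cube algebra_simps)
  also have "(1 + x) ^ 3 = ((1 + x) powr (3 / 2))\<^sup>2" using x by (simp add: powr_power)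
  finally show ?thesis by (rule power2_le_imp_le) simp
qed

text \<open>In 1 + 2 Re l / n + |l|^2 / n^2 the middle term is at most 1/n, and the condition on n
  bounds the last one by 1/(2n). The exponent 3/2 stays strictly above 1, the exponent of the
  accumulated noise variance, even for Re l = 1/2, as \<open>growth_bound\<close> requires.\<close>

lemma norm_one_plus_sq_le:
  assumes n: "n \<ge> 1" and l: "Re l \<le> 1 / 2" and n2: "2 * (norm l)\<^sup>2 \<le> real n"
  shows "(norm (1 + l / of_nat n))\<^sup>2 \<le> (1 + 1 / real n) powr (3 / 2)"
proof -
  have "(norm (1 + l / of_nat n))\<^sup>2 = (1 + Re l / real n)\<^sup>2 + (Im l / real n)\<^sup>2"
    by (simp add: cmod_power2)
  also have "\<dots> = 1 + 2 * Re l / real n + (norm l)\<^sup>2 / (real n)\<^sup>2"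
    using n cmod_power2[of l] by (simp add: power2_eq_square field_simps)
  also have "2 * Re l / real n \<le> 1 / real n" using l n by (intro divide_right_mono) auto
  also have "(norm l)\<^sup>2 / (real n)\<^sup>2 \<le> (1 / 2) / real n"
    using n n2 by (simp add: power2_eq_square field_simps)
  finally have "(norm (1 + l / of_nat n))\<^sup>2 \<le> 1 + 3 / 2 * (1 / real n)" by simp
  also have "\<dots> \<le> (1 + 1 / real n) powr (3 / 2)" by (rule one_plus_powr_three_halves) simp
  finally show ?thesis .
qed

lemma norm_add_sq:
  fixes z w :: complex
  shows "(norm (z + w))\<^sup>2 = (norm z)\<^sup>2 + (norm w)\<^sup>2 + 2 * Re (cnj w * z)"
  unfolding cmod_power2 by (simp add: power2_eq_square algebra_simps)

context coupled_walk
begin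

lemma S_rec:
  assumes n: "n \<ge> 1"
  shows "S (Suc n) \<omega> = S n \<omega> + (1 / real n) *\<^sub>R (S n \<omega> v* B) + (\<chi> v. X (Suc n) v \<omega> - a n v \<omega>)"
  using n by (simp add: S_Suc vec_eq_iff a_def drift_def)

lemma norm_S_le: "norm (S n \<omega>) \<le> real CARD('v) * real n"
proof -
  have "norm (S n \<omega>) \<le> (\<Sum>v\<in>UNIV. \<bar>S n \<omega> $ v\<bar>)" by (rule norm_le_l1_cart)
  also have "\<dots> \<le> (\<Sum>v\<in>(UNIV :: 'v set). real n)" by (intro sum_mono S_nth_le)
  finally show ?thesis by simp
qed

lemma pair_S_measurable[measurable]: "(\<lambda>\<omega>. pair_col (S n \<omega>) c) \<in> borel_measurable M"
  by (rule measurable_compose[OF S_measurable pair_col_measurable])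

text \<open>Along an eigenvector the walk is multiplied by 1 + l/n and receives bounded noise. In
  the second moment the cross term vanishes, because coordinate by coordinate it is a function of
  the past times a martingale difference.\<close>

lemma pair_S_moment:
  assumes eig: "eigcol B c l" and l: "Re l \<le> 1 / 2"
  shows "\<exists>K\<ge>0. \<forall>n\<ge>1. expectation (\<lambda>\<omega>. (norm (pair_col (S n \<omega>) c))\<^sup>2) \<le> K * real n powr (3 / 2)"
proof -
  obtain L where L: "L \<ge> 0" "\<And>x. norm (pair_col x c) \<le> L * norm x" using norm_pair_col_le by blast
  let ?N = "real CARD('v)"
  have pS: "norm (pair_col (S n \<omega>) c) \<le> L * (?N * real n)" for n \<omega>
    by (rule order_trans[OF L(2)]) (intro mult_left_mono norm_S_le L)
  define Q where "Q = (\<Sum>v\<in>UNIV. 2 * norm (c $ v))\<^sup>2"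
  define m where "m n v \<omega> = X (Suc n) v \<omega> - a n v \<omega>" for n v \<omega>
  have m2: "\<bar>m n v \<omega>\<bar> \<le> 2" for n v \<omega>
    unfolding m_def using X_abs[of "Suc n" v \<omega>] a_le_1[of n v \<omega>] by simp
  have isq: "integrable M (\<lambda>\<omega>. (norm (pair_col (S n \<omega>) c))\<^sup>2)" for n
  proof (rule integrable_bounded[of _ "(L * (?N * real n))\<^sup>2"])
    show "\<bar>(norm (pair_col (S n \<omega>) c))\<^sup>2\<bar> \<le> (L * (?N * real n))\<^sup>2" for \<omega>
      using power_mono[OF pS norm_ge_zero, of n \<omega> 2] by simp
  qed measurable
  have step: "expectation (\<lambda>\<omega>. (norm (pair_col (S (Suc n) \<omega>) c))\<^sup>2)
      \<le> (norm (1 + l / of_nat n))\<^sup>2 * expectation (\<lambda>\<omega>. (norm (pair_col (S n \<omega>) c))\<^sup>2) + Q" if n: "n \<ge> 1" for n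
  proof -
    let ?\<alpha> = "1 + l / of_nat n"
    define f where "f v z = Re (cnj (c $ v) * (?\<alpha> * pair_col (Sf n z) c))" for v z
    define R where "R \<omega> = (\<Sum>v\<in>UNIV. of_real (m n v \<omega>) * c $ v)" for \<omega>
    have rec: "pair_col (S (Suc n) \<omega>) c = ?\<alpha> * pair_col (S n \<omega>) c + R \<omega>" for \<omega>
    proof -
      have "pair_col (\<chi> v. X (Suc n) v \<omega> - a n v \<omega>) c = R \<omega>" by (simp add: pair_col_def R_def m_def)
      then show ?thesis unfolding S_rec[OF n] using eig
        by (simp add: pair_col_add pair_col_scaleR eigcol_def algebra_simps)
    qed
    have RQ: "(norm (R \<omega>))\<^sup>2 \<le> Q" for \<omega>
    proof -
      have "norm (R \<omega>) \<le> (\<Sum>v\<in>UNIV. 2 * norm (c $ v))"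
        unfolding R_def by (rule order_trans[OF norm_sum], intro sum_mono) (auto simp: norm_mult intro!: mult_right_mono m2)
      then show ?thesis unfolding Q_def by (rule power_mono) simp
    qed
    have cross: "Re (cnj (R \<omega>) * (?\<alpha> * pair_col (S n \<omega>) c)) = (\<Sum>v\<in>UNIV. f v (Pz n \<omega>) * m n v \<omega>)" for \<omega>
    proof -
      have "cnj (R \<omega>) * (?\<alpha> * pair_col (S n \<omega>) c) = (\<Sum>v\<in>UNIV. of_real (m n v \<omega>) * (cnj (c $ v) * (?\<alpha> * pair_col (S n \<omega>) c)))"
        by (simp add: R_def cnj_sum sum_distrib_right mult.assoc)
      also have "Re \<dots> = (\<Sum>v\<in>UNIV. m n v \<omega> * f v (Pz n \<omega>))"
      proof -
        have "Re (of_real r * z) = r * Re z" for r z by simp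
        then show ?thesis unfolding Re_sum f_def Sf_Pz[OF order_refl] by (intro sum.cong refl) (simp only:)
      qed
      finally show ?thesis by (simp only: mult.commute)
    qed
    have sq: "(norm (pair_col (S (Suc n) \<omega>) c))\<^sup>2 = (norm ?\<alpha>)\<^sup>2 * (norm (pair_col (S n \<omega>) c))\<^sup>2 + (norm (R \<omega>))\<^sup>2
       + 2 * (\<Sum>v\<in>UNIV. f v (Pz n \<omega>) * m n v \<omega>)" for \<omega>
      unfolding rec cross[symmetric] norm_add_sq[of "?\<alpha> * pair_col (S n \<omega>) c" "R \<omega>"] by (simp only: norm_mult power_mult_distrib)
    have fm: "f v \<in> borel_measurable (PastM n)" for v
    proof -
      have "(\<lambda>z. pair_col (Sf n z) c) \<in> borel_measurable (PastM n)"
        by (rule measurable_compose[OF Sf_measurable[OF order_refl] pair_col_measurable])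
      then show ?thesis unfolding f_def by measurable
    qed
    have fb: "\<bar>f v (Pz n \<omega>)\<bar> \<le> norm (c $ v) * (norm ?\<alpha> * (L * (?N * real n)))" for v \<omega>
    proof -
      have "\<bar>f v (Pz n \<omega>)\<bar> \<le> norm (cnj (c $ v) * (?\<alpha> * pair_col (S n \<omega>) c))"
        unfolding f_def Sf_Pz[OF order_refl] by (rule abs_Re_le_cmod)
      also have "\<dots> = norm (c $ v) * (norm ?\<alpha> * norm (pair_col (S n \<omega>) c))" by (simp add: norm_mult)
      also have "\<dots> \<le> norm (c $ v) * (norm ?\<alpha> * (L * (?N * real n)))" by (intro mult_left_mono pS) auto
      finally show ?thesis .
    qed
    note orth = orth_X[OF fm fb n, folded m_def]
    have iR: "integrable M (\<lambda>\<omega>. (norm (R \<omega>))\<^sup>2)"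
    proof (rule integrable_bounded[of _ Q])
      show "(\<lambda>\<omega>. (norm (R \<omega>))\<^sup>2) \<in> borel_measurable M" unfolding R_def m_def by measurable
      show "\<bar>(norm (R \<omega>))\<^sup>2\<bar> \<le> Q" for \<omega> using RQ[of \<omega>] by simp
    qed
    have "expectation (\<lambda>\<omega>. (norm (pair_col (S (Suc n) \<omega>) c))\<^sup>2)
      = (norm ?\<alpha>)\<^sup>2 * expectation (\<lambda>\<omega>. (norm (pair_col (S n \<omega>) c))\<^sup>2) + expectation (\<lambda>\<omega>. (norm (R \<omega>))\<^sup>2)
        + 2 * (\<Sum>v\<in>UNIV. expectation (\<lambda>\<omega>. f v (Pz n \<omega>) * m n v \<omega>))"
      unfolding sq using isq[of n] iR orth(2)
      by (simp add: Bochner_Integration.integral_add Bochner_Integration.integral_sum)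
    also have "(\<Sum>v\<in>UNIV. expectation (\<lambda>\<omega>. f v (Pz n \<omega>) * m n v \<omega>)) = 0"
      by (intro sum.neutral ballI orth(1))
    also have "expectation (\<lambda>\<omega>. (norm (R \<omega>))\<^sup>2) \<le> expectation (\<lambda>_. Q)"
      by (rule integral_mono[OF iR]) (use RQ in auto)
    finally show ?thesis by (simp add: prob_space)
  qed
  obtain n0 :: nat where n0: "2 * (norm l)\<^sup>2 \<le> real n0" using real_arch_simple by blast
  have Q0: "Q \<ge> 0" by (simp add: Q_def)
  show ?thesis
  proof (rule growth_bound[of "\<lambda>n. expectation (\<lambda>\<omega>. (norm (pair_col (S n \<omega>) c))\<^sup>2)" Q 1 "3 / 2" "Suc n0"])
    fix n assume n: "Suc n0 \<le> n"
    then have "n \<ge> 1" "2 * (norm l)\<^sup>2 \<le> real n" using n0 by auto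
    from norm_one_plus_sq_le[OF this(1) l this(2)]
    have "(norm (1 + l / of_nat n))\<^sup>2 * expectation (\<lambda>\<omega>. (norm (pair_col (S n \<omega>) c))\<^sup>2)
        \<le> (1 + 1 / real n) powr (3 / 2) * expectation (\<lambda>\<omega>. (norm (pair_col (S n \<omega>) c))\<^sup>2)"
      by (intro mult_right_mono) auto
    with step[OF \<open>n \<ge> 1\<close>] show "expectation (\<lambda>\<omega>. (norm (pair_col (S (Suc n) \<omega>) c))\<^sup>2)
      \<le> (1 + 1 / real n) powr (3 / 2) * expectation (\<lambda>\<omega>. (norm (pair_col (S n \<omega>) c))\<^sup>2) + Q * real n powr (1 - 1)"
      using \<open>n \<ge> 1\<close> by simp
  qed (use Q0 in auto)
qed

lemma a_moment:
  fixes T :: "complex ^ 'v ^ 'v"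
  assumes T: "invertible T" and eig: "\<And>j. eigcol B (column j T) (lam j)" and l: "\<And>j. Re (lam j) \<le> 1 / 2"
  shows "\<exists>K\<ge>0. \<forall>n\<ge>1. \<forall>v. expectation (\<lambda>\<omega>. \<bar>a n v \<omega>\<bar>) \<le> K * real n powr (- 1 / 4)"
proof -
  have "\<forall>j. \<exists>K\<ge>0. \<forall>n\<ge>1. expectation (\<lambda>\<omega>. (norm (pair_col (S n \<omega>) (column j T)))\<^sup>2) \<le> K * real n powr (3 / 2)"
    using pair_S_moment[OF eig l] by blast
  then obtain Kj where Kj: "\<And>j. Kj j \<ge> 0" "\<And>j n. n \<ge> 1 \<Longrightarrow> expectation (\<lambda>\<omega>. (norm (pair_col (S n \<omega>) (column j T)))\<^sup>2) \<le> Kj j * real n powr (3 / 2)"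
    by metis
  obtain C where C: "C \<ge> 0" "\<And>x. norm x \<le> C * (\<Sum>j\<in>UNIV. norm (pair_col x (column j T)))"
    using norm_le_sum_pair_col[OF T] by blast
  define K where "K = C\<^sup>2 * real CARD('v) * (\<Sum>j\<in>UNIV. Kj j)"
  have K: "K \<ge> 0" unfolding K_def using Kj by (intro mult_nonneg_nonneg sum_nonneg) auto
  have isq: "integrable M (\<lambda>\<omega>. (norm (pair_col (S n \<omega>) c))\<^sup>2)" for n c
  proof -
    obtain L where L: "L \<ge> 0" "\<And>x. norm (pair_col x c) \<le> L * norm x" using norm_pair_col_le by blast
    show ?thesis
    proof (rule integrable_bounded[of _ "(L * (real CARD('v) * real n))\<^sup>2"])
      fix \<omega>
      have "norm (pair_col (S n \<omega>) c) \<le> L * (real CARD('v) * real n)"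
        by (rule order_trans[OF L(2)]) (intro mult_left_mono norm_S_le L)
      from power_mono[OF this norm_ge_zero, of 2]
      show "\<bar>(norm (pair_col (S n \<omega>) c))\<^sup>2\<bar> \<le> (L * (real CARD('v) * real n))\<^sup>2" by simp
    qed measurable
  qed
  have S2: "expectation (\<lambda>\<omega>. (norm (S n \<omega>))\<^sup>2) \<le> K * real n powr (3 / 2)" and iS: "integrable M (\<lambda>\<omega>. (norm (S n \<omega>))\<^sup>2)" if n: "n \<ge> 1" for n
  proof -
    show iS: "integrable M (\<lambda>\<omega>. (norm (S n \<omega>))\<^sup>2)"
    proof (rule integrable_bounded[of _ "(real CARD('v) * real n)\<^sup>2"])
      show "\<bar>(norm (S n \<omega>))\<^sup>2\<bar> \<le> (real CARD('v) * real n)\<^sup>2" for \<omega>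
        using power_mono[OF norm_S_le norm_ge_zero, of n \<omega> 2] by simp
    qed measurable
    have pw: "(norm (S n \<omega>))\<^sup>2 \<le> C\<^sup>2 * real CARD('v) * (\<Sum>j\<in>UNIV. (norm (pair_col (S n \<omega>) (column j T)))\<^sup>2)" for \<omega>
    proof -
      have "(norm (S n \<omega>))\<^sup>2 \<le> (C * (\<Sum>j\<in>UNIV. norm (pair_col (S n \<omega>) (column j T))))\<^sup>2"
        by (rule power_mono[OF C(2)]) simp
      also have "\<dots> = C\<^sup>2 * (\<Sum>j\<in>UNIV. norm (pair_col (S n \<omega>) (column j T)))\<^sup>2" by (rule power_mult_distrib)
      also have "\<dots> \<le> C\<^sup>2 * ((\<Sum>j\<in>UNIV. (norm (pair_col (S n \<omega>) (column j T)))\<^sup>2) * real CARD('v))"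
        using sum_squared_le_sum_of_squares[where I = UNIV and f = "\<lambda>j. norm (pair_col (S n \<omega>) (column j T))"]
        by (intro mult_left_mono) auto
      finally show ?thesis by (simp only: mult_ac)
    qed
    have "expectation (\<lambda>\<omega>. (norm (S n \<omega>))\<^sup>2) \<le> expectation (\<lambda>\<omega>. C\<^sup>2 * real CARD('v) * (\<Sum>j\<in>UNIV. (norm (pair_col (S n \<omega>) (column j T)))\<^sup>2))"
      by (rule integral_mono[OF iS]) (use isq pw in auto)
    also have "\<dots> = C\<^sup>2 * real CARD('v) * (\<Sum>j\<in>UNIV. expectation (\<lambda>\<omega>. (norm (pair_col (S n \<omega>) (column j T)))\<^sup>2))"
      using isq by (simp add: Bochner_Integration.integral_sum)
    also have "\<dots> \<le> C\<^sup>2 * real CARD('v) * (\<Sum>j\<in>UNIV. Kj j * real n powr (3 / 2))"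
      by (intro mult_left_mono sum_mono Kj(2) n) auto
    finally show "expectation (\<lambda>\<omega>. (norm (S n \<omega>))\<^sup>2) \<le> K * real n powr (3 / 2)"
      by (simp add: K_def sum_distrib_right mult.assoc)
  qed
  have "expectation (\<lambda>\<omega>. \<bar>a n v \<omega>\<bar>) \<le> (K + 1) / 2 * real n powr (- 1 / 4)" if n: "n \<ge> 1" for n v
  proof -
    \<comment> \<open>The root mean square of the walk is O(n^(3/4)). With this r the inequality 2s
      \<le> s^2/r + r turns the second moment into a first moment of the same order.\<close>
    let ?r = "real n powr (3 / 4)"
    have r: "?r > 0" using n by simp
    have pw: "\<bar>a n v \<omega>\<bar> \<le> ((norm (S n \<omega>))\<^sup>2 / ?r + ?r) / (2 * real n)" for \<omega>
    proof -
      have "\<bar>\<Sum>i\<in>UNIV. B $ i $ v * S n \<omega> $ i\<bar> \<le> (\<Sum>i\<in>UNIV. \<bar>B $ i $ v\<bar> * norm (S n \<omega>))"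
        by (rule order_trans[OF sum_abs], intro sum_mono) (auto simp: abs_mult intro!: mult_left_mono component_le_norm_cart)
      also have "\<dots> \<le> 1 * norm (S n \<omega>)" unfolding sum_distrib_right[symmetric] by (intro mult_right_mono colsum) simp
      finally have "\<bar>a n v \<omega>\<bar> \<le> norm (S n \<omega>) / real n"
        using n by (simp add: a_def drift_eq divide_right_mono)
      moreover have "norm (S n \<omega>) \<le> ((norm (S n \<omega>))\<^sup>2 / ?r + ?r) / 2"
      proof -
        have "2 * norm (S n \<omega>) * ?r \<le> (norm (S n \<omega>))\<^sup>2 + ?r\<^sup>2"
          using zero_le_power2[of "norm (S n \<omega>) - ?r"] by (simp add: power2_diff)
        then have "2 * norm (S n \<omega>) \<le> ((norm (S n \<omega>))\<^sup>2 + ?r\<^sup>2) / ?r" using r by (simp add: pos_le_divide_eq)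
        also have "\<dots> = (norm (S n \<omega>))\<^sup>2 / ?r + ?r" using r by (simp add: add_divide_distrib power2_eq_square)
        finally show ?thesis by simp
      qed
      ultimately have "\<bar>a n v \<omega>\<bar> \<le> (((norm (S n \<omega>))\<^sup>2 / ?r + ?r) / 2) / real n"
        using n by (meson divide_right_mono of_nat_0_le_iff order_trans)
      then show ?thesis by simp
    qed
    have "expectation (\<lambda>\<omega>. \<bar>a n v \<omega>\<bar>) \<le> expectation (\<lambda>\<omega>. ((norm (S n \<omega>))\<^sup>2 / ?r + ?r) / (2 * real n))"
      by (rule integral_mono) (use iS[OF n] pw a_le_1 in \<open>auto intro!: integrable_bounded[of "\<lambda>\<omega>. \<bar>a n v \<omega>\<bar>" 1]\<close>)
    also have "\<dots> = (expectation (\<lambda>\<omega>. (norm (S n \<omega>))\<^sup>2) / ?r + ?r) / (2 * real n)"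
      using iS[OF n] by (simp add: prob_space)
    also have "\<dots> \<le> (K * real n powr (3 / 2) / ?r + ?r) / (2 * real n)"
      using S2[OF n] r n by (intro divide_right_mono add_right_mono) auto
    also have "K * real n powr (3 / 2) / ?r = K * ?r"
    proof -
      have "real n powr (3 / 2) = ?r * ?r" by (simp add: powr_add[symmetric])
      then show ?thesis using r by simp
    qed
    also have "(K * ?r + ?r) / (2 * real n) = (K + 1) / 2 * (?r / real n)" by (simp add: algebra_simps add_divide_distrib)
    also have "?r / real n = real n powr (- 1 / 4)"
    proof -
      have "?r = real n powr (- 1 / 4) * real n" using n powr_add[of "real n" "- 1 / 4" 1] by simp
      then show ?thesis using n by simp
    qed
    finally show ?thesis .
  qed
  then show ?thesis using K by (intro exI[of _ "(K + 1) / 2"]) auto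
qed

lemma D_AE:
  fixes T :: "complex ^ 'v ^ 'v"
  assumes T: "invertible T" and eig: "\<And>j. eigcol B (column j T) (lam j)" and l: "\<And>j. Re (lam j) \<le> 1 / 2"
  shows "AE \<omega> in M. \<exists>K\<ge>0. \<forall>n\<ge>1. \<bar>D n v \<omega>\<bar> \<le> K * real n powr (31 / 64)"
proof -
  obtain K where K: "K \<ge> 0" "\<And>n. n \<ge> 1 \<Longrightarrow> expectation (\<lambda>\<omega>. \<bar>a n v \<omega>\<bar>) \<le> K * real n powr (- 1 / 4)"
    using a_moment[OF T eig l] by blast
  have "\<exists>K\<ge>0. \<forall>n\<ge>1. expectation (\<lambda>\<omega>. (D n v \<omega>)\<^sup>2) \<le> K * real n powr (7 / 8)"
  \<comment> \<open>Increments of order n^(-1/4) accumulate to n^(3/4). The exponent 7/8 only has to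
    lie strictly between 3/4 and 31/32, twice the exponent of the claim.\<close>
  proof (rule growth_bound[of _ "10 * K" "3 / 4" "7 / 8" 1])
    fix n :: nat assume n: "1 \<le> n"
    have "1 \<le> (1 + 1 / real n) powr (7 / 8)" by (intro ge_one_powr_ge_zero) auto
    then have "1 * expectation (\<lambda>\<omega>. (D n v \<omega>)\<^sup>2) \<le> (1 + 1 / real n) powr (7 / 8) * expectation (\<lambda>\<omega>. (D n v \<omega>)\<^sup>2)"
      by (intro mult_right_mono) auto
    moreover have "expectation (\<lambda>\<omega>. (dlt n v \<omega>)\<^sup>2) \<le> 10 * (K * real n powr (- 1 / 4))"
      using dlt_second_moment[OF n, of v] K(2)[OF n] by linarith
    ultimately show "expectation (\<lambda>\<omega>. (D (Suc n) v \<omega>)\<^sup>2) \<le> (1 + 1 / real n) powr (7 / 8) * expectation (\<lambda>\<omega>. (D n v \<omega>)\<^sup>2) + 10 * K * real n powr (3 / 4 - 1)"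
      unfolding D_second_moment_Suc[OF n] by simp
  qed (use K in auto)
  then obtain K' where K': "K' \<ge> 0" "\<And>n. n \<ge> 1 \<Longrightarrow> expectation (\<lambda>\<omega>. (D n v \<omega>)\<^sup>2) \<le> K' * real n powr (7 / 8)" by blast
  show ?thesis
  proof (rule AE_dyadic_bound[where \<beta> = "7 / 8" and C = K'])
    fix n :: nat and c :: real assume n: "n \<ge> 1" and c: "c > 0"
    have "prob {\<omega>\<in>space M. \<exists>k\<le>n. c \<le> \<bar>D k v \<omega>\<bar>} \<le> expectation (\<lambda>\<omega>. (D n v \<omega>)\<^sup>2) / c\<^sup>2" by (rule D_maximal[OF c n])
    also have "\<dots> \<le> K' * real n powr (7 / 8) / c\<^sup>2" by (intro divide_right_mono K' n) simp
    finally show "prob {\<omega>\<in>space M. \<exists>k\<le>n. c \<le> \<bar>D k v \<omega>\<bar>} \<le> K' * real n powr (7 / 8) / c\<^sup>2" .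
  qed auto
qed

end

section \<open>The strong approximation\<close>

lemma ex_coupling_base: "\<exists>(M :: (bool \<times> nat \<times> 'v::finite \<Rightarrow> real) measure) y. coupling_base M (y :: bool \<times> nat \<times> 'v \<Rightarrow> _)"
proof -
  define N where "N k = (if fst k then std_normal else uniform_measure lborel {0<..<1})" for k :: "bool \<times> nat \<times> 'v"
  have pN: "prob_space (N k)" for k
    using prob_space_std_normal by (auto simp: N_def intro!: prob_space_uniform_measure)
  have sN: "sets (N k) = sets borel" for k by (simp add: N_def)
  let ?M = "PiM UNIV N" and ?y = "\<lambda>k (\<omega> :: bool \<times> nat \<times> 'v \<Rightarrow> real). \<omega> k"
  have sM: "sets ?M = sets (PiM UNIV (\<lambda>_. borel))" by (rule sets_PiM_cong) (simp_all add: sN)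
  have comp: "?y k \<in> measurable ?M borel" for k
    using measurable_component_singleton[of k UNIV N] sN[of k] by (simp cong: measurable_cong_sets)
  have dk: "distr ?M borel (?y k) = N k" for k
  proof -
    have "distr ?M borel (?y k) = distr ?M (N k) (?y k)" by (rule distr_cong) (simp_all add: sN)
    then show ?thesis using distr_PiM_component[of UNIV N k] pN by simp
  qed
  interpret prob_space ?M by (rule prob_space_PiM) (rule pN)
  have "coupling_base ?M ?y"
  proof unfold_locales
    show "indep_vars (\<lambda>_. borel) ?y UNIV"
    proof (subst indep_vars_iff_distr_eq_PiM')
      have "distr ?M (PiM UNIV (\<lambda>_. borel)) (\<lambda>x. \<lambda>i\<in>UNIV. x i) = ?M"
        using distr_id2[OF sM[symmetric]] by (simp add: restrict_def)
      also have "\<dots> = PiM UNIV (\<lambda>i. distr ?M borel (?y i))" by (simp add: dk)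
      finally show "distr ?M (PiM UNIV (\<lambda>_. borel)) (\<lambda>x. \<lambda>i\<in>UNIV. x i) = PiM UNIV (\<lambda>i. distr ?M borel (?y i))" .
    qed (use comp in auto)
    show "distributed ?M lborel (?y (True, n, v)) std_normal_density" for n v
    proof -
      have "distr ?M lborel (?y (True, n, v)) = distr ?M borel (?y (True, n, v))" by (rule distr_cong) simp_all
      then show ?thesis using dk[of "(True, n, v)"] comp by (simp add: distributed_def N_def)
    qed
    fix n :: nat and v :: 'v and c :: real assume c: "0 \<le> c" "c \<le> 1"
    have "prob {\<omega>\<in>space ?M. ?y (False, n, v) \<omega> < c} = measure (distr ?M borel (?y (False, n, v))) {..<c}"
      by (subst measure_distr[OF comp]) (simp_all add: vimage_def Int_def conj_commute)
    also have "\<dots> = measure (uniform_measure lborel {0<..<1}) {..<c}" by (simp add: dk N_def)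
    also have "\<dots> = measure lborel ({0<..<1} \<inter> {..<c}) / measure lborel {0<..<1::real}"
      by (rule measure_uniform_measure) auto
    also have "{0<..<1} \<inter> {..<c} = {0<..<c}" using c by auto
    finally show "prob {\<omega>\<in>space ?M. ?y (False, n, v) \<omega> < c} = c" using c by simp
  qed
  then show ?thesis by blast
qed

lemma std_mvn_density_prod:
  fixes x :: "real ^ 'n"
  shows "std_mvn_density x = (\<Prod>b\<in>Basis. std_normal_density (x \<bullet> b))"
proof -
  have "(\<Prod>b\<in>(Basis :: (real ^ 'n) set). std_normal_density (x \<bullet> b))
      = (\<Prod>b\<in>(Basis :: (real ^ 'n) set). 1 / sqrt (2 * pi)) * (\<Prod>b\<in>Basis. exp (- (x \<bullet> b)\<^sup>2 / 2))"
    unfolding std_normal_density_def by (rule prod.distrib)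
  also have "(\<Prod>b\<in>(Basis :: (real ^ 'n) set). 1 / sqrt (2 * pi)) = 1 / sqrt ((2 * pi) ^ CARD('n))"
    unfolding real_sqrt_power by (simp add: power_one_over)
  also have "(\<Prod>b\<in>Basis. exp (- (x \<bullet> b)\<^sup>2 / 2)) = exp (\<Sum>b\<in>Basis. - (x \<bullet> b)\<^sup>2 / 2)"
    by (simp add: exp_sum)
  also have "(\<Sum>b\<in>Basis. - (x \<bullet> b)\<^sup>2 / 2) = - (norm x)\<^sup>2 / 2"
  proof -
    have "(norm x)\<^sup>2 = (\<Sum>b\<in>Basis. (x \<bullet> b)\<^sup>2)"
      unfolding power2_norm_eq_inner by (subst euclidean_inner) (simp add: power2_eq_square)
    then show ?thesis by (simp only: sum_divide_distrib[symmetric] sum_negf)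
  qed
  finally show ?thesis by (simp add: std_mvn_density_def)
qed

lemma std_mvn_density_measurable: "std_mvn_density \<in> borel_measurable borel"
  unfolding std_mvn_density_def[abs_def] by measurable

lemma borel_linear_vec_mat: "(\<lambda>x :: real ^ 'n. x v* A) \<in> borel_measurable borel" for A :: "real ^ 'm ^ 'n"
proof -
  have "linear (\<lambda>x :: real ^ 'n. x v* A)"
    by (rule linearI) (simp_all add: vector_matrix_mult_def vec_eq_iff sum.distrib algebra_simps sum_distrib_left)
  then show ?thesis
    by (intro borel_measurable_continuous_onI linear_continuous_on) (simp add: linear_conv_bounded_linear)
qed

context coupling_base
begin

definition Yv :: "nat \<Rightarrow> 'a \<Rightarrow> real ^ 'v" where "Yv n \<omega> = (\<chi> v. y (True, n, v) \<omega>)"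

lemma Yv_measurable[measurable]: "Yv n \<in> borel_measurable M"
  unfolding Yv_def[abs_def] by (rule vec_lambda_measurable) simp

lemma Yv_indep: "indep_vars (\<lambda>_. borel) Yv {1..}"
proof -
  define J where "J n = (\<lambda>v :: 'v. (True, n :: nat, v)) ` UNIV" for n
  have "indep_vars (\<lambda>n. PiM (J n) (\<lambda>_. borel)) (\<lambda>n \<omega>. \<lambda>k\<in>J n. y k \<omega>) {1..}"
    by (rule indep_vars_restrict[OF y_indep]) (auto simp: J_def disjoint_family_on_def)
  then have "indep_vars (\<lambda>_. borel) (\<lambda>n \<omega>. (\<lambda>f. \<chi> v. f (True, n, v)) (\<lambda>k\<in>J n. y k \<omega>)) {1..}"
  proof (rule indep_vars_compose2)
    fix n :: nat
    show "(\<lambda>f. \<chi> v. f (True, n, v)) \<in> borel_measurable (PiM (J n) (\<lambda>_. borel :: real measure))"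
      by (rule vec_lambda_measurable)
        (use measurable_component_singleton[of _ "J n" "\<lambda>_. borel :: real measure"] in \<open>simp add: J_def\<close>)
  qed
  moreover have "(\<lambda>n \<omega>. (\<lambda>f. \<chi> v. f (True, n, v)) (\<lambda>k\<in>J n. y k \<omega>)) = Yv"
    by (intro ext) (simp add: Yv_def J_def)
  ultimately show ?thesis by simp
qed

text \<open>Open boxes form an intersection-stable generator of the Borel sets. On a box the density
  integral factors by Fubini and the probability by independence of the coordinates.\<close>

lemma Yv_distr: "distr M borel (Yv n) = density lborel (\<lambda>x. ennreal (std_mvn_density x))"
proof (rule measure_eqI_generator_eq[where E = "range (\<lambda>(a, b). box a b)" and \<Omega> = UNIV and A = "\<lambda>i. box (- (real i *\<^sub>R One)) (real i *\<^sub>R One)"])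
  show "Int_stable (range (\<lambda>(a, b). box a b :: (real ^ 'v) set))"
    by (auto simp: Int_stable_def box_Int_box)
  show "sets (distr M borel (Yv n)) = sigma_sets UNIV (range (\<lambda>(a, b). box a b))"
    by (simp add: borel_eq_box)
  show "sets (density lborel (\<lambda>x. ennreal (std_mvn_density x))) = sigma_sets UNIV (range (\<lambda>(a, b). box a b))"
    by (simp add: borel_eq_box)
  show "(\<Union>i. box (- (real i *\<^sub>R One)) (real i *\<^sub>R One)) = (UNIV :: (real ^ 'v) set)"
    by (rule UN_box_eq_UNIV)
  interpret D: prob_space "distr M borel (Yv n)" by (rule prob_space_distr) measurable
  show "emeasure (distr M borel (Yv n)) (box (- (real i *\<^sub>R One)) (real i *\<^sub>R One)) \<noteq> \<infinity>" for i by simp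
  fix A :: "(real ^ 'v) set" assume "A \<in> range (\<lambda>(a, b). box a b)"
  then obtain a b where A: "A = box a b" by auto
  have Bas: "Basis = range (\<lambda>v. axis v 1 :: real ^ 'v)" by (auto simp: Basis_vec_def)
  have inj: "inj (\<lambda>v. axis v 1 :: real ^ 'v)" by (auto simp: inj_on_def axis_eq_axis)
  let ?f = "\<lambda>k x. ennreal (std_normal_density x) * indicator {a \<bullet> k<..<b \<bullet> k} x"
  have "emeasure (density lborel (\<lambda>x. ennreal (std_mvn_density x))) A = (\<integral>\<^sup>+x. ennreal (std_mvn_density x) * indicator A x \<partial>lborel)"
    by (subst emeasure_density) (auto simp: A intro: measurable_compose[OF std_mvn_density_measurable measurable_ennreal])
  also have "\<dots> = (\<integral>\<^sup>+x. (\<Prod>k\<in>Basis. ?f k (x \<bullet> k)) \<partial>lborel)"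
  proof (rule nn_integral_cong)
    fix x :: "real ^ 'v"
    have "indicator A x = (\<Prod>k\<in>Basis. indicator {a \<bullet> k<..<b \<bullet> k} (x \<bullet> k) :: ennreal)"
      unfolding A by (auto simp: box_def indicator_def prod_eq_1_iff)
    then show "ennreal (std_mvn_density x) * indicator A x = (\<Prod>k\<in>Basis. ?f k (x \<bullet> k))"
      unfolding std_mvn_density_prod prod.distrib by (simp add: prod_ennreal)
  qed
  also have "\<dots> = (\<Prod>k\<in>Basis. \<integral>\<^sup>+x. ?f k x \<partial>lborel)" by (rule nn_integral_lborel_prod) auto
  also have "\<dots> = (\<Prod>v\<in>UNIV. \<integral>\<^sup>+x. ?f (axis v 1) x \<partial>lborel)" unfolding Bas by (rule prod.reindex_cong[OF inj refl refl])
  also have "\<dots> = (\<Prod>v\<in>UNIV. ennreal (prob (y (True, n, v) -` {a $ v<..<b $ v} \<inter> space M)))"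
  proof (rule prod.cong[OF refl])
    fix v :: 'v
    have "(\<integral>\<^sup>+x. ?f (axis v 1) x \<partial>lborel) = emeasure std_normal {a $ v<..<b $ v}"
      by (subst emeasure_density) (auto simp: inner_axis)
    also have "std_normal = distr M lborel (y (True, n, v))" using y_normal[of n v] by (simp add: distributed_def)
    also have "emeasure \<dots> {a $ v<..<b $ v} = emeasure M (y (True, n, v) -` {a $ v<..<b $ v} \<inter> space M)"
      by (rule emeasure_distr) auto
    finally show "(\<integral>\<^sup>+x. ?f (axis v 1) x \<partial>lborel) = ennreal (prob (y (True, n, v) -` {a $ v<..<b $ v} \<inter> space M))"
      by (simp add: emeasure_eq_measure)
  qed
  also have "\<dots> = ennreal (\<Prod>v\<in>UNIV. prob (y (True, n, v) -` {a $ v<..<b $ v} \<inter> space M))"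
    by (rule prod_ennreal) simp
  also have "(\<Prod>v\<in>UNIV. prob (y (True, n, v) -` {a $ v<..<b $ v} \<inter> space M)) = prob (\<Inter>v. y (True, n, v) -` {a $ v<..<b $ v} \<inter> space M)"
  proof -
    have "indep_vars (\<lambda>_. borel) (\<lambda>v. y (True, n, v)) UNIV"
      by (rule indep_vars_reindex_inj[OF y_indep]) (auto simp: inj_on_def)
    from indep_varsD[OF this, of UNIV "\<lambda>v. {a $ v<..<b $ v}"] show ?thesis by simp
  qed
  also have "(\<Inter>v. y (True, n, v) -` {a $ v<..<b $ v} \<inter> space M) = Yv n -` A \<inter> space M"
    unfolding A by (auto simp: Yv_def mem_box_cart)
  also have "ennreal (prob (Yv n -` A \<inter> space M)) = emeasure (distr M borel (Yv n)) A"
    by (subst emeasure_distr) (auto simp: A emeasure_eq_measure)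
  finally show "emeasure (distr M borel (Yv n)) A = emeasure (density lborel (\<lambda>x. ennreal (std_mvn_density x))) A" by simp
qed auto

end

text \<open>The final space is an image measure. An almost sure property is passed on to it as the
  membership in a measurable event of the target space.\<close>

lemma AE_distr_powr_bound:
  fixes f :: "nat \<Rightarrow> 'b \<Rightarrow> 'c::euclidean_space"
  assumes \<Phi>: "\<Phi> \<in> measurable M N" and f: "\<And>n. f n \<in> borel_measurable N"
    and AE: "AE \<omega> in M. \<exists>K\<ge>0. \<forall>n\<ge>1. norm (f n (\<Phi> \<omega>)) \<le> K * real n powr \<mu>"
  shows "AE p in distr M N \<Phi>. (\<lambda>n. norm (f n p)) \<in> O(\<lambda>n. real n powr \<mu>)"
proof -
  note [measurable] = f
  \<comment> \<open>an integer constant makes the event measurable\<close>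
  have "AE \<omega> in M. \<exists>k::nat. \<forall>n\<ge>1. norm (f n (\<Phi> \<omega>)) \<le> real k * real n powr \<mu>"
    using AE
  proof eventually_elim
    case (elim \<omega>)
    then obtain K where K: "\<And>n. n \<ge> 1 \<Longrightarrow> norm (f n (\<Phi> \<omega>)) \<le> K * real n powr \<mu>" by blast
    obtain k :: nat where "K \<le> real k" using real_arch_simple by blast
    then have "K * real n powr \<mu> \<le> real k * real n powr \<mu>" for n by (intro mult_right_mono) auto
    then show ?case using K by (intro exI[of _ k]) (auto intro: order_trans)
  qed
  moreover have "{p\<in>space N. \<exists>k::nat. \<forall>n\<ge>1. norm (f n p) \<le> real k * real n powr \<mu>} \<in> sets N" by measurable
  ultimately have "AE p in distr M N \<Phi>. \<exists>k::nat. \<forall>n\<ge>1. norm (f n p) \<le> real k * real n powr \<mu>"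
    by (subst AE_distr_iff[OF \<Phi>]) auto
  then show ?thesis
  proof eventually_elim
    case (elim p)
    then obtain k :: nat where k: "\<And>n. n \<ge> 1 \<Longrightarrow> norm (f n p) \<le> real k * real n powr \<mu>" by blast
    show ?case
      by (rule bigoI[of _ "real k"]) (use k in \<open>auto intro!: eventually_sequentiallyI[of 1]\<close>)
  qed
qed

lemma memory_matrix_colsum:
  assumes "card (in_nbrs E v) \<ge> 1" "p v \<in> {0..1}"
  shows "(\<Sum>i\<in>UNIV. \<bar>memory_matrix E p $ i $ v\<bar>) \<le> 1"
proof -
  have "(\<Sum>i\<in>UNIV. \<bar>memory_matrix E p $ i $ v\<bar>) = (\<Sum>i\<in>UNIV. if i \<in> in_nbrs E v then \<bar>2 * p v - 1\<bar> / real (card (in_nbrs E v)) else 0)"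
    by (intro sum.cong refl) (auto simp: memory_matrix_def in_nbrs_def)
  also have "\<dots> = (\<Sum>i\<in>in_nbrs E v. \<bar>2 * p v - 1\<bar> / real (card (in_nbrs E v)))"
    by (subst sum.inter_filter[symmetric]) auto
  also have "\<dots> = \<bar>2 * p v - 1\<bar>" using assms(1) by (cases "in_nbrs E v = {}") auto
  also have "\<dots> \<le> 1" using assms(2) by auto
  finally show ?thesis .
qed

context coupled_walk
begin

text \<open>The columns of T serve the moment bounds, which need all eigenvalues. The vector c is
  independent of them because the last claim concerns an arbitrary real diagonalisation.\<close>

lemma eigcol_error_AE:
  fixes T :: "complex ^ 'v ^ 'v"
  assumes T: "invertible T" and eig: "\<And>j. eigcol B (column j T) (lam j)" and l: "\<And>j. Re (lam j) \<le> 1 / 2"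
    and c: "eigcol B c lc" and \<mu>: "31 / 64 < \<mu>" "Re lc \<le> \<mu>"
  shows "AE \<omega> in M. \<exists>K\<ge>0. \<forall>n\<ge>1. norm (pair_col (S n \<omega> - gauss_sum B Yv n \<omega>) c) \<le> K * real n powr \<mu>"
proof -
  have "AE \<omega> in M. \<forall>v. \<exists>K\<ge>0. \<forall>n\<ge>1. \<bar>D n v \<omega>\<bar> \<le> K * real n powr (31 / 64)"
    unfolding AE_all_countable using D_AE[OF T eig l] by blast
  moreover have "AE \<omega> in M. \<forall>v. \<exists>K\<ge>0. \<forall>n\<ge>1. \<bar>\<Sum>j=1..n. rad j v \<omega> - y (True, j, v) \<omega>\<bar> \<le> K * real n powr (31 / 64)"
    unfolding AE_all_countable using rad_normal_AE by blast
  ultimately show ?thesis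
  proof eventually_elim
    case (elim \<omega>)
    from choice[OF elim(1)] obtain K1 where K1: "\<And>v. K1 v \<ge> 0" "\<And>v n. n \<ge> 1 \<Longrightarrow> \<bar>D n v \<omega>\<bar> \<le> K1 v * real n powr (31 / 64)" by blast
    from choice[OF elim(2)] obtain K2 where K2: "\<And>v. K2 v \<ge> 0" "\<And>v n. n \<ge> 1 \<Longrightarrow> \<bar>\<Sum>j=1..n. rad j v \<omega> - y (True, j, v) \<omega>\<bar> \<le> K2 v * real n powr (31 / 64)" by blast
    \<comment> \<open>The first step of the walk is not governed by \<open>rad 1\<close>. Only
      increments of \<open>N\<close> from time 1 on enter the recursion, so the discrepancy belongs
      to the initial value.\<close>
    define N where "N n = (\<chi> v. (\<Sum>j=1..n. rad j v \<omega>) + D n v \<omega>)" for n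
    show ?case
    proof (rule eigcol_error_bound[where N = N and \<kappa> = "31 / 64" and C = "\<Sum>v\<in>UNIV. K1 v + K2 v" and ?C0.0 = "real CARD('v)"])
      fix n :: nat assume n: "n \<ge> 1"
      have "N (Suc n) - N n = (\<chi> v. X (Suc n) v \<omega> - a n v \<omega>)"
        using n by (simp add: N_def vec_eq_iff D_def dlt_def)
      then show "S (Suc n) \<omega> = S n \<omega> + (1 / real n) *\<^sub>R (S n \<omega> v* B) + (N (Suc n) - N n)"
        using S_rec[OF n, of \<omega>] by simp
      have "norm (N n - (\<Sum>j=1..n. Yv j \<omega>)) \<le> (\<Sum>v\<in>UNIV. \<bar>(N n - (\<Sum>j=1..n. Yv j \<omega>)) $ v\<bar>)" by (rule norm_le_l1_cart)
      also have "\<dots> \<le> (\<Sum>v\<in>UNIV. (K1 v + K2 v) * real n powr (31 / 64))"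
      proof (rule sum_mono)
        fix v
        have "(N n - (\<Sum>j=1..n. Yv j \<omega>)) $ v = (\<Sum>j=1..n. rad j v \<omega> - y (True, j, v) \<omega>) + D n v \<omega>"
          by (simp add: N_def Yv_def sum_subtractf)
        then show "\<bar>(N n - (\<Sum>j=1..n. Yv j \<omega>)) $ v\<bar> \<le> (K1 v + K2 v) * real n powr (31 / 64)"
          using K1(2)[OF n, of v] K2(2)[OF n, of v] unfolding distrib_right by linarith
      qed
      finally show "norm (N n - (\<Sum>j=1..n. Yv j \<omega>)) \<le> (\<Sum>v\<in>UNIV. K1 v + K2 v) * real n powr (31 / 64)"
        by (simp only: sum_distrib_right)
    next
      show "norm (S n \<omega>) \<le> real CARD('v) * real n" for n by (rule norm_S_le)
    qed (use c \<mu> in auto)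
  qed
qed

end

theorem theorem3:
  fixes M :: "'a measure"
    and E :: "('v::finite \<times> 'v) set"
    and p q :: "'v \<Rightarrow> real"
    and S :: "nat \<Rightarrow> 'a \<Rightarrow> real ^ 'v"
    and B :: "real ^ 'v ^ 'v"
    and T :: "complex ^ 'v ^ 'v"
    and lam :: "'v \<Rightarrow> complex"
    and \<eta> :: real
  assumes in_degree: "\<And>v. card (in_nbrs E v) \<ge> 1"
    and p: "\<And>v. p v \<in> {0..1}"
    and q: "\<And>v. q v \<in> {0..1}"
    and S: "erwg_process M E p q S"
    and B: "B = memory_matrix E p"
    and T: "invertible T"
    and diag: "matrix_inv T ** map_matrix complex_of_real B ** T = diag_mat lam"
    and \<eta>: "\<eta> = max_Re_eigval B"
    and le_half: "\<eta> \<le> 1 / 2"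
  shows "\<exists>(M' :: ((nat \<Rightarrow> real ^ 'v) \<times> (nat \<Rightarrow> real ^ 'v)) measure) S' Y.
    prob_space M' \<and>
    (\<forall>n. S' n \<in> borel_measurable M') \<and>
    same_law M S M' S' \<and>
    iid_std_mvn M' Y \<and>
    (\<eta> < 1 / 2 \<longrightarrow>
       (\<exists>\<delta>>0. AE \<omega> in M'.
          (\<lambda>n. norm (S' n \<omega> - gauss_sum B Y n \<omega>)) \<in> O(\<lambda>n. real n powr (1 / 2 - \<delta>)))) \<and>
    (\<eta> = 1 / 2 \<longrightarrow>
       (AE \<omega> in M'.
          (\<lambda>n. norm (S' n \<omega> - gauss_sum B Y n \<omega>)) \<in> O(\<lambda>n. real n powr (1 / 2)))) \<and>
    (\<forall>(T' :: real ^ 'v ^ 'v) (l :: 'v \<Rightarrow> real).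
       invertible T' \<and> matrix_inv T' ** B ** T' = diag_mat l \<longrightarrow>
       (\<exists>(\<epsilon> :: nat \<Rightarrow> _ \<Rightarrow> real ^ 'v) (\<delta> :: 'v \<Rightarrow> real).
          (\<forall>n. \<epsilon> n \<in> borel_measurable M') \<and>
          (AE \<omega> in M'. \<forall>n\<ge>1. S' n \<omega> = gauss_sum B Y n \<omega> + \<epsilon> n \<omega> v* matrix_inv T') \<and>
          (\<forall>j. (l j < 1 / 2 \<longrightarrow> \<delta> j > 0) \<and> (l j = 1 / 2 \<longrightarrow> \<delta> j = 0)) \<and>
          (\<forall>j. AE \<omega> in M'. (\<lambda>n. \<epsilon> n \<omega> $ j) \<in> O(\<lambda>n. real n powr (1 / 2 - \<delta> j)))))"
proof -
  have eig: "eigcol B (column j T) (lam j)" for j by (rule eigcol_of_diag[OF T diag])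
  have lam: "Re (lam j) \<le> \<eta>" for j
    unfolding \<eta> max_Re_eigval_def
    by (rule Max_ge) (use finite_eigvals[OF T diag] eigvals_of_diag[OF T diag] in auto)
  then have lam_half: "Re (lam j) \<le> 1 / 2" for j using le_half order_trans by blast
  obtain \<Omega> :: "(bool \<times> nat \<times> 'v \<Rightarrow> real) measure" and y where base: "coupling_base \<Omega> (y :: bool \<times> nat \<times> 'v \<Rightarrow> _)"
    using ex_coupling_base by blast
  interpret W: coupled_walk \<Omega> y B q
    unfolding coupled_walk_def coupled_walk_axioms_def
    using base memory_matrix_colsum[OF in_degree p] q by (auto simp: B)
  obtain \<sigma> \<xi> D u and X :: "nat \<Rightarrow> 'v \<Rightarrow> 'a \<Rightarrow> int" where pM: "prob_space M"
    and innov: "erwg_innovations M E p q \<sigma> \<xi> D u"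
    and Xm: "\<And>n v. n \<ge> 1 \<Longrightarrow> X n v \<in> measurable M (count_space UNIV)"
    and X1: "AE \<omega> in M. \<forall>v. X 1 v \<omega> = \<sigma> v \<omega>"
    and Xrec: "AE \<omega> in M. \<forall>n\<ge>1. \<forall>v. X (n + 1) v \<omega> = \<xi> n v \<omega> * X (D n v \<omega>) (u n v \<omega>) \<omega>"
    and SX: "\<And>n \<omega>. \<omega> \<in> space M \<Longrightarrow> S n \<omega> = (\<Sum>j=1..n. \<chi> v. real_of_int (X j v \<omega>))"
    using S unfolding erwg_process_def by blast
  note orig = orig_path_prob[OF pM innov in_degree p q X1 Xrec Xm]
  have law: "same_law M S \<Omega> W.S"
  proof (rule same_law_of_path_probs[where X = X and X' = "\<lambda>n v \<omega>. \<lfloor>W.X n v \<omega>\<rfloor>"])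
    show "prob_space \<Omega>" by unfold_locales
    show "(\<lambda>\<omega>. \<lfloor>W.X j v \<omega>\<rfloor>) \<in> measurable \<Omega> (count_space UNIV)" for j v by measurable
    have fl: "real_of_int \<lfloor>W.X j v \<omega>\<rfloor> = W.X j v \<omega>" "\<lfloor>W.X j v \<omega>\<rfloor> \<in> {- 1, 1}" if "j \<ge> 1" for j v \<omega>
    proof -
      have "W.X j v \<omega> = of_int (- 1) \<or> W.X j v \<omega> = of_int 1" using W.X_in[OF that, of v \<omega>] by simp
      then show "real_of_int \<lfloor>W.X j v \<omega>\<rfloor> = W.X j v \<omega>" "\<lfloor>W.X j v \<omega>\<rfloor> \<in> {- 1, 1}"
        by (metis floor_of_int, metis floor_of_int insertCI)
    qed
    show "W.S n \<omega> = (\<Sum>j=1..n. \<chi> v. real_of_int \<lfloor>W.X j v \<omega>\<rfloor>)" for n \<omega>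
      unfolding W.S_eq_sum by (intro sum.cong refl) (simp add: fl(1) vec_eq_iff)
    show "AE \<omega> in \<Omega>. \<forall>j\<ge>1. \<forall>v. \<lfloor>W.X j v \<omega>\<rfloor> \<in> {- 1, 1}" using fl(2) by (intro AE_I2) blast
    \<comment> \<open>The second conclusion of \<open>orig_path_prob\<close> does not mention the
      path, so a constant one serves as instance.\<close>
    show "AE \<omega> in M. \<forall>j\<ge>1. \<forall>v. X j v \<omega> \<in> {- 1, 1}" by (rule orig(2)[of "\<lambda>_ _. 1"]) auto
    show "measure M {\<omega>\<in>space M. \<forall>j\<in>{1..N}. \<forall>v. X j v \<omega> = x j v} = W.prob {\<omega>\<in>space \<Omega>. \<forall>j\<in>{1..N}. \<forall>v. \<lfloor>W.X j v \<omega>\<rfloor> = x j v}"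
      if "\<And>j v. x j v \<in> {- 1, 1}" for N x
      using orig(1)[of x N] W.walk_path_prob[of x N] that by (simp add: B)
  qed (use pM Xm SX in auto)
  let ?N = "PiM UNIV (\<lambda>_. borel) :: (nat \<Rightarrow> real ^ 'v) measure"
  \<comment> \<open>The claim prescribes pairs of sequences as sample points. So the coupling is
    replaced by the joint law of the walk and the normal vectors, with the coordinate maps as the
    new processes.\<close>
  define \<Phi> where "\<Phi> \<omega> = ((\<lambda>n. W.S n \<omega>), (\<lambda>n. W.Yv n \<omega>))" for \<omega>
  define M' where "M' = distr \<Omega> (?N \<Otimes>\<^sub>M ?N) \<Phi>"
  define S' where "S' n p = fst p n" for n and p :: "(nat \<Rightarrow> real ^ 'v) \<times> (nat \<Rightarrow> real ^ 'v)"
  define Y where "Y n p = snd p n" for n and p :: "(nat \<Rightarrow> real ^ 'v) \<times> (nat \<Rightarrow> real ^ 'v)"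
  have \<Phi>m: "\<Phi> \<in> measurable \<Omega> (?N \<Otimes>\<^sub>M ?N)"
    unfolding \<Phi>_def[abs_def] by (intro measurable_Pair measurable_PiM_single') auto
  have cm: "(\<lambda>f. f n) \<in> borel_measurable ?N" for n
    by (rule measurable_component_singleton) simp
  have S'm: "S' n \<in> borel_measurable (?N \<Otimes>\<^sub>M ?N)" for n
    unfolding S'_def[abs_def] by (rule measurable_compose[OF measurable_fst cm])
  have Ym: "Y n \<in> borel_measurable (?N \<Otimes>\<^sub>M ?N)" for n
    unfolding Y_def[abs_def] by (rule measurable_compose[OF measurable_snd cm])
  have pM': "prob_space M'" unfolding M'_def by (rule W.prob_space_distr[OF \<Phi>m])
  interpret M': prob_space M' by (rule pM')
  have S'\<Phi>: "S' n (\<Phi> \<omega>) = W.S n \<omega>" and Y\<Phi>: "Y n (\<Phi> \<omega>) = W.Yv n \<omega>" for n \<omega> by (simp_all add: S'_def Y_def \<Phi>_def)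
  have gs: "gauss_sum B Y n (\<Phi> \<omega>) = gauss_sum B W.Yv n \<omega>" for n \<omega> by (simp add: gauss_sum_def Y\<Phi>)
  have gm: "gauss_sum B Y n \<in> borel_measurable (?N \<Otimes>\<^sub>M ?N)" for n
    unfolding gauss_sum_def[abs_def]
    by (intro Borel_Space.borel_measurable_sum measurable_compose[OF Ym borel_linear_vec_mat])
  define Err where "Err n p = S' n p - gauss_sum B Y n p" for n p
  have Errm: "Err n \<in> borel_measurable (?N \<Otimes>\<^sub>M ?N)" for n
    unfolding Err_def[abs_def] by (intro borel_measurable_diff S'm gm)
  have Err\<Phi>: "Err n (\<Phi> \<omega>) = W.S n \<omega> - gauss_sum B W.Yv n \<omega>" for n \<omega>
    by (simp add: Err_def S'\<Phi> gs)
  have law': "same_law M S M' S'"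
  proof -
    have "distr M' ?N (\<lambda>\<omega> n. S' n \<omega>) = distr \<Omega> ?N (\<lambda>\<omega> n. W.S n \<omega>)"
      unfolding M'_def
      by (subst distr_distr[OF _ \<Phi>m]) (auto simp: comp_def S'\<Phi> intro!: measurable_PiM_single' S'm)
    then show ?thesis using law by (simp add: same_law_def)
  qed
  have iid: "iid_std_mvn M' Y"
    unfolding iid_std_mvn_def
  proof (intro conjI allI impI)
    have dY: "distr M' borel (Y n) = distr \<Omega> borel (W.Yv n)" for n
      unfolding M'_def by (subst distr_distr[OF Ym \<Phi>m]) (simp add: comp_def Y\<Phi>)
    have Ym': "Y n \<in> borel_measurable M'" for n unfolding M'_def using Ym[of n] by simp
    show "M'.indep_vars (\<lambda>_. borel) Y {1..}"
    proof (subst M'.indep_vars_iff_distr_eq_PiM')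
      have "distr M' (PiM {1..} (\<lambda>_. borel)) (\<lambda>x. \<lambda>i\<in>{1..}. Y i x) = distr \<Omega> (PiM {1..} (\<lambda>_. borel)) (\<lambda>x. \<lambda>i\<in>{1..}. W.Yv i x)"
        unfolding M'_def by (subst distr_distr[OF _ \<Phi>m]) (auto simp: comp_def Y\<Phi> intro!: measurable_restrict Ym)
      also have "\<dots> = PiM {1..} (\<lambda>i. distr \<Omega> borel (W.Yv i))"
        using W.Yv_indep by (subst (asm) W.indep_vars_iff_distr_eq_PiM') auto
      finally show "distr M' (PiM {1..} (\<lambda>_. borel)) (\<lambda>x. \<lambda>i\<in>{1..}. Y i x) = PiM {1..} (\<lambda>i. distr M' borel (Y i))"
        by (simp only: dY)
    qed (use Ym' in auto)
    fix n
    have "distr M' lborel (Y n) = distr M' borel (Y n)" by (rule distr_cong) simp_all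
    then show "distributed M' lborel (Y n) (\<lambda>x. ennreal (std_mvn_density x))"
      using Ym'[of n] dY[of n] W.Yv_distr[of n] measurable_compose[OF std_mvn_density_measurable measurable_ennreal]
      by (simp add: distributed_def)
  qed
  have bound: "AE \<omega> in \<Omega>. \<exists>K\<ge>0. \<forall>n\<ge>1. norm (Err n (\<Phi> \<omega>)) \<le> K * real n powr \<mu>"
    if \<mu>: "31 / 64 < \<mu>" "\<eta> \<le> \<mu>" for \<mu>
  proof -
    obtain C where C: "C \<ge> 0" "\<And>x. norm x \<le> C * (\<Sum>j\<in>UNIV. norm (pair_col x (column j T)))"
      using norm_le_sum_pair_col[OF T] by blast
    have "AE \<omega> in \<Omega>. \<forall>j. \<exists>K\<ge>0. \<forall>n\<ge>1. norm (pair_col (W.S n \<omega> - gauss_sum B W.Yv n \<omega>) (column j T)) \<le> K * real n powr \<mu>"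
      unfolding AE_all_countable
      by (intro allI W.eigcol_error_AE[OF T eig lam_half eig \<mu>(1)] order_trans[OF lam \<mu>(2)])
    then show ?thesis
    proof eventually_elim
      case (elim \<omega>)
      from choice[OF elim] obtain K where K: "\<And>j. K j \<ge> 0"
        "\<And>j n. n \<ge> 1 \<Longrightarrow> norm (pair_col (W.S n \<omega> - gauss_sum B W.Yv n \<omega>) (column j T)) \<le> K j * real n powr \<mu>" by blast
      have "norm (Err n (\<Phi> \<omega>)) \<le> C * (\<Sum>j\<in>UNIV. K j) * real n powr \<mu>" if n: "n \<ge> 1" for n
      proof -
        have "norm (Err n (\<Phi> \<omega>)) \<le> C * (\<Sum>j\<in>UNIV. norm (pair_col (Err n (\<Phi> \<omega>)) (column j T)))" by (rule C(2))
        also have "\<dots> \<le> C * (\<Sum>j\<in>UNIV. K j * real n powr \<mu>)"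
          unfolding Err\<Phi> by (intro mult_left_mono sum_mono K(2) n C(1))
        finally show ?thesis by (simp add: sum_distrib_right mult.assoc)
      qed
      moreover have "C * (\<Sum>j\<in>UNIV. K j) \<ge> 0" using C(1) K(1) by (intro mult_nonneg_nonneg sum_nonneg) auto
      ultimately show ?case by blast
    qed
  qed
  have bound': "AE \<omega> in M'. (\<lambda>n. norm (S' n \<omega> - gauss_sum B Y n \<omega>)) \<in> O(\<lambda>n. real n powr \<mu>)"
    if \<mu>: "31 / 64 < \<mu>" "\<eta> \<le> \<mu>" for \<mu>
    using AE_distr_powr_bound[OF \<Phi>m Errm bound[OF \<mu>]] unfolding M'_def Err_def .
  \<comment> \<open>The value 63/128 is halfway between 31/64 and 1/2.\<close>
  have part1: "\<exists>\<delta>>0. AE \<omega> in M'. (\<lambda>n. norm (S' n \<omega> - gauss_sum B Y n \<omega>)) \<in> O(\<lambda>n. real n powr (1 / 2 - \<delta>))"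
    if "\<eta> < 1 / 2"
    using bound'[of "max \<eta> (63 / 128)"] that by (intro exI[of _ "1 / 2 - max \<eta> (63 / 128)"]) auto
  have part2: "AE \<omega> in M'. (\<lambda>n. norm (S' n \<omega> - gauss_sum B Y n \<omega>)) \<in> O(\<lambda>n. real n powr (1 / 2))"
    using bound'[of "1 / 2"] le_half by simp
  have part3: "\<exists>(\<epsilon> :: nat \<Rightarrow> _ \<Rightarrow> real ^ 'v) (\<delta> :: 'v \<Rightarrow> real).
          (\<forall>n. \<epsilon> n \<in> borel_measurable M') \<and>
          (AE \<omega> in M'. \<forall>n\<ge>1. S' n \<omega> = gauss_sum B Y n \<omega> + \<epsilon> n \<omega> v* matrix_inv T') \<and>
          (\<forall>j. (l j < 1 / 2 \<longrightarrow> \<delta> j > 0) \<and> (l j = 1 / 2 \<longrightarrow> \<delta> j = 0)) \<and>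
          (\<forall>j. AE \<omega> in M'. (\<lambda>n. \<epsilon> n \<omega> $ j) \<in> O(\<lambda>n. real n powr (1 / 2 - \<delta> j)))"
    if T': "invertible T'" and diag': "matrix_inv T' ** B ** T' = diag_mat l" for T' :: "real ^ 'v ^ 'v" and l
  proof -
    \<comment> \<open>The coordinates of the error times \<open>T'\<close> are its pairings with the
      columns of \<open>T'\<close>, so each coordinate feels only its own eigenvalue.\<close>
    define \<epsilon> where "\<epsilon> n p = Err n p v* T'" for n p
    \<comment> \<open>At \<open>l j\<close> = 1/2 this exponent is exactly 1/2, which gives
      \<open>\<delta> j\<close> = 0; for smaller \<open>l j\<close> it is strictly less than
      1/2.\<close>
    define \<mu> where "\<mu> j = max (l j) (63 / 128)" for j
    let ?c = "\<lambda>j. column j (map_matrix complex_of_real T')"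
    have comm: "B ** T' = T' ** diag_mat l" by (rule commute_of_diag[OF T' diag'])
    have "map_matrix complex_of_real B ** map_matrix complex_of_real T' = map_matrix complex_of_real (B ** T')"
      by (simp add: vec_eq_iff matrix_matrix_mult_def map_matrix_def)
    also have "\<dots> = map_matrix complex_of_real T' ** diag_mat (\<lambda>j. complex_of_real (l j))"
      unfolding comm by (simp add: vec_eq_iff matrix_matrix_mult_def map_matrix_def diag_mat_def if_distrib cong: if_cong)
    finally have eig': "eigcol B (?c j) (complex_of_real (l j))" for j by (rule eigcol_of_commute)
    have \<epsilon>_pair: "complex_of_real (\<epsilon> n p $ j) = pair_col (Err n p) (?c j)" for n p j
      by (simp add: \<epsilon>_def pair_col_def vector_matrix_mult_def column_def map_matrix_def mult.commute)
    have \<epsilon>m: "\<epsilon> n \<in> borel_measurable (?N \<Otimes>\<^sub>M ?N)" for n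
      unfolding \<epsilon>_def[abs_def] by (rule measurable_compose[OF Errm borel_linear_vec_mat])
    have "AE \<omega> in M'. (\<lambda>n. \<epsilon> n \<omega> $ j) \<in> O(\<lambda>n. real n powr (1 / 2 - (1 / 2 - \<mu> j)))" for j
    proof -
      have "AE \<omega> in \<Omega>. \<exists>K\<ge>0. \<forall>n\<ge>1. norm (pair_col (W.S n \<omega> - gauss_sum B W.Yv n \<omega>) (?c j)) \<le> K * real n powr \<mu> j"
        by (rule W.eigcol_error_AE[OF T eig lam_half eig']) (auto simp: \<mu>_def)
      then have "AE \<omega> in \<Omega>. \<exists>K\<ge>0. \<forall>n\<ge>1. norm (\<epsilon> n (\<Phi> \<omega>) $ j) \<le> K * real n powr \<mu> j"
        unfolding Err\<Phi>[symmetric] \<epsilon>_pair[symmetric] by simp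
      from AE_distr_powr_bound[OF \<Phi>m vec_nth_measurable[OF \<epsilon>m] this]
      show ?thesis unfolding M'_def by simp
    qed
    moreover have "S' n \<omega> = gauss_sum B Y n \<omega> + \<epsilon> n \<omega> v* matrix_inv T'" for n \<omega>
      by (simp add: \<epsilon>_def vector_matrix_mul_assoc matrix_inv_right[OF T'] Err_def)
    ultimately show ?thesis
      using \<epsilon>m by (intro exI[of _ \<epsilon>] exI[of _ "\<lambda>j. 1 / 2 - \<mu> j"]) (auto simp: \<mu>_def M'_def)
  qed
  show ?thesis
    using pM' S'm law' iid part1 part2 part3
    by (intro exI[of _ M'] exI[of _ S'] exI[of _ Y]) (simp add: M'_def)
qed

end
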